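(* Let $g\geq 2$ and $n\ge 0$. The points of the topological space $\overline{M_{g,n}^{\rm trop}}$ (defined in the context) bijectively parametrize isomorphism classes of extended $n$-pointed tropical curves of genus $g$. The topological space $\overline{M_{g,n}^{\rm trop}}$ is compact and Hausdorff. Furthermore, it has pure dimension $3g-3+n$ and it is connected through codimension one.
   Context: Graphs. A graph $\Gamma$ with $n$ legs consists of a finite nonempty set $V(\Gamma)$ of vertices, a finite set $H(\Gamma)$ of half-edges, an involution $h\mapsto\overline h$ of $H(\Gamma)$ with exactly $n$ fixed points (the legs, forming the set $L(\Gamma)=\{x_1,\dots,x_n\}$, which are labeled), and an endpoint map $\epsilon:H(\Gamma)\to V(\Gamma)$. An edge is a pair $\{h,\overline h\}$ with $h\neq\overline h$; $E(\Gamma)$ is the set of edges. All graphs are connected. The valence of $v$ is $|\epsilon^{-1}(v)|$; $\Gamma$ is 3-regular if all vertices have valence 3. $b_1(\Gamma)=|E(\Gamma)|-|V(\Gamma)|+1$. Weighted graphs. A weighted graph is a pair $(\Gamma,w)$ with $w:V(\Gamma)\to\mathbb Z_{\ge 0}$; its genus is $b_1(\Gamma)+\sum_v w(v)$. It is stable if every vertex of weight 0 has valence $\ge 3$ and every vertex of weight 1 has valence $\ge 1$. $\underline 0$ denotes the zero weight function. For $S\subset E(\Gamma)$, the weighted contraction $(\Gamma_{/S},w_{/S})$ is obtained by contracting every edge of $S$ (with contraction map $\sigma:\Gamma\to\Gamma_{/S}$, so $E(\Gamma_{/S})=E(\Gamma)\smallsetminus S$ and the legs are unchanged) and setting $w_{/S}(\overline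 v)=b_1(\sigma^{-1}(\overline v))+\sum_{v\in V(\Gamma),\,\sigma(v)=\overline v}w(v)$. Extended tropical curves. An extended $n$-pointed tropical curve of genus $g$ (up to tropical equivalence) is a triple $(\Gamma,w,\ell)$ with $(\Gamma,w)$ a stable graph of genus $g$ with $n$ labeled legs and $\ell:E(\Gamma)\cup L(\Gamma)\to\mathbb R_{>0}\cup\{\infty\}$ such that $\ell(x)=\infty$ for every leg $x$ (edges may have finite or infinite length). Isomorphisms are isomorphisms of graphs (bijections on vertices and half-edges compatible with involution and endpoints) preserving weights and lengths and sending the $i$-th leg to the $i$-th leg. Moduli. $\mathbb R\cup\{\infty\}$ carries the one-point compactification topology and $\mathbb R_{\ge0}\cup\{\infty\}$ the subspace topology. For a stable $(\Gamma,w)$ put $R_\infty(\Gamma,w)=(\mathbb R_{>0}\cup\{\infty\})^{E(\Gamma)}$ and $\overline{R_\infty(\Gamma,w)}=(\mathbb R_{\ge 0}\cup\{\infty\})^{E(\Gamma)}$. A point $p=(t_e)_e\in\overline{R_\infty(\Gamma,w)}$ determines the extended tropical curve $(\Gamma_{/S},w_{/S},\ell_p)$ with $S=\{e:t_e=0\}$ and $\ell_p(e)=t_e$ for $e\notin S$. $\overline{M^{\rm trop}_\infty(\Gamma,w)}$ is the quotient space of $\overline{R_\infty(\Gamma,w)}$ identifying points whose extended tropical curves are isomorphic; $M^{\rm trop}_\infty(\Gamma,w)$ is the set of isomorphism classes of extended tropical curves with underlying weighted graph $(\Gamma,w)$. Define, with the quotient topology, $$\overline{M_{g,n}^{\rm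 trop}}=\Bigl(\bigsqcup_{\Gamma}\overline{M^{\rm trop}_\infty(\Gamma,\underline 0)}\Bigr)/\cong$$ where $\Gamma$ runs over (isomorphism classes of) 3-regular graphs with $b_1(\Gamma)=g$ and $n$ labeled legs, and $\cong$ is isomorphism of extended tropical curves. Dimension. A topological space has pure dimension $d$ if it contains a dense open subset which is an orbifold of dimension $d$ (locally the quotient of a $d$-dimensional topological manifold by a finite group). A space $X$ of pure dimension $d$ with a decomposition $X=\bigsqcup_i X_i$ into connected pieces with assigned dimensions is connected through codimension one if $\bigsqcup_{\dim X_i\ge d-1}X_i$ is connected. Here the decomposition is $\overline{M_{g,n}^{\rm trop}}=\bigsqcup_{(\Gamma,w)}M^{\rm trop}_\infty(\Gamma,w)$ over isomorphism classes of stable graphs of genus $g$ with $n$ labeled legs, where $M^{\rm trop}_\infty(\Gamma,w)$ has dimension $|E(\Gamma)|$. *)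

theory Defs
  imports "HOL-Analysis.Analysis" "HOL-Algebra.Group_Action"
begin

section \<open>Graphs with legs\<close>

text \<open>
  The field \<open>bar\<close> is the involution on half-edges and \<open>endpt\<close> the endpoint map; both are
  only meaningful on \<open>halfs\<close>. The labelling \<open>x\<^sub>1, \<dots>, x\<^sub>n\<close> of the legs is the list \<open>leg_list\<close>,
  whose length is the number of legs.
\<close>

record ('v, 'h) graph =
  verts :: "'v set"
  halfs :: "'h set"
  bar :: "'h \<Rightarrow> 'h"
  endpt :: "'h \<Rightarrow> 'v"
  leg_list :: "'h list"

definition legs :: "('v, 'h) graph \<Rightarrow> 'h set" where
  "legs \<Gamma> = {h \<in> halfs \<Gamma>. bar \<Gamma> h = h}"

definition edges :: "('v, 'h) graph \<Rightarrow> 'h set set" where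
  "edges \<Gamma> = {{h, bar \<Gamma> h} | h. h \<in> halfs \<Gamma> \<and> bar \<Gamma> h \<noteq> h}"

definition valence :: "('v, 'h) graph \<Rightarrow> 'v \<Rightarrow> nat" where
  "valence \<Gamma> v = card {h \<in> halfs \<Gamma>. endpt \<Gamma> h = v}"

definition adjacent_via :: "('v, 'h) graph \<Rightarrow> 'h set set \<Rightarrow> ('v \<times> 'v) set" where
  "adjacent_via \<Gamma> S = {(endpt \<Gamma> h, endpt \<Gamma> (bar \<Gamma> h)) | h. h \<in> halfs \<Gamma> \<and> {h, bar \<Gamma> h} \<in> S}"

definition connected_graph :: "('v, 'h) graph \<Rightarrow> bool" where
  "connected_graph \<Gamma> \<longleftrightarrow> (\<forall>u\<in>verts \<Gamma>. \<forall>v\<in>verts \<Gamma>. (u, v) \<in> (adjacent_via \<Gamma> (edges \<Gamma>))\<^sup>*)"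

definition is_graph :: "nat \<Rightarrow> ('v, 'h) graph \<Rightarrow> bool" where
  "is_graph n \<Gamma> \<longleftrightarrow>
     finite (verts \<Gamma>) \<and> verts \<Gamma> \<noteq> {} \<and> finite (halfs \<Gamma>) \<and>
     (\<forall>h\<in>halfs \<Gamma>. bar \<Gamma> h \<in> halfs \<Gamma> \<and> bar \<Gamma> (bar \<Gamma> h) = h) \<and>
     (\<forall>h\<in>halfs \<Gamma>. endpt \<Gamma> h \<in> verts \<Gamma>) \<and>
     distinct (leg_list \<Gamma>) \<and> set (leg_list \<Gamma>) = legs \<Gamma> \<and> length (leg_list \<Gamma>) = n \<and>
     connected_graph \<Gamma>"

definition b1 :: "('v, 'h) graph \<Rightarrow> int" where
  "b1 \<Gamma> = int (card (edges \<Gamma>)) - int (card (verts \<Gamma>)) + 1"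

definition three_regular :: "('v, 'h) graph \<Rightarrow> bool" where
  "three_regular \<Gamma> \<longleftrightarrow> (\<forall>v\<in>verts \<Gamma>. valence \<Gamma> v = 3)"

definition graph_isomorphism ::
    "('v, 'h) graph \<Rightarrow> ('v2, 'h2) graph \<Rightarrow> ('v \<Rightarrow> 'v2) \<Rightarrow> ('h \<Rightarrow> 'h2) \<Rightarrow> bool" where
  "graph_isomorphism \<Gamma> \<Delta> \<phi> \<psi> \<longleftrightarrow>
     bij_betw \<phi> (verts \<Gamma>) (verts \<Delta>) \<and> bij_betw \<psi> (halfs \<Gamma>) (halfs \<Delta>) \<and>
     (\<forall>h\<in>halfs \<Gamma>. \<psi> (bar \<Gamma> h) = bar \<Delta> (\<psi> h)) \<and>
     (\<forall>h\<in>halfs \<Gamma>. \<phi> (endpt \<Gamma> h) = endpt \<Delta> (\<psi> h)) \<and>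
     map \<psi> (leg_list \<Gamma>) = leg_list \<Delta>"

definition graph_iso :: "('v, 'h) graph \<Rightarrow> ('v2, 'h2) graph \<Rightarrow> bool" where
  "graph_iso \<Gamma> \<Delta> \<longleftrightarrow> (\<exists>\<phi> \<psi>. graph_isomorphism \<Gamma> \<Delta> \<phi> \<psi>)"


section \<open>Weighted graphs and weighted contractions\<close>

type_synonym ('v, 'h) wgraph = "('v, 'h) graph \<times> ('v \<Rightarrow> nat)"

definition genus :: "('v, 'h) wgraph \<Rightarrow> int" where
  "genus = (\<lambda>(\<Gamma>, w). b1 \<Gamma> + int (\<Sum>v\<in>verts \<Gamma>. w v))"

definition stable :: "('v, 'h) wgraph \<Rightarrow> bool" where
  "stable = (\<lambda>(\<Gamma>, w). \<forall>v\<in>verts \<Gamma>.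
     (w v = 0 \<longrightarrow> valence \<Gamma> v \<ge> 3) \<and> (w v = 1 \<longrightarrow> valence \<Gamma> v \<ge> 1))"

definition stable_graph :: "nat \<Rightarrow> nat \<Rightarrow> ('v, 'h) wgraph \<Rightarrow> bool" where
  "stable_graph g n = (\<lambda>(\<Gamma>, w). is_graph n \<Gamma> \<and> stable (\<Gamma>, w) \<and> genus (\<Gamma>, w) = int g)"

definition wgraph_iso :: "('v, 'h) wgraph \<Rightarrow> ('v2, 'h2) wgraph \<Rightarrow> bool" where
  "wgraph_iso = (\<lambda>(\<Gamma>, w) (\<Delta>, w').
     \<exists>\<phi> \<psi>. graph_isomorphism \<Gamma> \<Delta> \<phi> \<psi> \<and> (\<forall>v\<in>verts \<Gamma>. w' (\<phi> v) = w v))"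

text \<open>
  The vertices of a contraction are the connected components of the spanning subgraph with
  edge set \<open>S\<close>, so the contraction map \<open>\<sigma>\<close> sends \<open>v\<close> to \<open>component \<Gamma> S v\<close>.
\<close>

definition component :: "('v, 'h) graph \<Rightarrow> 'h set set \<Rightarrow> 'v \<Rightarrow> 'v set" where
  "component \<Gamma> S v = {u \<in> verts \<Gamma>. (v, u) \<in> (adjacent_via \<Gamma> S)\<^sup>*}"

definition contract :: "('v, 'h) graph \<Rightarrow> 'h set set \<Rightarrow> ('v set, 'h) graph" where
  "contract \<Gamma> S =
     \<lparr>verts = component \<Gamma> S ` verts \<Gamma>,
      halfs = {h \<in> halfs \<Gamma>. {h, bar \<Gamma> h} \<notin> S},
      bar = bar \<Gamma>,
      endpt = (\<lambda>h. component \<Gamma> S (endpt \<Gamma> h)),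
      leg_list = leg_list \<Gamma>\<rparr>"

text \<open>The graph \<open>\<sigma>\<^sup>-\<^sup>1(U)\<close>: the vertices in \<open>U\<close> and the edges of \<open>S\<close> contracted to \<open>U\<close>.\<close>

definition contraction_fibre :: "('v, 'h) graph \<Rightarrow> 'h set set \<Rightarrow> 'v set \<Rightarrow> ('v, 'h) graph" where
  "contraction_fibre \<Gamma> S U =
     \<lparr>verts = U, halfs = {h \<in> halfs \<Gamma>. {h, bar \<Gamma> h} \<in> S \<and> endpt \<Gamma> h \<in> U},
      bar = bar \<Gamma>, endpt = endpt \<Gamma>, leg_list = []\<rparr>"

text \<open>The fibres are connected, so \<open>b1\<close> is nonnegative and \<open>nat\<close> does not truncate.\<close>

definition contract_weight ::
    "('v, 'h) graph \<Rightarrow> ('v \<Rightarrow> nat) \<Rightarrow> 'h set set \<Rightarrow> 'v set \<Rightarrow> nat" where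
  "contract_weight \<Gamma> w S U = nat (b1 (contraction_fibre \<Gamma> S U)) + (\<Sum>v\<in>U. w v)"


section \<open>Extended tropical curves\<close>

text \<open>
  Elements of \<open>\<real> \<union> {\<infinity>}\<close> have type \<^typ>\<open>real option\<close>, where \<^term>\<open>None\<close> is \<open>\<infinity>\<close>; this is the
  encoding of the one-point compactification in the library. A length function is defined on
  orbits of the involution: edges \<open>{h, bar h}\<close> and legs \<open>{x}\<close>.
\<close>

definition pos_ext :: "real option set" where
  "pos_ext = insert None (Some ` {0<..})"

definition nonneg_ext :: "real option set" where
  "nonneg_ext = insert None (Some ` {0..})"

type_synonym ('v, 'h) curve = "('v, 'h) graph \<times> ('v \<Rightarrow> nat) \<times> ('h set \<Rightarrow> real option)"

definition extended_tropical_curve :: "nat \<Rightarrow> nat \<Rightarrow> ('v, 'h) curve \<Rightarrow> bool" where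
  "extended_tropical_curve g n = (\<lambda>(\<Gamma>, w, l).
     stable_graph g n (\<Gamma>, w) \<and> (\<forall>e\<in>edges \<Gamma>. l e \<in> pos_ext) \<and> (\<forall>x\<in>legs \<Gamma>. l {x} = None))"

definition curve_iso :: "('v, 'h) curve \<Rightarrow> ('v2, 'h2) curve \<Rightarrow> bool" where
  "curve_iso = (\<lambda>(\<Gamma>, w, l) (\<Delta>, w', l').
     \<exists>\<phi> \<psi>. graph_isomorphism \<Gamma> \<Delta> \<phi> \<psi> \<and>
       (\<forall>v\<in>verts \<Gamma>. w' (\<phi> v) = w v) \<and>
       (\<forall>e\<in>edges \<Gamma>. l' (\<psi> ` e) = l e) \<and>
       (\<forall>x\<in>legs \<Gamma>. l' {\<psi> x} = l {x}))"

text \<open>The curve \<open>(\<Gamma>\<^sub>/\<^sub>S, w\<^sub>/\<^sub>S, \<ell>\<^sub>p)\<close> determined by a point \<open>p = (t\<^sub>e)\<^sub>e\<close>.\<close>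

definition curve_at ::
    "('v, 'h) wgraph \<Rightarrow> ('h set \<Rightarrow> real option) \<Rightarrow> ('v set, 'h) curve" where
  "curve_at = (\<lambda>(\<Gamma>, w) t.
     let S = {e \<in> edges \<Gamma>. t e = Some 0}
     in (contract \<Gamma> S, contract_weight \<Gamma> w S,
         (\<lambda>e. if e \<in> edges \<Gamma> - S then t e else None)))"


section \<open>Quotient topologies\<close>

text \<open>
  Only used for equivalence relations \<open>r\<close> on the underlying set. A set of classes is open iff
  its preimage under \<open>x \<mapsto> [x]\<close> is open.
\<close>

definition quotient_topology :: "'a topology \<Rightarrow> ('a \<times> 'a) set \<Rightarrow> 'a set topology" where
  "quotient_topology X r =
     topology (\<lambda>U. U \<subseteq> topspace X // r \<and> openin X {x \<in> topspace X. r `` {x} \<in> U})"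

lemma openin_quotient_topology:
  "openin (quotient_topology X r) U \<longleftrightarrow>
     U \<subseteq> topspace X // r \<and> openin X {x \<in> topspace X. r `` {x} \<in> U}"
proof -
  have "istopology (\<lambda>U. U \<subseteq> topspace X // r \<and> openin X {x \<in> topspace X. r `` {x} \<in> U})"
    unfolding istopology_def
  proof (intro conjI allI impI)
    fix S T
    assume S: "S \<subseteq> topspace X // r \<and> openin X {x \<in> topspace X. r `` {x} \<in> S}"
      and T: "T \<subseteq> topspace X // r \<and> openin X {x \<in> topspace X. r `` {x} \<in> T}"
    then show "S \<inter> T \<subseteq> topspace X // r" by blast
    have "{x \<in> topspace X. r `` {x} \<in> S \<inter> T} =
        {x \<in> topspace X. r `` {x} \<in> S} \<inter> {x \<in> topspace X. r `` {x} \<in> T}" by blast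
    with S T show "openin X {x \<in> topspace X. r `` {x} \<in> S \<inter> T}"
      by (simp add: openin_Int)
  next
    fix K
    assume K: "\<forall>S\<in>K. S \<subseteq> topspace X // r \<and> openin X {x \<in> topspace X. r `` {x} \<in> S}"
    then show "\<Union>K \<subseteq> topspace X // r" by blast
    have "{x \<in> topspace X. r `` {x} \<in> \<Union>K} = (\<Union>S\<in>K. {x \<in> topspace X. r `` {x} \<in> S})" by blast
    with K show "openin X {x \<in> topspace X. r `` {x} \<in> \<Union>K}"
      by auto
  qed
  then show ?thesis
    by (simp add: quotient_topology_def)
qed

lemma topspace_quotient_topology [simp]: "topspace (quotient_topology X r) = topspace X // r"
proof
  show "topspace (quotient_topology X r) \<subseteq> topspace X // r"
    using openin_quotient_topology[of X r "topspace (quotient_topology X r)"] by blast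
  have "{x \<in> topspace X. r `` {x} \<in> topspace X // r} = topspace X"
    by (auto intro: quotientI)
  then have "openin (quotient_topology X r) (topspace X // r)"
    by (simp add: openin_quotient_topology)
  then show "topspace X // r \<subseteq> topspace (quotient_topology X r)"
    by (rule openin_subset)
qed

lemma quotient_map_quotient_topology:
  "quotient_map X (quotient_topology X r) (\<lambda>x. r `` {x})"
  by (auto simp: quotient_map_def openin_quotient_topology quotient_def)


section \<open>The moduli space\<close>

text \<open>
  Every finite graph is isomorphic to one whose vertices and half-edges are natural numbers, so
  isomorphism classes are taken among such graphs and curves.
\<close>

definition class_representatives :: "'a set \<Rightarrow> ('a \<Rightarrow> 'a \<Rightarrow> bool) \<Rightarrow> 'a set" where
  "class_representatives A R =
     (\<lambda>c. SOME x. x \<in> c) ` (A // {(x, y). x \<in> A \<and> y \<in> A \<and> R x y})"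

definition ext_halfline :: "real option topology" where
  "ext_halfline = subtopology (Alexandroff_compactification euclideanreal) nonneg_ext"

definition closed_cell :: "('v, 'h) wgraph \<Rightarrow> ('h set \<Rightarrow> real option) topology" where
  "closed_cell = (\<lambda>(\<Gamma>, w). product_topology (\<lambda>_. ext_halfline) (edges \<Gamma>))"

definition cell_quotient :: "('v, 'h) wgraph \<Rightarrow> ('h set \<Rightarrow> real option) set topology" where
  "cell_quotient G = quotient_topology (closed_cell G)
     {(s, t). s \<in> topspace (closed_cell G) \<and> t \<in> topspace (closed_cell G) \<and>
        curve_iso (curve_at G s) (curve_at G t)}"

definition three_regular_graphs :: "nat \<Rightarrow> nat \<Rightarrow> (nat, nat) graph set" where
  "three_regular_graphs g n =
     class_representatives {\<Gamma>. is_graph n \<Gamma> \<and> three_regular \<Gamma> \<and> b1 \<Gamma> = int g} graph_iso"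

definition cells_union ::
    "nat \<Rightarrow> nat \<Rightarrow> ((nat, nat) graph \<times> (nat set \<Rightarrow> real option) set) topology" where
  "cells_union g n = sum_topology (\<lambda>\<Gamma>. cell_quotient (\<Gamma>, \<lambda>_. 0)) (three_regular_graphs g n)"

text \<open>All \<open>s \<in> a\<close> determine isomorphic curves, and likewise for \<open>t \<in> b\<close>.\<close>

definition moduli_rel ::
    "nat \<Rightarrow> nat \<Rightarrow> (((nat, nat) graph \<times> (nat set \<Rightarrow> real option) set) \<times>
                  ((nat, nat) graph \<times> (nat set \<Rightarrow> real option) set)) set" where
  "moduli_rel g n =
     {((\<Gamma>, a), (\<Delta>, b)). (\<Gamma>, a) \<in> topspace (cells_union g n) \<and> (\<Delta>, b) \<in> topspace (cells_union g n) \<and>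
        (\<exists>s\<in>a. \<exists>t\<in>b. curve_iso (curve_at (\<Gamma>, \<lambda>_. 0) s) (curve_at (\<Delta>, \<lambda>_. 0) t))}"

type_synonym moduli_point = "((nat, nat) graph \<times> (nat set \<Rightarrow> real option) set) set"

definition Mbar :: "nat \<Rightarrow> nat \<Rightarrow> moduli_point topology" where
  "Mbar g n = quotient_topology (cells_union g n) (moduli_rel g n)"

definition curve_classes :: "nat \<Rightarrow> nat \<Rightarrow> (nat, nat) curve set set" where
  "curve_classes g n = {C. extended_tropical_curve g n C} //
     {(C, D). extended_tropical_curve g n C \<and> extended_tropical_curve g n D \<and> curve_iso C D}"

text \<open>The isomorphism class of the extended tropical curves represented by a point.\<close>

definition curve_class :: "nat \<Rightarrow> nat \<Rightarrow> moduli_point \<Rightarrow> (nat, nat) curve set" where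
  "curve_class g n x = {C. extended_tropical_curve g n C \<and>
     (\<exists>(\<Gamma>, a)\<in>x. \<exists>t\<in>a. curve_iso (curve_at (\<Gamma>, \<lambda>_. 0) t) C)}"

definition stable_graphs :: "nat \<Rightarrow> nat \<Rightarrow> (nat, nat) wgraph set" where
  "stable_graphs g n = class_representatives {G. stable_graph g n G} wgraph_iso"

text \<open>\<open>M\<^sub>\<infinity>\<^sup>t\<^sup>r\<^sup>o\<^sup>p(\<Gamma>, w)\<close> as a subset of the moduli space.\<close>

definition stratum :: "nat \<Rightarrow> nat \<Rightarrow> (nat, nat) wgraph \<Rightarrow> moduli_point set" where
  "stratum g n = (\<lambda>(\<Gamma>, w). {x \<in> topspace (Mbar g n). \<exists>l. (\<Gamma>, w, l) \<in> curve_class g n x})"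

definition stratum_dim :: "(nat, nat) wgraph \<Rightarrow> nat" where
  "stratum_dim = (\<lambda>(\<Gamma>, w). card (edges \<Gamma>))"


section \<open>Orbifolds, pure dimension, connectedness through codimension one\<close>

definition topological_manifold :: "nat \<Rightarrow> 'a topology \<Rightarrow> bool" where
  "topological_manifold d M \<longleftrightarrow>
     Hausdorff_space M \<and> second_countable M \<and>
     (\<forall>x\<in>topspace M. \<exists>U V. openin M U \<and> x \<in> U \<and> openin (Euclidean_space d) V \<and>
        subtopology M U homeomorphic_space subtopology (Euclidean_space d) V)"

definition orbit_space ::
    "('g, 'm) monoid_scheme \<Rightarrow> ('g \<Rightarrow> 'a \<Rightarrow> 'a) \<Rightarrow> 'a topology \<Rightarrow> 'a set topology" where
  "orbit_space G \<phi> M = quotient_topology M {(x, y). x \<in> topspace M \<and> y \<in> orbit G \<phi> x}"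

text \<open>
  The carrier types \<^typ>\<open>nat \<Rightarrow> real\<close> and \<^typ>\<open>nat\<close> below are no restriction: a second countable
  Hausdorff space has at most the cardinality of the continuum, and \<open>G\<close> is finite.
\<close>

definition orbifold :: "nat \<Rightarrow> 'a topology \<Rightarrow> bool" where
  "orbifold d X \<longleftrightarrow>
     (\<forall>x\<in>topspace X. \<exists>U (M :: (nat \<Rightarrow> real) topology) (G :: nat monoid) \<phi>.
        openin X U \<and> x \<in> U \<and> topological_manifold d M \<and>
        finite (carrier G) \<and> group_action G (topspace M) \<phi> \<and>
        (\<forall>g\<in>carrier G. homeomorphic_map M M (\<phi> g)) \<and>
        subtopology X U homeomorphic_space orbit_space G \<phi> M)"

definition pure_dimension :: "'a topology \<Rightarrow> nat \<Rightarrow> bool" where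
  "pure_dimension X d \<longleftrightarrow>
     (\<exists>U. openin X U \<and> X closure_of U = topspace X \<and> orbifold d (subtopology X U))"

definition connected_through_codim_one ::
    "'a topology \<Rightarrow> nat \<Rightarrow> 'i set \<Rightarrow> ('i \<Rightarrow> 'a set) \<Rightarrow> ('i \<Rightarrow> nat) \<Rightarrow> bool" where
  "connected_through_codim_one X d I Y \<delta> \<longleftrightarrow>
     pure_dimension X d \<and>
     disjoint_family_on Y I \<and> (\<Union>i\<in>I. Y i) = topspace X \<and> (\<forall>i\<in>I. connectedin X (Y i)) \<and>
     connectedin X (\<Union>i\<in>{i\<in>I. \<delta> i + 1 \<ge> d}. Y i)"

end

theory Submission
  imports Defs
begin

text \<open>
  Record a weight function \<open>w\<close> through the degree \<open>2 w(v) - 2 + val(v)\<close> of each vertex: a graph is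
  stable iff all degrees are positive, the degrees add up to \<open>2g - 2 + n\<close>, and weighted contraction
  is simply push-forward of degrees. Hence the codimension of a stable graph is the sum of
  \<open>deg(v) - 1 + w(v)\<close>, and as long as it is positive some vertex can be expanded by an edge, either by
  trading one unit of weight for a loop or by splitting the vertex. Iterating, every curve lies in the
  closed cell of a 3-regular graph of weight zero.

  The identifications between two closed cells are finitely many pairs of face inclusions
  of a common smaller cell, so the projection from the disjoint union of the cells is a closed map,
  which gives the Hausdorff property. Near curves with pairwise distinct finite edge lengths the
  projection is injective, which gives the dimension.

  For connectedness through codimension one, any two 3-regular graphs both contract to the graph with
  one vertex, and one shows by induction on the codimension of a graph that its 3-regular
  expansions are linked by flips: any two one-edge expansions are joined by a chain in which neighbours
  have a common expansion.
\<close>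

section \<open>Graphs, half-edge counting and stability\<close>

text \<open>Why degrees replace weights: contraction adds the Betti number of a fibre to the weight,
  so composing contractions would mean comparing Betti numbers of nested subgraphs. The degree is
  that of the canonical divisor of the weighted graph; being additive over fibres, it turns
  composition and factorization of contractions into the regrouping of a finite sum. An isomorphism
  is the contraction of no edges, so one notion carries isomorphisms, faces and expansions. It
  relates graphs over different types, because contracting replaces vertices by sets of vertices.

  The obstacle to linking expansions is a 4-valent vertex of weight zero: its three splittings are
  pairwise incompatible. In codimension one nothing but the flip itself relates them, which is why
  flips are defined through a common contraction of codimension at most one. From codimension two on
  there is room: positive weight, larger valence, or a second vertex that can be expanded.\<close>

definition leg_graph :: "nat \<Rightarrow> ('v, 'h) graph \<Rightarrow> bool" where
  "leg_graph n \<Gamma> \<longleftrightarrow>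
     finite (verts \<Gamma>) \<and> verts \<Gamma> \<noteq> {} \<and> finite (halfs \<Gamma>) \<and>
     (\<forall>h\<in>halfs \<Gamma>. bar \<Gamma> h \<in> halfs \<Gamma> \<and> bar \<Gamma> (bar \<Gamma> h) = h) \<and>
     (\<forall>h\<in>halfs \<Gamma>. endpt \<Gamma> h \<in> verts \<Gamma>) \<and>
     distinct (leg_list \<Gamma>) \<and> set (leg_list \<Gamma>) = legs \<Gamma> \<and> length (leg_list \<Gamma>) = n"

text \<open>Connectedness is kept apart from the other axioms because a contraction transports it in
  both directions, whereas the other axioms are passed on from the graph to its contraction.\<close>

lemma is_graph_iff: "is_graph n \<Gamma> \<longleftrightarrow> leg_graph n \<Gamma> \<and> connected_graph \<Gamma>"
  by (auto simp: is_graph_def leg_graph_def)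

lemma leg_graphD:
  assumes "leg_graph n \<Gamma>"
  shows "finite (verts \<Gamma>)" "verts \<Gamma> \<noteq> {}" "finite (halfs \<Gamma>)"
    "\<And>h. h \<in> halfs \<Gamma> \<Longrightarrow> bar \<Gamma> h \<in> halfs \<Gamma>"
    "\<And>h. h \<in> halfs \<Gamma> \<Longrightarrow> bar \<Gamma> (bar \<Gamma> h) = h"
    "\<And>h. h \<in> halfs \<Gamma> \<Longrightarrow> endpt \<Gamma> h \<in> verts \<Gamma>"
    "distinct (leg_list \<Gamma>)" "set (leg_list \<Gamma>) = legs \<Gamma>" "length (leg_list \<Gamma>) = n"
  using assms by (auto simp: leg_graph_def)

lemma edgesE:
  assumes "e \<in> edges \<Gamma>"
  obtains h where "h \<in> halfs \<Gamma>" "bar \<Gamma> h \<noteq> h" "e = {h, bar \<Gamma> h}"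
  using assms by (auto simp: edges_def)

lemma edges_iff:
  assumes "leg_graph n \<Gamma>" "h \<in> halfs \<Gamma>"
  shows "{h, bar \<Gamma> h} \<in> edges \<Gamma> \<longleftrightarrow> bar \<Gamma> h \<noteq> h"
proof
  assume "{h, bar \<Gamma> h} \<in> edges \<Gamma>"
  then obtain k where k: "k \<in> halfs \<Gamma>" "bar \<Gamma> k \<noteq> k" "{h, bar \<Gamma> h} = {k, bar \<Gamma> k}"
    by (auto simp: edges_def)
  then show "bar \<Gamma> h \<noteq> h" by (metis doubleton_eq_iff)
qed (use assms in \<open>auto simp: edges_def\<close>)

lemma finite_edges: "leg_graph n \<Gamma> \<Longrightarrow> finite (edges \<Gamma>)"
proof -
  assume "leg_graph n \<Gamma>"
  then have "finite ((\<lambda>h. {h, bar \<Gamma> h}) ` halfs \<Gamma>)" using leg_graphD(3) by blast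
  moreover have "edges \<Gamma> \<subseteq> (\<lambda>h. {h, bar \<Gamma> h}) ` halfs \<Gamma>" by (auto simp: edges_def)
  ultimately show ?thesis by (rule finite_subset[rotated])
qed

lemma card_orbits_of_free_involution:
  assumes "finite H" "\<And>h. h \<in> H \<Longrightarrow> b h \<in> H \<and> b (b h) = h \<and> b h \<noteq> h"
  shows "2 * card ((\<lambda>h. {h, b h}) ` H) = card H"
proof -
  have U: "\<Union>((\<lambda>h. {h, b h}) ` H) = H" using assms(2) by auto
  have "2 * card ((\<lambda>h. {h, b h}) ` H) = card (\<Union>((\<lambda>h. {h, b h}) ` H))"
  proof (rule card_partition)
    show "finite ((\<lambda>h. {h, b h}) ` H)" using assms(1) by blast
    show "finite (\<Union>((\<lambda>h. {h, b h}) ` H))" using assms(1) by (simp only: U)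
    fix c assume "c \<in> (\<lambda>h. {h, b h}) ` H"
    then show "card c = 2" using assms(2) by (force simp: card_2_iff)
  next
    fix c d assume cd: "c \<in> (\<lambda>h. {h, b h}) ` H" "d \<in> (\<lambda>h. {h, b h}) ` H" "c \<noteq> d"
    then obtain h k where hk: "h \<in> H" "k \<in> H" "c = {h, b h}" "d = {k, b k}" by auto
    have "h \<noteq> k" "h \<noteq> b k" using cd(3) assms(2)[OF hk(1)] assms(2)[OF hk(2)] hk(3,4) by fastforce+
    moreover have "k \<noteq> b h" "b h \<noteq> b k"
      using calculation assms(2)[OF hk(1)] assms(2)[OF hk(2)] by metis+
    ultimately show "c \<inter> d = {}" using hk by auto
  qed
  then show ?thesis by (simp only: U)
qed

lemma edges_eq_image: "edges \<Gamma> = (\<lambda>h. {h, bar \<Gamma> h}) ` {h \<in> halfs \<Gamma>. bar \<Gamma> h \<noteq> h}"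
  by (auto simp: edges_def)

lemma card_halfs:
  assumes "leg_graph n \<Gamma>"
  shows "card (halfs \<Gamma>) = 2 * card (edges \<Gamma>) + n"
proof -
  note D = leg_graphD[OF assms]
  have 1: "2 * card (edges \<Gamma>) = card {h \<in> halfs \<Gamma>. bar \<Gamma> h \<noteq> h}"
    unfolding edges_eq_image by (rule card_orbits_of_free_involution) (use D in auto)
  have 2: "card (legs \<Gamma>) = n" using D(7-9) distinct_card by metis
  have "halfs \<Gamma> = {h \<in> halfs \<Gamma>. bar \<Gamma> h \<noteq> h} \<union> legs \<Gamma>" by (auto simp: legs_def)
  moreover have "card ({h \<in> halfs \<Gamma>. bar \<Gamma> h \<noteq> h} \<union> legs \<Gamma>) = card {h \<in> halfs \<Gamma>. bar \<Gamma> h \<noteq> h} + card (legs \<Gamma>)"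
    by (rule card_Un_disjoint) (use D in \<open>auto simp: legs_def\<close>)
  ultimately show ?thesis using 1 2 by simp
qed

lemma sum_card_fibres:
  assumes "finite A" "finite B" "f ` A \<subseteq> B"
  shows "(\<Sum>y\<in>B. card {x \<in> A. f x = y}) = card A"
  using sum.group[OF assms, of "\<lambda>_. 1::nat"] by simp

text \<open>The degree at \<open>v\<close> of the canonical divisor of a weighted graph with legs.
  It is an integer since a vertex of small weight and valence has negative degree.\<close>

definition can_deg :: "('v, 'h) wgraph \<Rightarrow> 'v \<Rightarrow> int" where
  "can_deg = (\<lambda>(\<Gamma>, w) v. 2 * int (w v) - 2 + int (valence \<Gamma> v))"

lemma sum_valence:
  assumes "leg_graph n \<Gamma>"
  shows "(\<Sum>v\<in>verts \<Gamma>. valence \<Gamma> v) = card (halfs \<Gamma>)"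
  unfolding valence_def using leg_graphD[OF assms] by (intro sum_card_fibres) auto

text \<open>From weight 2 on, \<open>2 w - 2\<close> is at least 2 without any half-edge, matching
  the absence of a stability condition there; weights 0 and 1 give the bounds 3 and 1 on the
  valence.\<close>

lemma stable_iff_can_deg: "stable (\<Gamma>, w) \<longleftrightarrow> (\<forall>v\<in>verts \<Gamma>. can_deg (\<Gamma>, w) v \<ge> 1)"
  unfolding stable_def can_deg_def case_prod_conv
proof (intro ball_cong refl)
  fix v
  show "((w v = 0 \<longrightarrow> 3 \<le> valence \<Gamma> v) \<and> (w v = 1 \<longrightarrow> 1 \<le> valence \<Gamma> v)) =
         (1 \<le> 2 * int (w v) - 2 + int (valence \<Gamma> v))"
    by (cases "w v"; cases "w v - 1") auto
qed

lemma sum_can_deg: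
  assumes "leg_graph n \<Gamma>"
  shows "(\<Sum>v\<in>verts \<Gamma>. can_deg (\<Gamma>, w) v) = 2 * genus (\<Gamma>, w) - 2 + int n"
proof -
  have "(\<Sum>v\<in>verts \<Gamma>. can_deg (\<Gamma>, w) v) =
     2 * int (\<Sum>v\<in>verts \<Gamma>. w v) - 2 * int (card (verts \<Gamma>)) + int (\<Sum>v\<in>verts \<Gamma>. valence \<Gamma> v)"
    by (simp add: can_deg_def sum.distrib sum_subtractf sum_distrib_left algebra_simps)
  then show ?thesis
    by (simp add: sum_valence[OF assms] card_halfs[OF assms] genus_def b1_def)
qed

text \<open>Subtract the number of vertices from the degree sum \<open>2g - 2 + n\<close> and add
  the total weight \<open>g - b1\<close>; the number of vertices cancels against the one in
  \<open>b1\<close>.\<close>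

lemma card_edges_codim:
  assumes "leg_graph n \<Gamma>"
  shows "int (card (edges \<Gamma>)) + (\<Sum>v\<in>verts \<Gamma>. can_deg (\<Gamma>, w) v - 1 + int (w v)) =
     3 * genus (\<Gamma>, w) - 3 + int n"
proof -
  have "(\<Sum>v\<in>verts \<Gamma>. can_deg (\<Gamma>, w) v - 1 + int (w v)) =
    (\<Sum>v\<in>verts \<Gamma>. can_deg (\<Gamma>, w) v) - int (card (verts \<Gamma>)) + (\<Sum>v\<in>verts \<Gamma>. int (w v))"
    by (simp add: sum.distrib sum_subtractf)
  then show ?thesis
    by (simp add: sum_can_deg[OF assms] genus_def b1_def)
qed

section \<open>Contraction morphisms\<close>

definition free_halfs :: "('v, 'h) graph \<Rightarrow> 'h set set \<Rightarrow> 'h set" where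
  "free_halfs \<Gamma> S = {h \<in> halfs \<Gamma>. {h, bar \<Gamma> h} \<notin> S}"

text \<open>Weights enter only through the push-forward of degrees. As \<open>\<psi>\<close> and
  \<open>\<sigma>\<close> fix the valences of the target, the degrees determine \<open>w'\<close> on
  its vertices. The set \<open>S\<close> is part of the data because \<open>\<sigma>\<close> does
  not determine it: contracting a loop identifies no vertices.\<close>

definition contraction ::
    "('v, 'h) wgraph \<Rightarrow> ('v2, 'h2) wgraph \<Rightarrow> 'h set set \<Rightarrow> ('v \<Rightarrow> 'v2) \<Rightarrow> ('h \<Rightarrow> 'h2) \<Rightarrow> bool" where
  "contraction = (\<lambda>(\<Gamma>, w) (\<Delta>, w') S \<sigma> \<psi>.
     S \<subseteq> edges \<Gamma> \<and> \<sigma> ` verts \<Gamma> = verts \<Delta> \<and>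
     (\<forall>u\<in>verts \<Gamma>. \<forall>v\<in>verts \<Gamma>. \<sigma> u = \<sigma> v \<longleftrightarrow> (u, v) \<in> (adjacent_via \<Gamma> S)\<^sup>*) \<and>
     bij_betw \<psi> (free_halfs \<Gamma> S) (halfs \<Delta>) \<and>
     (\<forall>h\<in>free_halfs \<Gamma> S. \<psi> (bar \<Gamma> h) = bar \<Delta> (\<psi> h)) \<and>
     (\<forall>h\<in>free_halfs \<Gamma> S. endpt \<Delta> (\<psi> h) = \<sigma> (endpt \<Gamma> h)) \<and>
     map \<psi> (leg_list \<Gamma>) = leg_list \<Delta> \<and>
     (\<forall>x\<in>verts \<Delta>. can_deg (\<Delta>, w') x = (\<Sum>v | v \<in> verts \<Gamma> \<and> \<sigma> v = x. can_deg (\<Gamma>, w) v)))"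

lemma contractionD:
  assumes "contraction (\<Gamma>, w) (\<Delta>, w') S \<sigma> \<psi>"
  shows "S \<subseteq> edges \<Gamma>" "\<sigma> ` verts \<Gamma> = verts \<Delta>"
    "\<And>u v. u \<in> verts \<Gamma> \<Longrightarrow> v \<in> verts \<Gamma> \<Longrightarrow> \<sigma> u = \<sigma> v \<longleftrightarrow> (u, v) \<in> (adjacent_via \<Gamma> S)\<^sup>*"
    "bij_betw \<psi> (free_halfs \<Gamma> S) (halfs \<Delta>)"
    "\<And>h. h \<in> free_halfs \<Gamma> S \<Longrightarrow> \<psi> (bar \<Gamma> h) = bar \<Delta> (\<psi> h)"
    "\<And>h. h \<in> free_halfs \<Gamma> S \<Longrightarrow> endpt \<Delta> (\<psi> h) = \<sigma> (endpt \<Gamma> h)"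
    "map \<psi> (leg_list \<Gamma>) = leg_list \<Delta>"
    "\<And>x. x \<in> verts \<Delta> \<Longrightarrow> can_deg (\<Delta>, w') x = (\<Sum>v | v \<in> verts \<Gamma> \<and> \<sigma> v = x. can_deg (\<Gamma>, w) v)"
  using assms unfolding contraction_def case_prod_conv by blast+

lemma free_halfs_bar:
  assumes "leg_graph n \<Gamma>" "h \<in> free_halfs \<Gamma> S"
  shows "bar \<Gamma> h \<in> free_halfs \<Gamma> S"
  using assms by (auto simp: free_halfs_def leg_graphD insert_commute)

lemma legs_subset_free_halfs:
  assumes "leg_graph n \<Gamma>" "S \<subseteq> edges \<Gamma>"
  shows "legs \<Gamma> \<subseteq> free_halfs \<Gamma> S"
proof
  fix x assume x: "x \<in> legs \<Gamma>"
  then have "{x, bar \<Gamma> x} \<notin> edges \<Gamma>"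
    using edges_iff[OF assms(1), of x] by (auto simp: legs_def)
  then show "x \<in> free_halfs \<Gamma> S" using x assms(2) by (auto simp: legs_def free_halfs_def)
qed

lemma edge_subset_free_halfs:
  assumes "leg_graph n \<Gamma>" "e \<in> edges \<Gamma> - S"
  shows "e \<subseteq> free_halfs \<Gamma> S"
proof -
  obtain h where "h \<in> halfs \<Gamma>" "e = {h, bar \<Gamma> h}" using assms(2) by (auto elim: edgesE)
  then show ?thesis using assms free_halfs_bar[OF assms(1), of h S] by (auto simp: free_halfs_def)
qed

text \<open>\<open>T\<close> avoids \<open>S\<close> because \<open>\<psi>\<close> is controlled on
  the surviving half-edges only; the image of a contracted edge could be anything.\<close>

lemma contraction_edge_iff:
  assumes "contraction (\<Gamma>, w) (\<Delta>, w') S \<sigma> \<psi>" "leg_graph n \<Gamma>"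
    and "h \<in> free_halfs \<Gamma> S" "T \<subseteq> edges \<Gamma> - S"
  shows "{\<psi> h, bar \<Delta> (\<psi> h)} \<in> (`) \<psi> ` T \<longleftrightarrow> {h, bar \<Gamma> h} \<in> T"
proof -
  note C = contractionD[OF assms(1)]
  have inj: "inj_on \<psi> (free_halfs \<Gamma> S)" using C(4) by (rule bij_betw_imp_inj_on)
  have eq: "{\<psi> h, bar \<Delta> (\<psi> h)} = \<psi> ` {h, bar \<Gamma> h}" using C(5)[OF assms(3)] by simp
  have sub: "{h, bar \<Gamma> h} \<subseteq> free_halfs \<Gamma> S" using assms(3) free_halfs_bar[OF assms(2,3)] by simp
  show ?thesis
  proof
    assume "{\<psi> h, bar \<Delta> (\<psi> h)} \<in> (`) \<psi> ` T"
    then obtain e where e: "e \<in> T" "\<psi> ` {h, bar \<Gamma> h} = \<psi> ` e" using eq by auto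
    have "e \<subseteq> free_halfs \<Gamma> S" using e(1) assms(4) edge_subset_free_halfs[OF assms(2)] by blast
    then have "{h, bar \<Gamma> h} = e" using inj_on_image_eq_iff[OF inj sub] e(2) by blast
    then show "{h, bar \<Gamma> h} \<in> T" using e by simp
  next
    assume "{h, bar \<Gamma> h} \<in> T"
    then show "{\<psi> h, bar \<Delta> (\<psi> h)} \<in> (`) \<psi> ` T" unfolding eq by (rule imageI)
  qed
qed

text \<open>This bijection matches the coordinates of the cell of \<open>\<Delta>\<close> with the
  free coordinates on the face of the cell of \<open>\<Gamma>\<close> where the edges of
  \<open>S\<close> have length zero.\<close>

lemma contraction_edges:
  assumes "contraction (\<Gamma>, w) (\<Delta>, w') S \<sigma> \<psi>" "leg_graph n \<Gamma>"
  shows "bij_betw ((`) \<psi>) (edges \<Gamma> - S) (edges \<Delta>)"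
proof -
  note C = contractionD[OF assms(1)]
  have inj: "inj_on \<psi> (free_halfs \<Gamma> S)" using C(4) by (rule bij_betw_imp_inj_on)
  have sub: "\<And>e. e \<in> edges \<Gamma> - S \<Longrightarrow> e \<subseteq> free_halfs \<Gamma> S"
    using edge_subset_free_halfs[OF assms(2)] by blast
  have "inj_on ((`) \<psi>) (edges \<Gamma> - S)"
    using inj_on_image_eq_iff[OF inj] sub by (intro inj_onI) blast
  moreover have "(`) \<psi> ` (edges \<Gamma> - S) = edges \<Delta>"
  proof (intro equalityI subsetI)
    fix e' assume "e' \<in> (`) \<psi> ` (edges \<Gamma> - S)"
    then obtain e where e: "e \<in> edges \<Gamma> - S" "e' = \<psi> ` e" by auto
    then obtain h where h: "h \<in> halfs \<Gamma>" "bar \<Gamma> h \<noteq> h" "e = {h, bar \<Gamma> h}" by (auto elim: edgesE)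
    have hf: "h \<in> free_halfs \<Gamma> S" "bar \<Gamma> h \<in> free_halfs \<Gamma> S" using sub[OF e(1)] h(3) by auto
    have "\<psi> (bar \<Gamma> h) \<noteq> \<psi> h" using hf h(2) inj by (metis inj_onD)
    moreover have "\<psi> h \<in> halfs \<Delta>" using C(4) hf by (auto simp: bij_betw_def)
    ultimately show "e' \<in> edges \<Delta>" using e(2) h(3) C(5)[OF hf(1)] by (auto simp: edges_def)
  next
    fix e' assume "e' \<in> edges \<Delta>"
    then obtain k where k: "k \<in> halfs \<Delta>" "bar \<Delta> k \<noteq> k" "e' = {k, bar \<Delta> k}" by (auto elim: edgesE)
    then obtain h where h: "h \<in> free_halfs \<Gamma> S" "k = \<psi> h" using C(4) by (auto simp: bij_betw_def)
    have "bar \<Gamma> h \<noteq> h" using C(5)[OF h(1)] h(2) k(2) by metis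
    then have "{h, bar \<Gamma> h} \<in> edges \<Gamma> - S" using h(1) by (auto simp: edges_def free_halfs_def)
    moreover have "e' = \<psi> ` {h, bar \<Gamma> h}" using C(5)[OF h(1)] h(2) k(3) by simp
    ultimately show "e' \<in> (`) \<psi> ` (edges \<Gamma> - S)" by blast
  qed
  ultimately show ?thesis by (simp add: bij_betw_def)
qed

lemma card_edges_contraction:
  assumes "contraction (\<Gamma>, w) (\<Delta>, w') S \<sigma> \<psi>" "leg_graph n \<Gamma>"
  shows "card (edges \<Gamma>) = card (edges \<Delta>) + card S"
proof -
  have S: "S \<subseteq> edges \<Gamma>" "finite (edges \<Gamma>)" using contractionD(1)[OF assms(1)] finite_edges[OF assms(2)] .
  have "card (edges \<Gamma> - S) = card (edges \<Delta>)"
    using contraction_edges[OF assms] by (rule bij_betw_same_card)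
  moreover have "card (edges \<Gamma> - S) = card (edges \<Gamma>) - card S" "card S \<le> card (edges \<Gamma>)"
    using S by (auto simp: card_Diff_subset finite_subset card_mono)
  ultimately show ?thesis by simp
qed

text \<open>No leg is created: \<open>\<psi>\<close> is injective on the surviving half-edges and
  commutes with the involutions, so a fixed half-edge of \<open>\<Delta>\<close> comes from a fixed
  one of \<open>\<Gamma>\<close>.\<close>

lemma contraction_leg_graph:
  assumes "contraction (\<Gamma>, w) (\<Delta>, w') S \<sigma> \<psi>" "leg_graph n \<Gamma>"
  shows "leg_graph n \<Delta>"
proof -
  note C = contractionD[OF assms(1)]
  note D = leg_graphD[OF assms(2)]
  have inj: "inj_on \<psi> (free_halfs \<Gamma> S)" and im: "\<psi> ` free_halfs \<Gamma> S = halfs \<Delta>"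
    using C(4) by (auto simp: bij_betw_def)
  note bf = free_halfs_bar[OF assms(2)]
  have fin: "finite (free_halfs \<Gamma> S)" using D(3) by (simp add: free_halfs_def)
  have L: "legs \<Gamma> \<subseteq> free_halfs \<Gamma> S" by (rule legs_subset_free_halfs[OF assms(2) C(1)])
  have legs: "legs \<Delta> = \<psi> ` legs \<Gamma>"
  proof (intro equalityI subsetI)
    fix k assume k: "k \<in> legs \<Delta>"
    then obtain h where h: "h \<in> free_halfs \<Gamma> S" "k = \<psi> h" using im by (auto simp: legs_def)
    then have "\<psi> (bar \<Gamma> h) = \<psi> h" using C(5)[OF h(1)] k by (simp add: legs_def)
    then have "bar \<Gamma> h = h" using inj bf[OF h(1)] h(1) by (metis inj_onD)
    then show "k \<in> \<psi> ` legs \<Gamma>" using h by (auto simp: legs_def free_halfs_def)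
  next
    fix k assume "k \<in> \<psi> ` legs \<Gamma>"
    then obtain h where h: "h \<in> legs \<Gamma>" "k = \<psi> h" by auto
    then have hf: "h \<in> free_halfs \<Gamma> S" using L by auto
    then show "k \<in> legs \<Delta>" using h im C(5)[OF hf] by (auto simp: legs_def)
  qed
  show ?thesis unfolding leg_graph_def
  proof (intro conjI ballI)
    show "finite (verts \<Delta>)" "verts \<Delta> \<noteq> {}" using D(1,2) unfolding C(2)[symmetric] by simp_all
    show "finite (halfs \<Delta>)" unfolding im[symmetric] using fin by (rule finite_imageI)
    fix k assume "k \<in> halfs \<Delta>"
    then obtain h where h: "h \<in> free_halfs \<Gamma> S" "k = \<psi> h" using im by auto
    then have hh: "h \<in> halfs \<Gamma>" by (simp add: free_halfs_def)
    show "bar \<Delta> k \<in> halfs \<Delta>" using C(5)[OF h(1)] bf[OF h(1)] im h(2) by (metis imageI)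
    show "bar \<Delta> (bar \<Delta> k) = k" using C(5)[OF h(1)] C(5)[OF bf[OF h(1)]] h(2) D(5)[OF hh] by simp
    show "endpt \<Delta> k \<in> verts \<Delta>" using C(6)[OF h(1)] h(2) D(6)[OF hh] C(2) by (metis imageI)
  next
    show "distinct (leg_list \<Delta>)"
      using D(7,8) L inj C(7) by (metis distinct_map inj_on_subset)
    show "set (leg_list \<Delta>) = legs \<Delta>" using C(7) D(8) legs by (metis list.set_map)
    show "length (leg_list \<Delta>) = n" using C(7) D(9) by (metis length_map)
  qed
qed

lemma adjacent_viaI:
  "h \<in> halfs \<Gamma> \<Longrightarrow> {h, bar \<Gamma> h} \<in> S \<Longrightarrow> (endpt \<Gamma> h, endpt \<Gamma> (bar \<Gamma> h)) \<in> adjacent_via \<Gamma> S"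
  by (auto simp: adjacent_via_def)

lemma sym_adjacent_via:
  assumes "leg_graph n \<Gamma>"
  shows "sym (adjacent_via \<Gamma> S)"
proof (rule symI)
  fix u v assume "(u, v) \<in> adjacent_via \<Gamma> S"
  then obtain h where h: "h \<in> halfs \<Gamma>" "{h, bar \<Gamma> h} \<in> S" "u = endpt \<Gamma> h" "v = endpt \<Gamma> (bar \<Gamma> h)"
    by (auto simp: adjacent_via_def)
  have "(endpt \<Gamma> (bar \<Gamma> h), endpt \<Gamma> (bar \<Gamma> (bar \<Gamma> h))) \<in> adjacent_via \<Gamma> S"
    by (rule adjacent_viaI) (use h leg_graphD[OF assms] in \<open>auto simp: insert_commute\<close>)
  then show "(v, u) \<in> adjacent_via \<Gamma> S" using h leg_graphD(5)[OF assms] by simp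
qed

lemma adjacent_via_mono: "S \<subseteq> T \<Longrightarrow> adjacent_via \<Gamma> S \<subseteq> adjacent_via \<Gamma> T"
  by (auto simp: adjacent_via_def)

lemma adjacent_via_verts:
  assumes "leg_graph n \<Gamma>" "(u, v) \<in> adjacent_via \<Gamma> S"
  shows "u \<in> verts \<Gamma>" "v \<in> verts \<Gamma>"
  using assms by (auto simp: adjacent_via_def leg_graphD)

lemma reachable_verts:
  assumes "leg_graph n \<Gamma>" "(u, v) \<in> (adjacent_via \<Gamma> S)\<^sup>*" "u \<in> verts \<Gamma>"
  shows "v \<in> verts \<Gamma>"
  using assms(2,3) by (induction rule: rtrancl_induct) (auto dest: adjacent_via_verts[OF assms(1)])

text \<open>A step along an edge of \<open>T\<close> either lies in \<open>S\<close>, where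
  \<open>\<sigma>\<close> is constant, or survives as a step in \<open>\<Delta>\<close>. Conversely
  a step in \<open>\<Delta>\<close> lifts to one edge, and successive lifts are joined inside fibres
  by paths in \<open>S\<close>. The case of all edges transports connectedness; general
  \<open>T\<close> serves composition and factorization.\<close>

lemma contraction_reach:
  assumes c: "contraction (\<Gamma>, w) (\<Delta>, w') S \<sigma> \<psi>" and g: "leg_graph n \<Gamma>"
    and T: "S \<subseteq> T" "T \<subseteq> edges \<Gamma>" and ab: "a \<in> verts \<Gamma>" "b \<in> verts \<Gamma>"
  shows "(\<sigma> a, \<sigma> b) \<in> (adjacent_via \<Delta> ((`) \<psi> ` (T - S)))\<^sup>* \<longleftrightarrow> (a, b) \<in> (adjacent_via \<Gamma> T)\<^sup>*"
proof
  note C = contractionD[OF c]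
  note D = leg_graphD[OF g]
  have TS: "T - S \<subseteq> edges \<Gamma> - S" using T by auto
  show "(\<sigma> a, \<sigma> b) \<in> (adjacent_via \<Delta> ((`) \<psi> ` (T - S)))\<^sup>*" if "(a, b) \<in> (adjacent_via \<Gamma> T)\<^sup>*"
    using that
  proof (induction rule: rtrancl_induct)
    case (step y z)
    then obtain h where h: "h \<in> halfs \<Gamma>" "{h, bar \<Gamma> h} \<in> T" "y = endpt \<Gamma> h" "z = endpt \<Gamma> (bar \<Gamma> h)"
      by (auto simp: adjacent_via_def)
    show ?case
    proof (cases "{h, bar \<Gamma> h} \<in> S")
      case True
      then have "(y, z) \<in> (adjacent_via \<Gamma> S)\<^sup>*" using adjacent_viaI[OF h(1) True] h by simp
      then have "\<sigma> y = \<sigma> z" using C(3) h D(4,6) by blast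
      then show ?thesis using step by simp
    next
      case False
      then have hf: "h \<in> free_halfs \<Gamma> S" using h(1) by (simp add: free_halfs_def)
      then have "\<psi> h \<in> halfs \<Delta>" using C(4) by (auto simp: bij_betw_def)
      moreover have "{\<psi> h, bar \<Delta> (\<psi> h)} \<in> (`) \<psi> ` (T - S)"
        using contraction_edge_iff[OF c g hf TS] h(2) False by simp
      ultimately have "(endpt \<Delta> (\<psi> h), endpt \<Delta> (bar \<Delta> (\<psi> h))) \<in> adjacent_via \<Delta> ((`) \<psi> ` (T - S))"
        by (rule adjacent_viaI)
      then have "(\<sigma> y, \<sigma> z) \<in> adjacent_via \<Delta> ((`) \<psi> ` (T - S))"
        using C(5,6) hf free_halfs_bar[OF g hf] h(3,4) by metis
      then show ?thesis using step.IH by (rule rtrancl_into_rtrancl[rotated])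
    qed
  qed simp
  \<comment> \<open>The induction runs over all preimages of \<open>y\<close>, since the lifted path
    may leave a fibre at another vertex than the one where it entered.\<close>
  have "\<forall>b. b \<in> verts \<Gamma> \<longrightarrow> \<sigma> b = y \<longrightarrow> (a, b) \<in> (adjacent_via \<Gamma> T)\<^sup>*"
    if "(\<sigma> a, y) \<in> (adjacent_via \<Delta> ((`) \<psi> ` (T - S)))\<^sup>*" for y
    using that
  proof (induction rule: rtrancl_induct)
    case base
    then show ?case
      using C(3)[OF ab(1)] rtrancl_mono[OF adjacent_via_mono[OF T(1)]] by fastforce
  next
    case (step y z)
    then obtain k where k: "k \<in> halfs \<Delta>" "{k, bar \<Delta> k} \<in> (`) \<psi> ` (T - S)" "y = endpt \<Delta> k" "z = endpt \<Delta> (bar \<Delta> k)"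
      by (auto simp: adjacent_via_def)
    then obtain h where h: "h \<in> free_halfs \<Gamma> S" "k = \<psi> h" using C(4) by (auto simp: bij_betw_def)
    have hh: "h \<in> halfs \<Gamma>" using h by (simp add: free_halfs_def)
    have e: "{h, bar \<Gamma> h} \<in> T - S" using contraction_edge_iff[OF c g h(1) TS] k(2) h(2) by simp
    have y: "y = \<sigma> (endpt \<Gamma> h)" using C(6)[OF h(1)] k h by simp
    have z: "z = \<sigma> (endpt \<Gamma> (bar \<Gamma> h))"
      using C(6)[OF free_halfs_bar[OF g h(1)]] C(5)[OF h(1)] k h by simp
    have 1: "(a, endpt \<Gamma> h) \<in> (adjacent_via \<Gamma> T)\<^sup>*" using step.IH y D(6)[OF hh] by simp
    have 2: "(endpt \<Gamma> h, endpt \<Gamma> (bar \<Gamma> h)) \<in> adjacent_via \<Gamma> T" using adjacent_viaI[OF hh] e by simp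
    show ?case
    proof (intro allI impI)
      fix b assume b: "b \<in> verts \<Gamma>" "\<sigma> b = z"
      then have "(endpt \<Gamma> (bar \<Gamma> h), b) \<in> (adjacent_via \<Gamma> S)\<^sup>*"
        using C(3) z D(4,6) hh by metis
      then have "(endpt \<Gamma> (bar \<Gamma> h), b) \<in> (adjacent_via \<Gamma> T)\<^sup>*"
        using rtrancl_mono[OF adjacent_via_mono[OF T(1)]] by blast
      then show "(a, b) \<in> (adjacent_via \<Gamma> T)\<^sup>*" using 1 2 by (meson rtrancl_into_rtrancl rtrancl_trans)
    qed
  qed
  then show "(\<sigma> a, \<sigma> b) \<in> (adjacent_via \<Delta> ((`) \<psi> ` (T - S)))\<^sup>* \<Longrightarrow> (a, b) \<in> (adjacent_via \<Gamma> T)\<^sup>*"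
    using ab(2) by blast
qed

lemma contraction_is_graph_iff:
  assumes "contraction (\<Gamma>, w) (\<Delta>, w') S \<sigma> \<psi>" "leg_graph n \<Gamma>"
  shows "is_graph n \<Delta> \<longleftrightarrow> is_graph n \<Gamma>"
proof -
  note C = contractionD[OF assms(1)]
  have "(`) \<psi> ` (edges \<Gamma> - S) = edges \<Delta>" using contraction_edges[OF assms] by (simp add: bij_betw_def)
  then have "connected_graph \<Delta> \<longleftrightarrow> connected_graph \<Gamma>"
    using contraction_reach[OF assms C(1) subset_refl]
    by (simp add: connected_graph_def C(2)[symmetric])
  then show ?thesis using contraction_leg_graph[OF assms] assms(2) by (simp add: is_graph_iff)
qed

lemma sum_can_deg_contraction:
  assumes "contraction (\<Gamma>, w) (\<Delta>, w') S \<sigma> \<psi>" "leg_graph n \<Gamma>"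
  shows "(\<Sum>x\<in>verts \<Delta>. can_deg (\<Delta>, w') x) = (\<Sum>v\<in>verts \<Gamma>. can_deg (\<Gamma>, w) v)"
proof -
  note C = contractionD[OF assms(1)]
  have "(\<Sum>x\<in>verts \<Delta>. can_deg (\<Delta>, w') x) =
      (\<Sum>x\<in>verts \<Delta>. \<Sum>v | v \<in> verts \<Gamma> \<and> \<sigma> v = x. can_deg (\<Gamma>, w) v)"
    using C(8) by (rule sum.cong[OF refl])
  also have "\<dots> = (\<Sum>v\<in>verts \<Gamma>. can_deg (\<Gamma>, w) v)"
    using leg_graphD(1)[OF assms(2)] leg_graphD(1)[OF contraction_leg_graph[OF assms]] C(2)
    by (intro sum.group) simp_all
  finally show ?thesis .
qed

text \<open>The degree sum \<open>2g - 2 + n\<close> is preserved and determines the genus, so no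
  Betti number of the contracted graph has to be computed.\<close>

lemma genus_contraction:
  assumes "contraction (\<Gamma>, w) (\<Delta>, w') S \<sigma> \<psi>" "leg_graph n \<Gamma>"
  shows "genus (\<Delta>, w') = genus (\<Gamma>, w)"
  using sum_can_deg_contraction[OF assms] sum_can_deg[OF assms(2), of w]
    sum_can_deg[OF contraction_leg_graph[OF assms], of w'] by simp

lemma stable_graphD:
  assumes "stable_graph g n (\<Gamma>, w)"
  shows "is_graph n \<Gamma>" "leg_graph n \<Gamma>" "\<And>v. v \<in> verts \<Gamma> \<Longrightarrow> can_deg (\<Gamma>, w) v \<ge> 1" "genus (\<Gamma>, w) = int g"
  using assms by (auto simp: stable_graph_def is_graph_iff stable_iff_can_deg)

lemma stable_graph_contraction:
  assumes "contraction (\<Gamma>, w) (\<Delta>, w') S \<sigma> \<psi>" "stable_graph g n (\<Gamma>, w)"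
  shows "stable_graph g n (\<Delta>, w')"
proof -
  note C = contractionD[OF assms(1)]
  note s = stable_graphD[OF assms(2)]
  have "can_deg (\<Delta>, w') x \<ge> 1" if x: "x \<in> verts \<Delta>" for x
  proof -
    obtain v where v: "v \<in> verts \<Gamma>" "\<sigma> v = x" using x unfolding C(2)[symmetric] by blast
    have "can_deg (\<Gamma>, w) v \<le> (\<Sum>v | v \<in> verts \<Gamma> \<and> \<sigma> v = x. can_deg (\<Gamma>, w) v)"
    proof (rule member_le_sum)
      show "0 \<le> can_deg (\<Gamma>, w) u" if "u \<in> {v \<in> verts \<Gamma>. \<sigma> v = x} - {v}" for u
        using s(3)[of u] that by simp
    qed (use v leg_graphD(1)[OF s(2)] in auto)
    then show ?thesis using s(3)[OF v(1)] C(8)[OF x] by simp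
  qed
  then show ?thesis
    using s contraction_is_graph_iff[OF assms(1) s(2)] genus_contraction[OF assms(1) s(2)]
    by (simp add: stable_graph_def stable_iff_can_deg)
qed

text \<open>In this direction positivity of the degrees has to be supplied: the degree of a vertex
  of \<open>\<Delta>\<close> is a sum over its fibre and does not bound the single summands.\<close>

lemma stable_graph_expansion:
  assumes "contraction (\<Gamma>, w) (\<Delta>, w') S \<sigma> \<psi>" "stable_graph g n (\<Delta>, w')" "leg_graph n \<Gamma>"
    and "\<And>v. v \<in> verts \<Gamma> \<Longrightarrow> can_deg (\<Gamma>, w) v \<ge> 1"
  shows "stable_graph g n (\<Gamma>, w)"
  using assms(2,4) contraction_is_graph_iff[OF assms(1,3)] genus_contraction[OF assms(1,3)]
  by (simp add: stable_graph_def stable_iff_can_deg)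

lemma image_preimage_subset: "f ` A = B \<Longrightarrow> T \<subseteq> B \<Longrightarrow> f ` {x \<in> A. f x \<in> T} = T"
  by auto

text \<open>An edge disappears in the composite if it lies in \<open>S\<close> or if its surviving
  image lies in \<open>T\<close>. The fibres are connected as required by
  \<open>contraction_reach\<close>, and degrees are summed over a fibre of the composite in two
  stages.\<close>

lemma contraction_comp:
  assumes c1: "contraction (\<Gamma>, w) (\<Delta>, w') S \<sigma> \<psi>" and c2: "contraction (\<Delta>, w') (\<Theta>, w'') T \<tau> \<rho>"
    and g: "leg_graph n \<Gamma>"
  shows "contraction (\<Gamma>, w) (\<Theta>, w'') (S \<union> {e \<in> edges \<Gamma> - S. \<psi> ` e \<in> T}) (\<tau> \<circ> \<sigma>) (\<rho> \<circ> \<psi>)"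
proof -
  note C1 = contractionD[OF c1] and C2 = contractionD[OF c2]
  note D1 = leg_graphD[OF g]
  have g2: "leg_graph n \<Delta>" by (rule contraction_leg_graph[OF c1 g])
  note D2 = leg_graphD[OF g2]
  let ?T' = "{e \<in> edges \<Gamma> - S. \<psi> ` e \<in> T}"
  let ?U = "S \<union> ?T'"
  have US: "?U - S = ?T'" by auto
  have U: "S \<subseteq> ?U" "?U \<subseteq> edges \<Gamma>" using C1(1) by auto
  have im: "(`) \<psi> ` (?U - S) = T"
  proof -
    have "(`) \<psi> ` (edges \<Gamma> - S) = edges \<Delta>" using contraction_edges[OF c1 g] by (simp add: bij_betw_def)
    then show ?thesis unfolding US using C2(1) by (rule image_preimage_subset)
  qed
  have free: "h \<in> free_halfs \<Gamma> ?U \<longleftrightarrow> h \<in> free_halfs \<Gamma> S \<and> \<psi> h \<in> free_halfs \<Delta> T" for h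
  proof (cases "h \<in> free_halfs \<Gamma> S")
    case True
    then have "\<psi> h \<in> halfs \<Delta>" using C1(4) by (auto simp: bij_betw_def)
    then have "\<psi> h \<in> free_halfs \<Delta> T \<longleftrightarrow> {\<psi> h, bar \<Delta> (\<psi> h)} \<notin> (`) \<psi> ` (?U - S)"
      using im by (simp add: free_halfs_def)
    also have "\<dots> \<longleftrightarrow> {h, bar \<Gamma> h} \<notin> ?U - S"
      using contraction_edge_iff[OF c1 g True, of "?U - S"] U(2) by blast
    finally show ?thesis using True by (auto simp: free_halfs_def)
  qed (auto simp: free_halfs_def)
  have bij: "bij_betw (\<rho> \<circ> \<psi>) (free_halfs \<Gamma> ?U) (halfs \<Theta>)"
  proof (rule bij_betw_trans[OF _ C2(4)])
    have "\<psi> ` {h \<in> free_halfs \<Gamma> S. \<psi> h \<in> free_halfs \<Delta> T} = free_halfs \<Delta> T"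
      using C1(4) by (intro image_preimage_subset) (auto simp: bij_betw_def free_halfs_def)
    moreover have "free_halfs \<Gamma> ?U = {h \<in> free_halfs \<Gamma> S. \<psi> h \<in> free_halfs \<Delta> T}" using free by auto
    ultimately have "\<psi> ` free_halfs \<Gamma> ?U = free_halfs \<Delta> T" by simp
    moreover have "inj_on \<psi> (free_halfs \<Gamma> ?U)"
      using C1(4) free by (auto simp: bij_betw_def inj_on_def)
    ultimately show "bij_betw \<psi> (free_halfs \<Gamma> ?U) (free_halfs \<Delta> T)" by (simp add: bij_betw_def)
  qed
  have "(\<tau> (\<sigma> u) = \<tau> (\<sigma> v)) = ((u, v) \<in> (adjacent_via \<Gamma> ?U)\<^sup>*)" if "u \<in> verts \<Gamma>" "v \<in> verts \<Gamma>" for u v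
    using contraction_reach[OF c1 g U that] C2(3) C1(2) that unfolding im by blast
  moreover have "can_deg (\<Theta>, w'') x = (\<Sum>v | v \<in> verts \<Gamma> \<and> (\<tau> \<circ> \<sigma>) v = x. can_deg (\<Gamma>, w) v)"
    if x: "x \<in> verts \<Theta>" for x
  proof -
    have "can_deg (\<Theta>, w'') x = (\<Sum>y | y \<in> verts \<Delta> \<and> \<tau> y = x. can_deg (\<Delta>, w') y)" by (rule C2(8)[OF x])
    also have "\<dots> = (\<Sum>y | y \<in> verts \<Delta> \<and> \<tau> y = x. \<Sum>v | v \<in> verts \<Gamma> \<and> \<sigma> v = y. can_deg (\<Gamma>, w) v)"
      by (rule sum.cong) (use C1(8) in auto)
    also have "\<dots> = (\<Sum>y | y \<in> verts \<Delta> \<and> \<tau> y = x.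
        \<Sum>v | v \<in> {v \<in> verts \<Gamma>. \<tau> (\<sigma> v) = x} \<and> \<sigma> v = y. can_deg (\<Gamma>, w) v)"
      by (intro sum.cong refl) auto
    also have "\<dots> = (\<Sum>v | v \<in> verts \<Gamma> \<and> \<tau> (\<sigma> v) = x. can_deg (\<Gamma>, w) v)"
    proof (rule sum.group)
      show "\<sigma> ` {v \<in> verts \<Gamma>. \<tau> (\<sigma> v) = x} \<subseteq> {y \<in> verts \<Delta>. \<tau> y = x}"
        unfolding C1(2)[symmetric] by auto
    qed (use D1(1) D2(1) in simp_all)
    finally show ?thesis by simp
  qed
  moreover have "(\<rho> \<circ> \<psi>) (bar \<Gamma> h) = bar \<Theta> ((\<rho> \<circ> \<psi>) h)"
    "endpt \<Theta> ((\<rho> \<circ> \<psi>) h) = (\<tau> \<circ> \<sigma>) (endpt \<Gamma> h)" if "h \<in> free_halfs \<Gamma> ?U" for h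
    using C1(5,6)[of h] C2(5,6)[of "\<psi> h"] free[of h] that by simp_all
  moreover have "map (\<rho> \<circ> \<psi>) (leg_list \<Gamma>) = leg_list \<Theta>" using C1(7) C2(7) by (metis map_map)
  moreover have "(\<tau> \<circ> \<sigma>) ` verts \<Gamma> = verts \<Theta>" using C1(2) C2(2) by (metis image_comp)
  ultimately show ?thesis
    unfolding contraction_def case_prod_conv using U(2) bij by simp
qed

text \<open>Any section of \<open>\<sigma>\<close> will do, because \<open>\<tau>\<close> is
  constant on the components of \<open>S\<close> when \<open>S \<subseteq> T\<close>. The case
  \<open>S = T\<close> says that contracting \<open>S\<close> is unique up to isomorphism.\<close>

lemma contraction_factor:
  assumes c1: "contraction (\<Gamma>, w) (\<Delta>, w') S \<sigma> \<psi>" and c2: "contraction (\<Gamma>, w) (\<Theta>, w'') T \<tau> \<rho>"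
    and ST: "S \<subseteq> T" and g: "leg_graph n \<Gamma>"
  shows "contraction (\<Delta>, w') (\<Theta>, w'') ((`) \<psi> ` (T - S)) (\<tau> \<circ> inv_into (verts \<Gamma>) \<sigma>)
     (\<rho> \<circ> inv_into (free_halfs \<Gamma> S) \<psi>)"
proof -
  note C1 = contractionD[OF c1] and C2 = contractionD[OF c2]
  note D1 = leg_graphD[OF g]
  have g2: "leg_graph n \<Delta>" by (rule contraction_leg_graph[OF c1 g])
  note D2 = leg_graphD[OF g2]
  let ?\<tau> = "\<tau> \<circ> inv_into (verts \<Gamma>) \<sigma>"
  let ?\<rho> = "\<rho> \<circ> inv_into (free_halfs \<Gamma> S) \<psi>"
  have inj: "inj_on \<psi> (free_halfs \<Gamma> S)" and im: "\<psi> ` free_halfs \<Gamma> S = halfs \<Delta>"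
    using C1(4) by (auto simp: bij_betw_def)
  have \<rho>: "?\<rho> (\<psi> h) = \<rho> h" if "h \<in> free_halfs \<Gamma> S" for h using inj that by simp
  have \<tau>: "?\<tau> (\<sigma> v) = \<tau> v" if v: "v \<in> verts \<Gamma>" for v
  proof -
    have i: "inv_into (verts \<Gamma>) \<sigma> (\<sigma> v) \<in> verts \<Gamma>" "\<sigma> (inv_into (verts \<Gamma>) \<sigma> (\<sigma> v)) = \<sigma> v"
      using v by (auto simp: inv_into_into f_inv_into_f)
    then have "(inv_into (verts \<Gamma>) \<sigma> (\<sigma> v), v) \<in> (adjacent_via \<Gamma> T)\<^sup>*"
      using C1(3)[OF i(1) v] rtrancl_mono[OF adjacent_via_mono[OF ST]] by blast
    then show ?thesis using C2(3)[OF i(1) v] by simp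
  qed
  have TS: "T - S \<subseteq> edges \<Gamma> - S" using C2(1) by auto
  have free: "\<psi> h \<in> free_halfs \<Delta> ((`) \<psi> ` (T - S)) \<longleftrightarrow> h \<in> free_halfs \<Gamma> T" if "h \<in> free_halfs \<Gamma> S" for h
  proof -
    have "\<psi> h \<in> halfs \<Delta>" using im that by blast
    then show ?thesis using contraction_edge_iff[OF c1 g that TS] that by (auto simp: free_halfs_def)
  qed
  have TfS: "free_halfs \<Gamma> T \<subseteq> free_halfs \<Gamma> S" using ST by (auto simp: free_halfs_def)
  have freeim: "free_halfs \<Delta> ((`) \<psi> ` (T - S)) = \<psi> ` free_halfs \<Gamma> T"
  proof (intro equalityI subsetI)
    fix k assume k: "k \<in> free_halfs \<Delta> ((`) \<psi> ` (T - S))"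
    then have "k \<in> \<psi> ` free_halfs \<Gamma> S" unfolding im by (simp add: free_halfs_def)
    then obtain h where "h \<in> free_halfs \<Gamma> S" "k = \<psi> h" by blast
    then show "k \<in> \<psi> ` free_halfs \<Gamma> T" using free k by blast
  qed (use free TfS in blast)
  have bij: "bij_betw ?\<rho> (\<psi> ` free_halfs \<Gamma> T) (halfs \<Theta>)"
  proof -
    have "bij_betw (inv_into (free_halfs \<Gamma> S) \<psi>) (\<psi> ` free_halfs \<Gamma> T) (free_halfs \<Gamma> T)"
    proof (rule bij_betw_byWitness[where f' = \<psi>])
      show "\<forall>a\<in>\<psi> ` free_halfs \<Gamma> T. \<psi> (inv_into (free_halfs \<Gamma> S) \<psi> a) = a"
        using TfS by (auto intro!: f_inv_into_f)
    qed (use TfS inj in \<open>auto simp: subset_iff\<close>)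
    then show ?thesis using C2(4) by (rule bij_betw_trans)
  qed
  have legs: "set (leg_list \<Gamma>) \<subseteq> free_halfs \<Gamma> S"
    using D1(8) legs_subset_free_halfs[OF g C1(1)] by simp
  show ?thesis
    unfolding contraction_def case_prod_conv freeim
  proof (intro conjI ballI)
    show "(`) \<psi> ` (T - S) \<subseteq> edges \<Delta>" using contraction_edges[OF c1 g] TS by (auto simp: bij_betw_def)
    have "?\<tau> ` verts \<Delta> = (\<lambda>v. ?\<tau> (\<sigma> v)) ` verts \<Gamma>" unfolding C1(2)[symmetric] by (rule image_image)
    then show "?\<tau> ` verts \<Delta> = verts \<Theta>" using \<tau> C2(2) by auto
    show "bij_betw ?\<rho> (\<psi> ` free_halfs \<Gamma> T) (halfs \<Theta>)" by (rule bij)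
    have "map ?\<rho> (leg_list \<Delta>) = map (\<lambda>h. ?\<rho> (\<psi> h)) (leg_list \<Gamma>)" unfolding C1(7)[symmetric] by simp
    also have "\<dots> = map \<rho> (leg_list \<Gamma>)" using \<rho> legs by (intro map_cong) auto
    finally show "map ?\<rho> (leg_list \<Delta>) = leg_list \<Theta>" using C2(7) by simp
  next
    fix a b assume "a \<in> verts \<Delta>" "b \<in> verts \<Delta>"
    then obtain u v where uv: "u \<in> verts \<Gamma>" "v \<in> verts \<Gamma>" "a = \<sigma> u" "b = \<sigma> v" unfolding C1(2)[symmetric] by blast
    show "(?\<tau> a = ?\<tau> b) = ((a, b) \<in> (adjacent_via \<Delta> ((`) \<psi> ` (T - S)))\<^sup>*)"
      using contraction_reach[OF c1 g ST C2(1) uv(1,2)] C2(3)[OF uv(1,2)] \<tau> uv by simp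
  next
    fix k assume "k \<in> \<psi> ` free_halfs \<Gamma> T"
    then obtain h where h: "h \<in> free_halfs \<Gamma> T" "k = \<psi> h" by auto
    have hS: "h \<in> free_halfs \<Gamma> S" using h TfS by auto
    have "h \<in> halfs \<Gamma>" using h by (simp add: free_halfs_def)
    then show "endpt \<Theta> (?\<rho> k) = ?\<tau> (endpt \<Delta> k)"
      using C2(6)[OF h(1)] C1(6)[OF hS] \<rho>[OF hS] \<tau> h(2) D1(6) by metis
    show "?\<rho> (bar \<Delta> k) = bar \<Theta> (?\<rho> k)"
      using C2(5)[OF h(1)] C1(5)[OF hS] \<rho> hS free_halfs_bar[OF g hS] h(2) by metis
  next
    fix x assume x: "x \<in> verts \<Theta>"
    have "can_deg (\<Theta>, w'') x = (\<Sum>v | v \<in> verts \<Gamma> \<and> \<tau> v = x. can_deg (\<Gamma>, w) v)" by (rule C2(8)[OF x])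
    also have "\<dots> = (\<Sum>y | y \<in> verts \<Delta> \<and> ?\<tau> y = x.
        \<Sum>v | v \<in> {v \<in> verts \<Gamma>. \<tau> v = x} \<and> \<sigma> v = y. can_deg (\<Gamma>, w) v)"
    proof (rule sum.group[symmetric])
      show "\<sigma> ` {v \<in> verts \<Gamma>. \<tau> v = x} \<subseteq> {y \<in> verts \<Delta>. ?\<tau> y = x}"
        unfolding C1(2)[symmetric] using \<tau> by auto
    qed (use D1(1) D2(1) in simp_all)
    also have "\<dots> = (\<Sum>y | y \<in> verts \<Delta> \<and> ?\<tau> y = x. can_deg (\<Delta>, w') y)"
    proof (rule sum.cong[OF refl])
      fix y assume y: "y \<in> {y \<in> verts \<Delta>. ?\<tau> y = x}"
      have "{v. v \<in> {v \<in> verts \<Gamma>. \<tau> v = x} \<and> \<sigma> v = y} = {v. v \<in> verts \<Gamma> \<and> \<sigma> v = y}"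
        using y \<tau> by auto
      then show "(\<Sum>v | v \<in> {v \<in> verts \<Gamma>. \<tau> v = x} \<and> \<sigma> v = y. can_deg (\<Gamma>, w) v) = can_deg (\<Delta>, w') y"
        using C1(8) y by simp
    qed
    finally show "can_deg (\<Theta>, w'') x = (\<Sum>y | y \<in> verts \<Delta> \<and> ?\<tau> y = x. can_deg (\<Delta>, w') y)" .
  qed
qed

section \<open>Weighted contractions are contraction morphisms\<close>

lemma component_eq_iff:
  assumes "leg_graph n \<Gamma>" "u \<in> verts \<Gamma>" "v \<in> verts \<Gamma>"
  shows "component \<Gamma> S u = component \<Gamma> S v \<longleftrightarrow> (u, v) \<in> (adjacent_via \<Gamma> S)\<^sup>*"
proof
  have sym: "sym ((adjacent_via \<Gamma> S)\<^sup>*)" by (rule sym_rtrancl[OF sym_adjacent_via[OF assms(1)]])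
  show "(u, v) \<in> (adjacent_via \<Gamma> S)\<^sup>*" if "component \<Gamma> S u = component \<Gamma> S v"
  proof -
    have "v \<in> component \<Gamma> S v" using assms(3) by (simp add: component_def)
    then show ?thesis unfolding that[symmetric] by (simp add: component_def)
  qed
  show "component \<Gamma> S u = component \<Gamma> S v" if uv: "(u, v) \<in> (adjacent_via \<Gamma> S)\<^sup>*"
    using uv symD[OF sym uv] by (auto simp: component_def intro: rtrancl_trans)
qed

lemma in_component_iff:
  assumes "leg_graph n \<Gamma>" "u \<in> verts \<Gamma>" "v \<in> verts \<Gamma>"
  shows "v \<in> component \<Gamma> S u \<longleftrightarrow> component \<Gamma> S v = component \<Gamma> S u"
  using component_eq_iff[OF assms] assms(3) by (auto simp: component_def)

lemma component_bar:
  assumes "leg_graph n \<Gamma>" "h \<in> halfs \<Gamma>" "{h, bar \<Gamma> h} \<in> S"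
  shows "component \<Gamma> S (endpt \<Gamma> (bar \<Gamma> h)) = component \<Gamma> S (endpt \<Gamma> h)"
  using component_eq_iff[OF assms(1), of "endpt \<Gamma> h" "endpt \<Gamma> (bar \<Gamma> h)" S] adjacent_viaI[OF assms(2,3)]
    leg_graphD[OF assms(1)] assms(2) by auto

text \<open>Every vertex other than the root owns the edge by which a shortest path enters it.\<close>

lemma card_component_le:
  assumes g: "leg_graph n \<Gamma>" and S: "S \<subseteq> edges \<Gamma>" and r: "r \<in> verts \<Gamma>"
  shows "card (component \<Gamma> S r) \<le> card (edges (contraction_fibre \<Gamma> S (component \<Gamma> S r))) + 1"
proof -
  note D = leg_graphD[OF g]
  let ?A = "adjacent_via \<Gamma> S" and ?U = "component \<Gamma> S r"
  let ?F = "contraction_fibre \<Gamma> S ?U"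
  define d where "d v = (LEAST k. (r, v) \<in> ?A ^^ k)" for v
  have dI: "(r, v) \<in> ?A ^^ d v" if v: "v \<in> ?U" for v
  proof -
    obtain k where "(r, v) \<in> ?A ^^ k"
      using v by (auto simp: component_def dest: rtrancl_imp_relpow)
    then show ?thesis unfolding d_def by (rule LeastI)
  qed
  have d_le: "d v \<le> k" if "(r, v) \<in> ?A ^^ k" for v k
    unfolding d_def using that by (rule Least_le)
  have "\<exists>h. h \<in> halfs \<Gamma> \<and> {h, bar \<Gamma> h} \<in> S \<and> endpt \<Gamma> (bar \<Gamma> h) = v \<and> endpt \<Gamma> h \<in> ?U \<and> d v = Suc (d (endpt \<Gamma> h))"
    if v: "v \<in> ?U - {r}" for v
  proof -
    have rv: "(r, v) \<in> ?A ^^ d v" using dI v by blast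
    obtain k where k: "d v = Suc k" using rv v by (cases "d v") auto
    then obtain u where u: "(r, u) \<in> ?A ^^ k" "(u, v) \<in> ?A" using rv by auto
    have uU: "u \<in> ?U"
      using relpow_imp_rtrancl[OF u(1)] reachable_verts[OF g _ r] by (auto simp: component_def)
    have "(r, v) \<in> ?A ^^ Suc (d u)" using dI[OF uU] u(2) by auto
    then have "d v \<le> Suc (d u)" by (rule d_le)
    then have "d u = k" using d_le[OF u(1)] k by simp
    then show ?thesis using u(2) uU k by (auto simp: adjacent_via_def)
  qed
  then obtain f where f: "\<And>v. v \<in> ?U - {r} \<Longrightarrow> f v \<in> halfs \<Gamma> \<and> {f v, bar \<Gamma> (f v)} \<in> S \<and>
      endpt \<Gamma> (bar \<Gamma> (f v)) = v \<and> endpt \<Gamma> (f v) \<in> ?U \<and> d v = Suc (d (endpt \<Gamma> (f v)))"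
    by metis
  have inj: "inj_on (\<lambda>v. {f v, bar \<Gamma> (f v)}) (?U - {r})"
  proof (rule inj_onI)
    fix u v assume u: "u \<in> ?U - {r}" and v: "v \<in> ?U - {r}" and eq: "{f u, bar \<Gamma> (f u)} = {f v, bar \<Gamma> (f v)}"
    show "u = v"
    proof (cases "f u = f v")
      case True
      then show ?thesis using f[OF u] f[OF v] by metis
    next
      case False
      then have "f u = bar \<Gamma> (f v)" "bar \<Gamma> (f u) = f v" using eq by (auto simp: doubleton_eq_iff)
      \<comment> \<open>The two vertices would own one edge from opposite ends, and each distance
        would exceed the other.\<close>
      then have "d u = Suc (d v)" "d v = Suc (d u)" using f[OF u] f[OF v] by metis+
      then show ?thesis by simp
    qed
  qed
  have "(\<lambda>v. {f v, bar \<Gamma> (f v)}) ` (?U - {r}) \<subseteq> edges ?F"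
  proof (rule image_subsetI)
    fix v assume v: "v \<in> ?U - {r}"
    have "bar \<Gamma> (f v) \<noteq> f v" using f[OF v] edges_iff[OF g] S by blast
    then show "{f v, bar \<Gamma> (f v)} \<in> edges ?F" using f[OF v] by (auto simp: edges_def contraction_fibre_def)
  qed
  moreover have "finite (edges ?F)"
    using D(3) unfolding edges_eq_image by (auto simp: contraction_fibre_def)
  ultimately have "card (?U - {r}) \<le> card (edges ?F)" using card_inj_on_le[OF inj] by blast
  moreover have "finite ?U" using D(1) by (simp add: component_def)
  ultimately show ?thesis by (simp add: card_Diff_singleton_if split: if_splits)
qed

text \<open>The link between degrees and the weight formula of the definition. Every edge of the
  fibre has two half-edges over \<open>U\<close>, so twice the Betti number is the number of these
  half-edges minus \<open>2 * card U\<close> plus 2. By \<open>card_component_le\<close> the Betti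
  number is nonnegative, so \<open>nat\<close> loses nothing, and the terms combine to the degree
  sum over \<open>U\<close>.\<close>

lemma contraction_contract:
  assumes g: "leg_graph n \<Gamma>" and S: "S \<subseteq> edges \<Gamma>"
  shows "contraction (\<Gamma>, w) (contract \<Gamma> S, contract_weight \<Gamma> w S) S (component \<Gamma> S) id"
proof -
  note D = leg_graphD[OF g]
  let ?c = "component \<Gamma> S"
  have "can_deg (contract \<Gamma> S, contract_weight \<Gamma> w S) U = (\<Sum>v | v \<in> verts \<Gamma> \<and> ?c v = U. can_deg (\<Gamma>, w) v)"
    if U': "U \<in> ?c ` verts \<Gamma>" for U
  proof -
    obtain r where r: "r \<in> verts \<Gamma>" "U = ?c r" using U' by auto
    let ?F = "contraction_fibre \<Gamma> S U"
    let ?HS = "{h \<in> halfs \<Gamma>. {h, bar \<Gamma> h} \<in> S \<and> endpt \<Gamma> h \<in> U}"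
    let ?HF = "{h \<in> halfs \<Gamma>. {h, bar \<Gamma> h} \<notin> S \<and> endpt \<Gamma> h \<in> U}"
    have U: "{v. v \<in> verts \<Gamma> \<and> ?c v = U} = U"
      using in_component_iff[OF g r(1)] r by (auto simp: component_def)
    have Uv: "v \<in> U \<longleftrightarrow> ?c v = U" if "v \<in> verts \<Gamma>" for v
      using in_component_iff[OF g r(1) that] r by simp
    have Ufin: "finite U" "U \<subseteq> verts \<Gamma>" using D(1) r by (auto simp: component_def)
    have HS: "{h \<in> halfs ?F. bar ?F h \<noteq> h} = ?HS"
      using edges_iff[OF g] S by (auto simp: contraction_fibre_def)
    have "2 * card (edges ?F) = card ?HS"
      unfolding edges_eq_image HS
    proof -
      have "2 * card ((\<lambda>h. {h, bar \<Gamma> h}) ` ?HS) = card ?HS"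
      proof (rule card_orbits_of_free_involution)
        \<comment> \<open>The involution stays within the fibre because both ends of a contracted
          edge lie in one component.\<close>
        fix h assume h: "h \<in> ?HS"
        then have "?c (endpt \<Gamma> (bar \<Gamma> h)) = ?c (endpt \<Gamma> h)" using component_bar[OF g] by blast
        then have "endpt \<Gamma> (bar \<Gamma> h) \<in> U" using h Uv D(4,6) by auto
        moreover have "bar \<Gamma> h \<noteq> h" using h edges_iff[OF g] S by blast
        ultimately show "bar \<Gamma> h \<in> ?HS \<and> bar \<Gamma> (bar \<Gamma> h) = h \<and> bar \<Gamma> h \<noteq> h"
          using h D(4,5) by (auto simp: insert_commute)
      qed (use D(3) in auto)
      then show "2 * card ((\<lambda>h. {h, bar ?F h}) ` ?HS) = card ?HS" by (simp add: contraction_fibre_def)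
    qed
    moreover have "card U \<le> card (edges ?F) + 1" using card_component_le[OF g S r(1)] r(2) by simp
    moreover have "verts ?F = U" by (simp add: contraction_fibre_def)
    ultimately have b1: "2 * int (nat (b1 ?F)) = int (card ?HS) - 2 * int (card U) + 2"
      by (simp add: b1_def)
    have "(\<Sum>v\<in>U. valence \<Gamma> v) = (\<Sum>v\<in>U. card {h \<in> {h \<in> halfs \<Gamma>. endpt \<Gamma> h \<in> U}. endpt \<Gamma> h = v})"
      unfolding valence_def by (intro sum.cong refl arg_cong[of _ _ card]) auto
    also have "\<dots> = card {h \<in> halfs \<Gamma>. endpt \<Gamma> h \<in> U}"
      by (rule sum_card_fibres) (use D(3) Ufin in auto)
    also have "{h \<in> halfs \<Gamma>. endpt \<Gamma> h \<in> U} = ?HS \<union> ?HF" by auto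
    also have "card (?HS \<union> ?HF) = card ?HS + card ?HF" by (rule card_Un_disjoint) (use D(3) in auto)
    finally have val: "(\<Sum>v\<in>U. valence \<Gamma> v) = card ?HS + card ?HF" .
    have "valence (contract \<Gamma> S) U = card ?HF"
      unfolding valence_def contract_def using Uv D(6) by (intro arg_cong[of _ _ card]) auto
    moreover have "(\<Sum>v\<in>U. can_deg (\<Gamma>, w) v) =
        2 * int (\<Sum>v\<in>U. w v) - 2 * int (card U) + int (\<Sum>v\<in>U. valence \<Gamma> v)"
      by (simp add: can_deg_def sum.distrib sum_subtractf sum_distrib_left)
    ultimately show ?thesis
      unfolding U using b1 val by (simp add: can_deg_def contract_weight_def)
  qed
  then show ?thesis
    unfolding contraction_def case_prod_conv using S component_eq_iff[OF g]
    by (simp add: contract_def free_halfs_def)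
qed

section \<open>Isomorphisms\<close>

lemma free_halfs_empty [simp]: "free_halfs \<Gamma> {} = halfs \<Gamma>"
  by (simp add: free_halfs_def)

lemma adjacent_via_empty [simp]: "adjacent_via \<Gamma> {} = {}"
  by (simp add: adjacent_via_def)

lemma valence_isomorphism:
  assumes i: "graph_isomorphism \<Gamma> \<Delta> \<sigma> \<psi>" and g: "leg_graph n \<Gamma>" and v: "v \<in> verts \<Gamma>"
  shows "valence \<Delta> (\<sigma> v) = valence \<Gamma> v"
proof -
  note D = leg_graphD[OF g]
  have \<sigma>: "inj_on \<sigma> (verts \<Gamma>)" and \<psi>: "inj_on \<psi> (halfs \<Gamma>)" "\<psi> ` halfs \<Gamma> = halfs \<Delta>"
    and e: "\<And>h. h \<in> halfs \<Gamma> \<Longrightarrow> \<sigma> (endpt \<Gamma> h) = endpt \<Delta> (\<psi> h)"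
    using i by (auto simp: graph_isomorphism_def bij_betw_def)
  have "{k \<in> halfs \<Delta>. endpt \<Delta> k = \<sigma> v} = \<psi> ` {h \<in> halfs \<Gamma>. endpt \<Gamma> h = v}"
  proof (intro equalityI subsetI)
    fix k assume k: "k \<in> {k \<in> halfs \<Delta>. endpt \<Delta> k = \<sigma> v}"
    then have "k \<in> \<psi> ` halfs \<Gamma>" unfolding \<psi>(2) by simp
    then obtain h where h: "h \<in> halfs \<Gamma>" "k = \<psi> h" by blast
    then have "\<sigma> (endpt \<Gamma> h) = \<sigma> v" using e k by simp
    then have "endpt \<Gamma> h = v" using \<sigma> D(6)[OF h(1)] v by (meson inj_onD)
    then show "k \<in> \<psi> ` {h \<in> halfs \<Gamma>. endpt \<Gamma> h = v}" using h by auto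
  next
    fix k assume "k \<in> \<psi> ` {h \<in> halfs \<Gamma>. endpt \<Gamma> h = v}"
    then obtain h where h: "h \<in> halfs \<Gamma>" "k = \<psi> h" "endpt \<Gamma> h = v" by blast
    then have "\<psi> h \<in> halfs \<Delta>" using \<psi>(2) by blast
    then show "k \<in> {k \<in> halfs \<Delta>. endpt \<Delta> k = \<sigma> v}" using h e[OF h(1)] by simp
  qed
  moreover have "inj_on \<psi> {h \<in> halfs \<Gamma>. endpt \<Gamma> h = v}" by (rule inj_on_subset[OF \<psi>(1)]) auto
  ultimately show ?thesis unfolding valence_def by (simp add: card_image)
qed

text \<open>With nothing contracted the fibres of \<open>\<sigma>\<close> are single vertices and
  valences are preserved, so equality of degrees amounts to equality of weights.\<close>

lemma contraction_empty_iff: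
  assumes g: "leg_graph n \<Gamma>"
  shows "contraction (\<Gamma>, w) (\<Delta>, w') {} \<sigma> \<psi> \<longleftrightarrow>
     graph_isomorphism \<Gamma> \<Delta> \<sigma> \<psi> \<and> (\<forall>v\<in>verts \<Gamma>. w' (\<sigma> v) = w v)"
proof -
  have gi: "graph_isomorphism \<Gamma> \<Delta> \<sigma> \<psi> \<longleftrightarrow>
     \<sigma> ` verts \<Gamma> = verts \<Delta> \<and>
     (\<forall>u\<in>verts \<Gamma>. \<forall>v\<in>verts \<Gamma>. \<sigma> u = \<sigma> v \<longleftrightarrow> (u, v) \<in> (adjacent_via \<Gamma> {})\<^sup>*) \<and>
     bij_betw \<psi> (free_halfs \<Gamma> {}) (halfs \<Delta>) \<and>
     (\<forall>h\<in>free_halfs \<Gamma> {}. \<psi> (bar \<Gamma> h) = bar \<Delta> (\<psi> h)) \<and>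
     (\<forall>h\<in>free_halfs \<Gamma> {}. endpt \<Delta> (\<psi> h) = \<sigma> (endpt \<Gamma> h)) \<and>
     map \<psi> (leg_list \<Gamma>) = leg_list \<Delta>"
    by (auto simp: graph_isomorphism_def bij_betw_def inj_on_def)
  have "(\<forall>x\<in>verts \<Delta>. can_deg (\<Delta>, w') x = (\<Sum>v | v \<in> verts \<Gamma> \<and> \<sigma> v = x. can_deg (\<Gamma>, w) v)) \<longleftrightarrow>
      (\<forall>v\<in>verts \<Gamma>. w' (\<sigma> v) = w v)" if i: "graph_isomorphism \<Gamma> \<Delta> \<sigma> \<psi>"
  proof -
    have \<sigma>: "verts \<Delta> = \<sigma> ` verts \<Gamma>" "inj_on \<sigma> (verts \<Gamma>)"
      using i by (auto simp: graph_isomorphism_def bij_betw_def)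
    have "(\<Sum>u | u \<in> verts \<Gamma> \<and> \<sigma> u = \<sigma> v. can_deg (\<Gamma>, w) u) = can_deg (\<Gamma>, w) v" if v: "v \<in> verts \<Gamma>" for v
    proof -
      have "{u. u \<in> verts \<Gamma> \<and> \<sigma> u = \<sigma> v} = {v}" using \<sigma>(2) v by (auto dest: inj_onD)
      then show ?thesis by simp
    qed
    moreover have "can_deg (\<Delta>, w') (\<sigma> v) = can_deg (\<Gamma>, w) v \<longleftrightarrow> w' (\<sigma> v) = w v" if v: "v \<in> verts \<Gamma>" for v
      using valence_isomorphism[OF i g v] by (simp add: can_deg_def)
    ultimately show ?thesis unfolding \<sigma>(1) by simp
  qed
  then show ?thesis unfolding contraction_def case_prod_conv gi by blast
qed

lemma wgraph_iso_iff:
  assumes "leg_graph n \<Gamma>"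
  shows "wgraph_iso (\<Gamma>, w) (\<Delta>, w') \<longleftrightarrow> (\<exists>\<sigma> \<psi>. contraction (\<Gamma>, w) (\<Delta>, w') {} \<sigma> \<psi>)"
  by (simp add: wgraph_iso_def contraction_empty_iff[OF assms])

lemma graph_iso_iff_wgraph_iso: "graph_iso \<Gamma> \<Delta> \<longleftrightarrow> wgraph_iso (\<Gamma>, \<lambda>_. 0) (\<Delta>, \<lambda>_. 0)"
  by (simp add: graph_iso_def wgraph_iso_def)

lemma contraction_id: "leg_graph n \<Gamma> \<Longrightarrow> contraction (\<Gamma>, w) (\<Gamma>, w) {} id id"
  using contraction_empty_iff[of n \<Gamma> w \<Gamma> w id id] by (simp add: graph_isomorphism_def)

text \<open>The inverse arises by factoring the identity through the isomorphism.\<close>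

lemma contraction_iso_sym:
  assumes "contraction (\<Gamma>, w) (\<Delta>, w') {} \<sigma> \<psi>" "leg_graph n \<Gamma>"
  shows "contraction (\<Delta>, w') (\<Gamma>, w) {} (inv_into (verts \<Gamma>) \<sigma>) (inv_into (halfs \<Gamma>) \<psi>)"
  using contraction_factor[OF assms(1) contraction_id[OF assms(2)] subset_refl assms(2)] by simp

lemma contraction_comp_iso:
  assumes "contraction (\<Gamma>, w) (\<Delta>, w') S \<sigma> \<psi>" "contraction (\<Delta>, w') (\<Theta>, w'') {} \<tau> \<rho>" "leg_graph n \<Gamma>"
  shows "contraction (\<Gamma>, w) (\<Theta>, w'') S (\<tau> \<circ> \<sigma>) (\<rho> \<circ> \<psi>)"
  using contraction_comp[OF assms] by simp

lemma curve_iso_iff: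
  assumes "leg_graph n \<Gamma>"
  shows "curve_iso (\<Gamma>, w, l) (\<Delta>, w', l') \<longleftrightarrow> (\<exists>\<sigma> \<psi>. contraction (\<Gamma>, w) (\<Delta>, w') {} \<sigma> \<psi> \<and>
     (\<forall>e\<in>edges \<Gamma>. l' (\<psi> ` e) = l e) \<and> (\<forall>x\<in>legs \<Gamma>. l' {\<psi> x} = l {x}))"
  by (simp add: curve_iso_def contraction_empty_iff[OF assms] conj_assoc)

lemma curve_iso_refl: "curve_iso C C"
  by (cases C) (auto simp: curve_iso_def graph_isomorphism_def intro!: exI[of _ id])

lemma curve_iso_trans:
  assumes "curve_iso (\<Gamma>, w, l) (\<Delta>, w', l')" "curve_iso (\<Delta>, w', l') (\<Theta>, w'', l'')" "leg_graph n \<Gamma>"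
  shows "curve_iso (\<Gamma>, w, l) (\<Theta>, w'', l'')"
proof -
  obtain \<sigma> \<psi> where 1: "contraction (\<Gamma>, w) (\<Delta>, w') {} \<sigma> \<psi>"
     "\<forall>e\<in>edges \<Gamma>. l' (\<psi> ` e) = l e" "\<forall>x\<in>legs \<Gamma>. l' {\<psi> x} = l {x}"
    using assms(1) unfolding curve_iso_iff[OF assms(3)] by blast
  have g: "leg_graph n \<Delta>" by (rule contraction_leg_graph[OF 1(1) assms(3)])
  obtain \<tau> \<rho> where 2: "contraction (\<Delta>, w') (\<Theta>, w'') {} \<tau> \<rho>"
     "\<forall>e\<in>edges \<Delta>. l'' (\<rho> ` e) = l' e" "\<forall>x\<in>legs \<Delta>. l'' {\<rho> x} = l' {x}"
    using assms(2) unfolding curve_iso_iff[OF g] by blast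
  have e: "\<psi> ` e \<in> edges \<Delta>" if "e \<in> edges \<Gamma>" for e
    using contraction_edges[OF 1(1) assms(3)] that by (simp add: bij_betw_apply)
  have x: "\<psi> x \<in> legs \<Delta>" if "x \<in> legs \<Gamma>" for x
  proof -
    have "\<psi> x \<in> set (map \<psi> (leg_list \<Gamma>))" using that leg_graphD(8)[OF assms(3)] by simp
    then show ?thesis using contractionD(7)[OF 1(1)] leg_graphD(8)[OF g] by simp
  qed
  have "contraction (\<Gamma>, w) (\<Theta>, w'') {} (\<tau> \<circ> \<sigma>) (\<rho> \<circ> \<psi>)" by (rule contraction_comp_iso[OF 1(1) 2(1) assms(3)])
  moreover have "l'' ((\<rho> \<circ> \<psi>) ` e) = l e" if "e \<in> edges \<Gamma>" for e
    using 1(2) 2(2) e[OF that] that unfolding image_comp[symmetric] by simp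
  moreover have "l'' {(\<rho> \<circ> \<psi>) x} = l {x}" if "x \<in> legs \<Gamma>" for x
    using 1(3) 2(3) x[OF that] that by simp
  ultimately show ?thesis unfolding curve_iso_iff[OF assms(3)] by blast
qed

lemma curve_iso_sym:
  assumes "curve_iso (\<Gamma>, w, l) (\<Delta>, w', l')" "leg_graph n \<Gamma>"
  shows "curve_iso (\<Delta>, w', l') (\<Gamma>, w, l)"
proof -
  obtain \<sigma> \<psi> where 1: "contraction (\<Gamma>, w) (\<Delta>, w') {} \<sigma> \<psi>"
     "\<forall>e\<in>edges \<Gamma>. l' (\<psi> ` e) = l e" "\<forall>x\<in>legs \<Gamma>. l' {\<psi> x} = l {x}"
    using assms(1) unfolding curve_iso_iff[OF assms(2)] by blast
  have g: "leg_graph n \<Delta>" by (rule contraction_leg_graph[OF 1(1) assms(2)])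
  let ?\<rho> = "inv_into (halfs \<Gamma>) \<psi>"
  have inj: "inj_on \<psi> (halfs \<Gamma>)" using contractionD(4)[OF 1(1)] by (simp add: bij_betw_def)
  have E: "bij_betw ((`) \<psi>) (edges \<Gamma>) (edges \<Delta>)" using contraction_edges[OF 1(1) assms(2)] by simp
  have "l (?\<rho> ` e) = l' e" if e: "e \<in> edges \<Delta>" for e
  proof -
    have "e \<in> (`) \<psi> ` edges \<Gamma>" using e unfolding bij_betw_imp_surj_on[OF E] .
    then obtain e' where e': "e' \<in> edges \<Gamma>" "e = \<psi> ` e'" by (elim imageE)
    have "e' \<subseteq> halfs \<Gamma>" using edge_subset_free_halfs[OF assms(2), of e' "{}"] e'(1) by simp
    then have "?\<rho> ` e = e'" using inj e'(2) by (simp add: inv_into_image_cancel)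
    then show ?thesis using 1(2) e' by simp
  qed
  moreover have "l {?\<rho> x} = l' {x}" if x: "x \<in> legs \<Delta>" for x
  proof -
    have "x \<in> set (map \<psi> (leg_list \<Gamma>))" unfolding contractionD(7)[OF 1(1)] using x leg_graphD(8)[OF g] by simp
    then obtain y where y: "y \<in> legs \<Gamma>" "x = \<psi> y" using leg_graphD(8)[OF assms(2)] by auto
    then have "?\<rho> x = y" using inj by (simp add: legs_def)
    then show ?thesis using 1(3) y by simp
  qed
  ultimately show ?thesis
    unfolding curve_iso_iff[OF g] using contraction_iso_sym[OF 1(1) assms(2)] by blast
qed

section \<open>The curve determined by a point of a cell\<close>

definition zero_edges :: "('v, 'h) graph \<Rightarrow> ('h set \<Rightarrow> real option) \<Rightarrow> 'h set set" where
  "zero_edges \<Gamma> t = {e \<in> edges \<Gamma>. t e = Some 0}"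

lemma curve_at_eq: "curve_at (\<Gamma>, w) t =
   (contract \<Gamma> (zero_edges \<Gamma> t), contract_weight \<Gamma> w (zero_edges \<Gamma> t),
    \<lambda>e. if e \<in> edges \<Gamma> - zero_edges \<Gamma> t then t e else None)"
  by (simp add: curve_at_def zero_edges_def Let_def)

lemma zero_edges_subset: "zero_edges \<Gamma> t \<subseteq> edges \<Gamma>"
  by (auto simp: zero_edges_def)

lemma edges_contract: "edges (contract \<Gamma> S) = edges \<Gamma> - S"
  by (auto simp: edges_def contract_def)

lemma legs_contract:
  assumes "leg_graph n \<Gamma>" "S \<subseteq> edges \<Gamma>"
  shows "legs (contract \<Gamma> S) = legs \<Gamma>"
  using legs_subset_free_halfs[OF assms] by (auto simp: legs_def contract_def free_halfs_def)

lemma leg_graph_contract: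
  assumes "leg_graph n \<Gamma>" "S \<subseteq> edges \<Gamma>"
  shows "leg_graph n (contract \<Gamma> S)"
  using contraction_leg_graph[OF contraction_contract[OF assms] assms(1)] .

lemma leg_not_edge:
  assumes "leg_graph n \<Gamma>" "x \<in> legs \<Gamma>"
  shows "{x} \<notin> edges \<Gamma>"
  using assms(2) edges_iff[OF assms(1), of x] by (auto simp: legs_def)

text \<open>Composition with the canonical contraction, and factorization through it, eliminate
  \<open>contract\<close>: an isomorphism from the contracted curve is a contraction of
  \<open>\<Gamma>\<close> itself along the edges of length zero. On legs the value is
  \<open>None\<close> because the singleton of a leg is not an edge.\<close>

lemma curve_iso_curve_at_iff:
  assumes g: "leg_graph n \<Gamma>"
  shows "curve_iso (curve_at (\<Gamma>, w) t) (\<Delta>, w', l) \<longleftrightarrow>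
     (\<exists>\<sigma> \<psi>. contraction (\<Gamma>, w) (\<Delta>, w') (zero_edges \<Gamma> t) \<sigma> \<psi> \<and>
       (\<forall>e\<in>edges \<Gamma> - zero_edges \<Gamma> t. l (\<psi> ` e) = t e) \<and> (\<forall>x\<in>legs \<Gamma>. l {\<psi> x} = None))"
proof -
  let ?S = "zero_edges \<Gamma> t"
  note c = contraction_contract[OF g zero_edges_subset, of w t]
  note gS = leg_graph_contract[OF g zero_edges_subset, of t]
  show ?thesis
    unfolding curve_at_eq curve_iso_iff[OF gS] edges_contract legs_contract[OF g zero_edges_subset]
  proof (intro iffI; elim exE conjE)
    fix \<sigma> \<psi>
    assume 1: "contraction (contract \<Gamma> ?S, contract_weight \<Gamma> w ?S) (\<Delta>, w') {} \<sigma> \<psi>"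
      and 2: "\<forall>e\<in>edges \<Gamma> - ?S. l (\<psi> ` e) = (if e \<in> edges \<Gamma> - ?S then t e else None)"
      and 3: "\<forall>x\<in>legs \<Gamma>. l {\<psi> x} = (if {x} \<in> edges \<Gamma> - ?S then t {x} else None)"
    have "contraction (\<Gamma>, w) (\<Delta>, w') ?S (\<sigma> \<circ> component \<Gamma> ?S) (\<psi> \<circ> id)"
      by (rule contraction_comp_iso[OF c 1 g])
    then show "\<exists>\<sigma> \<psi>. contraction (\<Gamma>, w) (\<Delta>, w') (zero_edges \<Gamma> t) \<sigma> \<psi> \<and>
       (\<forall>e\<in>edges \<Gamma> - zero_edges \<Gamma> t. l (\<psi> ` e) = t e) \<and> (\<forall>x\<in>legs \<Gamma>. l {\<psi> x} = None)"
      using 2 3 leg_not_edge[OF g] by (intro exI[of _ "\<sigma> \<circ> component \<Gamma> ?S"] exI[of _ \<psi>]) auto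
  next
    fix \<sigma> \<psi>
    assume 1: "contraction (\<Gamma>, w) (\<Delta>, w') ?S \<sigma> \<psi>"
      and 2: "\<forall>e\<in>edges \<Gamma> - ?S. l (\<psi> ` e) = t e" and 3: "\<forall>x\<in>legs \<Gamma>. l {\<psi> x} = None"
    let ?\<sigma> = "\<sigma> \<circ> inv_into (verts \<Gamma>) (component \<Gamma> ?S)" and ?\<psi> = "\<psi> \<circ> inv_into (free_halfs \<Gamma> ?S) id"
    have i: "?\<psi> h = \<psi> h" if "h \<in> free_halfs \<Gamma> ?S" for h
      using inv_into_f_f[of id "free_halfs \<Gamma> ?S" h] that by simp
    have "contraction (contract \<Gamma> ?S, contract_weight \<Gamma> w ?S) (\<Delta>, w') ((`) id ` (?S - ?S)) ?\<sigma> ?\<psi>"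
      by (rule contraction_factor[OF c 1 subset_refl g])
    then have "contraction (contract \<Gamma> ?S, contract_weight \<Gamma> w ?S) (\<Delta>, w') {} ?\<sigma> ?\<psi>" by simp
    moreover have "?\<psi> ` e = \<psi> ` e" if "e \<in> edges \<Gamma> - ?S" for e
      using edge_subset_free_halfs[OF g that] i by (intro image_cong) auto
    moreover have "?\<psi> x = \<psi> x" if "x \<in> legs \<Gamma>" for x
      using legs_subset_free_halfs[OF g zero_edges_subset] that i by blast
    ultimately show "\<exists>\<sigma> \<psi>. contraction (contract \<Gamma> ?S, contract_weight \<Gamma> w ?S) (\<Delta>, w') {} \<sigma> \<psi> \<and>
      (\<forall>e\<in>edges \<Gamma> - ?S. l (\<psi> ` e) = (if e \<in> edges \<Gamma> - ?S then t e else None)) \<and>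
      (\<forall>x\<in>legs \<Gamma>. l {\<psi> x} = (if {x} \<in> edges \<Gamma> - ?S then t {x} else None))"
      using 2 3 leg_not_edge[OF g] by (intro exI[of _ ?\<sigma>] exI[of _ ?\<psi>]) (simp del: o_apply)
  qed
qed

text \<open>The inclusion of a smaller cell as the face where the coordinates in \<open>S\<close>
  vanish. It depends on a contraction only through \<open>S\<close> and the induced map
  \<open>\<beta>\<close> of edges, of which there are finitely many, and it is restricted to
  \<open>E\<close> so that its values are points of a product \<open>PiE\<close>.\<close>

definition face_map ::
    "'h set set \<Rightarrow> 'h set set \<Rightarrow> ('h set \<Rightarrow> 'h2 set) \<Rightarrow> ('h2 set \<Rightarrow> real option) \<Rightarrow> 'h set \<Rightarrow> real option" where
  "face_map E S \<beta> u = (\<lambda>e\<in>E. if e \<in> S then Some 0 else u (\<beta> e))"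

text \<open>The point \<open>u\<close> may have zero coordinates of its own: the zero edges of its
  image are \<open>S\<close> together with the edges mapped to zero edges of \<open>u\<close>, which
  is the edge set of a composite contraction.\<close>

lemma curve_iso_face_map:
  assumes c: "contraction (\<Gamma>, w) (\<Delta>, w') S \<sigma> \<psi>" and g: "leg_graph n \<Gamma>"
  shows "curve_iso (curve_at (\<Gamma>, w) (face_map (edges \<Gamma>) S ((`) \<psi>) u)) (curve_at (\<Delta>, w') u)"
proof -
  let ?f = "face_map (edges \<Gamma>) S ((`) \<psi>) u" and ?T = "zero_edges \<Delta> u"
  have g': "leg_graph n \<Delta>" by (rule contraction_leg_graph[OF c g])
  have E: "\<psi> ` e \<in> edges \<Delta>" if "e \<in> edges \<Gamma> - S" for e
    using contraction_edges[OF c g] that by (rule bij_betw_apply)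
  have S: "S \<subseteq> edges \<Gamma>" by (rule contractionD(1)[OF c])
  have z: "zero_edges \<Gamma> ?f = S \<union> {e \<in> edges \<Gamma> - S. \<psi> ` e \<in> ?T}"
    using S E by (auto simp: zero_edges_def face_map_def)
  have "contraction (\<Gamma>, w) (contract \<Delta> ?T, contract_weight \<Delta> w' ?T) (zero_edges \<Gamma> ?f)
      (component \<Delta> ?T \<circ> \<sigma>) (id \<circ> \<psi>)"
    unfolding z by (rule contraction_comp[OF c contraction_contract[OF g' zero_edges_subset] g])
  moreover have "(if (id \<circ> \<psi>) ` e \<in> edges \<Delta> - ?T then u ((id \<circ> \<psi>) ` e) else None) = ?f e"
    if "e \<in> edges \<Gamma> - zero_edges \<Gamma> ?f" for e
    using that E[of e] unfolding z by (auto simp: face_map_def)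
  moreover have "(if {(id \<circ> \<psi>) x} \<in> edges \<Delta> - ?T then u {(id \<circ> \<psi>) x} else None) = None" if "x \<in> legs \<Gamma>" for x
  proof -
    have "\<psi> x \<in> set (map \<psi> (leg_list \<Gamma>))" using that leg_graphD(8)[OF g] by simp
    then have "\<psi> x \<in> legs \<Delta>" using contractionD(7)[OF c] leg_graphD(8)[OF g'] by simp
    then show ?thesis using leg_not_edge[OF g'] by simp
  qed
  ultimately show ?thesis
    unfolding curve_at_eq[of \<Delta>] curve_iso_curve_at_iff[OF g] by blast
qed

section \<open>Normal forms and class representatives\<close>

text \<open>Contracted graphs have sets as vertices; this brings them back to the type over which
  the moduli space is built. The maps are cut off outside the half-edges so that there are finitely
  many normal forms of a given size.\<close>

lemma exists_nat_graph:
  fixes \<Gamma> :: "('v, 'h) graph"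
  assumes g: "leg_graph n \<Gamma>"
  shows "\<exists>(\<Delta> :: (nat, nat) graph) w' \<sigma> \<psi>. contraction (\<Gamma>, w) (\<Delta>, w') {} \<sigma> \<psi> \<and>
    verts \<Delta> = {..<card (verts \<Gamma>)} \<and> halfs \<Delta> = {..<card (halfs \<Gamma>)} \<and>
    bar \<Delta> \<in> extensional (halfs \<Delta>) \<and> endpt \<Delta> \<in> extensional (halfs \<Delta>)"
proof -
  note D = leg_graphD[OF g]
  obtain \<sigma> where \<sigma>: "bij_betw \<sigma> (verts \<Gamma>) {0..<card (verts \<Gamma>)}"
    using ex_bij_betw_finite_nat[OF D(1)] by blast
  obtain \<psi> where \<psi>: "bij_betw \<psi> (halfs \<Gamma>) {0..<card (halfs \<Gamma>)}"
    using ex_bij_betw_finite_nat[OF D(3)] by blast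
  define i where "i = inv_into (halfs \<Gamma>) \<psi>"
  define \<Delta> where "\<Delta> = \<lparr>verts = {..<card (verts \<Gamma>)}, halfs = {..<card (halfs \<Gamma>)},
     bar = (\<lambda>k\<in>{..<card (halfs \<Gamma>)}. \<psi> (bar \<Gamma> (i k))), endpt = (\<lambda>k\<in>{..<card (halfs \<Gamma>)}. \<sigma> (endpt \<Gamma> (i k))),
     leg_list = map \<psi> (leg_list \<Gamma>)\<rparr>"
  let ?w = "\<lambda>v. w (inv_into (verts \<Gamma>) \<sigma> v)"
  have i: "i (\<psi> h) = h" "\<psi> h < card (halfs \<Gamma>)" if "h \<in> halfs \<Gamma>" for h
    using \<psi> that by (auto simp: i_def bij_betw_def)
  have "graph_isomorphism \<Gamma> \<Delta> \<sigma> \<psi>"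
    using \<sigma> \<psi> i D(4) by (simp add: graph_isomorphism_def \<Delta>_def atLeast0LessThan)
  moreover have "\<forall>v\<in>verts \<Gamma>. ?w (\<sigma> v) = w v" using \<sigma> by (simp add: bij_betw_def)
  ultimately have "contraction (\<Gamma>, w) (\<Delta>, ?w) {} \<sigma> \<psi>" using contraction_empty_iff[OF g] by blast
  then show ?thesis
    by (intro exI[of _ \<Delta>] exI[of _ ?w] exI[of _ \<sigma>] exI[of _ \<psi>]) (simp add: \<Delta>_def)
qed

text \<open>Symmetry and transitivity are asked of chains that start in \<open>A\<close>, because
  isomorphisms are inverted and composed for graphs that satisfy the axioms.\<close>

lemma class_representatives:
  assumes "\<And>x. R x x" "\<And>x y. x \<in> A \<Longrightarrow> R x y \<Longrightarrow> R y x"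
    "\<And>x y z. x \<in> A \<Longrightarrow> R x y \<Longrightarrow> R y z \<Longrightarrow> R x z"
  shows "class_representatives A R \<subseteq> A"
    "\<And>x. x \<in> A \<Longrightarrow> \<exists>y\<in>class_representatives A R. R x y"
    "\<And>x y. x \<in> class_representatives A R \<Longrightarrow> y \<in> class_representatives A R \<Longrightarrow> R x y \<Longrightarrow> x = y"
proof -
  let ?r = "{(x, y). x \<in> A \<and> y \<in> A \<and> R x y}"
  have eq: "equiv A ?r"
  proof (rule equivI)
    show "trans ?r" using assms(3) by (auto intro!: transI)
  qed (use assms(1,2) in \<open>auto simp: refl_on_def sym_def\<close>)
  have some: "(SOME x. x \<in> c) \<in> c" if "c \<in> A // ?r" for c
    using in_quotient_imp_non_empty[OF eq that] by (simp add: some_in_eq)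
  show sub: "class_representatives A R \<subseteq> A"
    unfolding class_representatives_def
  proof (rule image_subsetI)
    fix c assume c: "c \<in> A // ?r"
    show "(SOME x. x \<in> c) \<in> A" using some[OF c] in_quotient_imp_subset[OF eq c] by blast
  qed
  show "\<exists>y\<in>class_representatives A R. R x y" if "x \<in> A" for x
  proof -
    have c: "?r `` {x} \<in> A // ?r" using that by (rule quotientI)
    then have "(SOME y. y \<in> ?r `` {x}) \<in> class_representatives A R"
      unfolding class_representatives_def by (rule imageI)
    moreover have "R x (SOME y. y \<in> ?r `` {x})" using some[OF c] by blast
    ultimately show ?thesis by blast
  qed
  fix x y assume x: "x \<in> class_representatives A R" and y: "y \<in> class_representatives A R" and R: "R x y"
  obtain c where c: "c \<in> A // ?r" "x = (SOME x. x \<in> c)"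
    using x unfolding class_representatives_def by (elim imageE)
  obtain d where d: "d \<in> A // ?r" "y = (SOME x. x \<in> d)"
    using y unfolding class_representatives_def by (elim imageE)
  have "(x, y) \<in> ?r" using subsetD[OF sub x] subsetD[OF sub y] R by simp
  then have "c = d" using quotient_eqI[OF eq c(1) d(1)] some[OF c(1)] some[OF d(1)] c(2) d(2) by simp
  then show "x = y" using c d by simp
qed

lemma wgraph_iso_refl: "wgraph_iso G G"
  by (cases G) (auto simp: wgraph_iso_def graph_isomorphism_def intro!: exI[of _ id])

lemma wgraph_iso_sym:
  assumes g: "leg_graph n \<Gamma>" and "wgraph_iso (\<Gamma>, w) (\<Delta>, w')"
  shows "wgraph_iso (\<Delta>, w') (\<Gamma>, w)"
proof -
  obtain \<sigma> \<psi> where c: "contraction (\<Gamma>, w) (\<Delta>, w') {} \<sigma> \<psi>" using assms(2) unfolding wgraph_iso_iff[OF g] by blast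
  show ?thesis
    unfolding wgraph_iso_iff[OF contraction_leg_graph[OF c g]] using contraction_iso_sym[OF c g] by blast
qed

lemma wgraph_iso_trans:
  assumes g: "leg_graph n \<Gamma>" and "wgraph_iso (\<Gamma>, w) (\<Delta>, w')" "wgraph_iso (\<Delta>, w') (\<Theta>, w'')"
  shows "wgraph_iso (\<Gamma>, w) (\<Theta>, w'')"
proof -
  obtain \<sigma> \<psi> where c: "contraction (\<Gamma>, w) (\<Delta>, w') {} \<sigma> \<psi>" using assms(2) unfolding wgraph_iso_iff[OF g] by blast
  obtain \<tau> \<rho> where d: "contraction (\<Delta>, w') (\<Theta>, w'') {} \<tau> \<rho>"
    using assms(3) unfolding wgraph_iso_iff[OF contraction_leg_graph[OF c g]] by blast
  show ?thesis unfolding wgraph_iso_iff[OF g] using contraction_comp_iso[OF c d g] by blast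
qed

section \<open>Three-regular graphs as the stable graphs with the maximal number of edges\<close>

definition trivalent :: "nat \<Rightarrow> nat \<Rightarrow> ('v, 'h) graph \<Rightarrow> bool" where
  "trivalent g n \<Gamma> \<longleftrightarrow> is_graph n \<Gamma> \<and> three_regular \<Gamma> \<and> b1 \<Gamma> = int g"

lemma trivalent_leg_graph: "trivalent g n \<Gamma> \<Longrightarrow> leg_graph n \<Gamma>"
  by (simp add: trivalent_def is_graph_iff)

lemma trivalent_stable_graph: "trivalent g n \<Gamma> \<Longrightarrow> stable_graph g n (\<Gamma>, \<lambda>_. 0)"
  by (auto simp: trivalent_def stable_graph_def three_regular_def stable_def genus_def)

lemma stable_graph_trivalent:
  assumes s: "stable_graph g n (\<Gamma>, w)" and z: "\<And>v. v \<in> verts \<Gamma> \<Longrightarrow> can_deg (\<Gamma>, w) v = 1 \<and> w v = 0"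
  shows "trivalent g n \<Gamma>"
proof -
  have "valence \<Gamma> v = 3" if "v \<in> verts \<Gamma>" for v using z[OF that] by (simp add: can_deg_def)
  moreover have "genus (\<Gamma>, w) = b1 \<Gamma>" using z by (simp add: genus_def)
  ultimately show ?thesis using stable_graphD[OF s] by (simp add: trivalent_def three_regular_def)
qed

text \<open>On a stable graph all summands of the codimension are nonnegative; if they add up to
  zero, each vertex has degree one and weight zero.\<close>

lemma card_edges_le:
  assumes "stable_graph g n (\<Gamma>, w)"
  shows "int (card (edges \<Gamma>)) \<le> 3 * int g - 3 + int n"
    "int (card (edges \<Gamma>)) = 3 * int g - 3 + int n \<Longrightarrow> v \<in> verts \<Gamma> \<Longrightarrow> can_deg (\<Gamma>, w) v = 1 \<and> w v = 0"
proof -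
  note s = stable_graphD[OF assms]
  have nn: "can_deg (\<Gamma>, w) v - 1 + int (w v) \<ge> 0" if "v \<in> verts \<Gamma>" for v using s(3)[OF that] by simp
  note c = card_edges_codim[OF s(2), of w, unfolded s(4)]
  show "int (card (edges \<Gamma>)) \<le> 3 * int g - 3 + int n" 
  proof -
    have "0 \<le> (\<Sum>v\<in>verts \<Gamma>. can_deg (\<Gamma>, w) v - 1 + int (w v))" using nn by (rule sum_nonneg)
    then show ?thesis using c by simp
  qed
  assume e: "int (card (edges \<Gamma>)) = 3 * int g - 3 + int n" "v \<in> verts \<Gamma>"
  then have "\<forall>v\<in>verts \<Gamma>. can_deg (\<Gamma>, w) v - 1 + int (w v) = 0"
    using c nn leg_graphD(1)[OF s(2)] by (subst sum_nonneg_eq_0_iff[symmetric]) auto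
  then show "can_deg (\<Gamma>, w) v = 1 \<and> w v = 0" using s(3)[OF e(2)] e(2) by force
qed

lemma card_edges_trivalent:
  assumes "trivalent g n \<Gamma>"
  shows "int (card (edges \<Gamma>)) = 3 * int g - 3 + int n"
proof -
  note s = stable_graphD[OF trivalent_stable_graph[OF assms]]
  have "can_deg (\<Gamma>, \<lambda>_. 0) v = 1" if "v \<in> verts \<Gamma>" for v
    using assms that by (simp add: can_deg_def trivalent_def three_regular_def)
  then show ?thesis using card_edges_codim[OF s(2), of "\<lambda>_. 0", unfolded s(4)] by simp
qed

lemma trivalent_if_card_edges:
  assumes "stable_graph g n (\<Gamma>, w)" "int (card (edges \<Gamma>)) = 3 * int g - 3 + int n"
  shows "trivalent g n \<Gamma>" "\<And>v. v \<in> verts \<Gamma> \<Longrightarrow> w v = 0"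
  using stable_graph_trivalent[OF assms(1)] card_edges_le(2)[OF assms] by auto

text \<open>Weight functions are total, and a weight vanishing on all vertices may differ from
  \<open>\<lambda>_. 0\<close> elsewhere. Contractions read weights at vertices only, so the two can
  be exchanged.\<close>

lemma weight_cong:
  assumes "\<And>v. v \<in> verts \<Gamma> \<Longrightarrow> w v = w' v"
  shows "contraction (\<Gamma>, w) D S \<sigma> \<psi> = contraction (\<Gamma>, w') D S \<sigma> \<psi>"
    "contraction D' (\<Gamma>, w) S' \<sigma>' \<psi>' = contraction D' (\<Gamma>, w') S' \<sigma>' \<psi>'"
proof -
  have c: "can_deg (\<Gamma>, w) v = can_deg (\<Gamma>, w') v" if "v \<in> verts \<Gamma>" for v
    using assms[OF that] by (simp add: can_deg_def)
  then have "(\<Sum>v | v \<in> verts \<Gamma> \<and> \<sigma> v = x. can_deg (\<Gamma>, w) v) = (\<Sum>v | v \<in> verts \<Gamma> \<and> \<sigma> v = x. can_deg (\<Gamma>, w') v)" for x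
    by (intro sum.cong) auto
  then show "contraction (\<Gamma>, w) D S \<sigma> \<psi> = contraction (\<Gamma>, w') D S \<sigma> \<psi>"
    by (cases D) (simp add: contraction_def)
  show "contraction D' (\<Gamma>, w) S' \<sigma>' \<psi>' = contraction D' (\<Gamma>, w') S' \<sigma>' \<psi>'"
    using c by (cases D') (simp add: contraction_def)
qed

lemma trivalent_iso:
  assumes c: "contraction (\<Gamma>, \<lambda>_. 0) (\<Delta>, w') {} \<sigma> \<psi>" and t: "trivalent g n \<Gamma>"
  shows "trivalent g n \<Delta>" "contraction (\<Gamma>, \<lambda>_. 0) (\<Delta>, \<lambda>_. 0) {} \<sigma> \<psi>"
proof -
  note g = trivalent_leg_graph[OF t]
  have "int (card (edges \<Delta>)) = 3 * int g - 3 + int n"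
    using card_edges_contraction[OF c g] card_edges_trivalent[OF t] by simp
  note * = trivalent_if_card_edges[OF stable_graph_contraction[OF c trivalent_stable_graph[OF t]] this]
  show "trivalent g n \<Delta>" by (rule *(1))
  show "contraction (\<Gamma>, \<lambda>_. 0) (\<Delta>, \<lambda>_. 0) {} \<sigma> \<psi>"
    using c weight_cong(2)[of \<Delta> w' "\<lambda>_. 0"] *(2) by blast
qed

lemma three_regular_graphs_eq:
  "three_regular_graphs g n = class_representatives {\<Gamma>. trivalent g n \<Gamma>} graph_iso"
  by (simp add: three_regular_graphs_def trivalent_def)

lemma three_regular_graphs:
  shows "\<And>\<Gamma>. \<Gamma> \<in> three_regular_graphs g n \<Longrightarrow> trivalent g n \<Gamma>"
    "\<And>\<Gamma> :: (nat, nat) graph. trivalent g n \<Gamma> \<Longrightarrow> \<exists>\<Delta>\<in>three_regular_graphs g n. graph_iso \<Gamma> \<Delta>"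
    "\<And>\<Gamma> \<Delta>. \<Gamma> \<in> three_regular_graphs g n \<Longrightarrow> \<Delta> \<in> three_regular_graphs g n \<Longrightarrow> graph_iso \<Gamma> \<Delta> \<Longrightarrow> \<Gamma> = \<Delta>"
proof -
  have *: "graph_iso x x" "x \<in> {\<Gamma>. trivalent g n \<Gamma>} \<Longrightarrow> graph_iso x y \<Longrightarrow> graph_iso y x"
    "x \<in> {\<Gamma>. trivalent g n \<Gamma>} \<Longrightarrow> graph_iso x y \<Longrightarrow> graph_iso y z \<Longrightarrow> graph_iso x z" for x y z :: "(nat, nat) graph"
    unfolding graph_iso_iff_wgraph_iso
    using wgraph_iso_refl wgraph_iso_sym[of n x] wgraph_iso_trans[of n x] trivalent_leg_graph[of g n x] by blast+
  have "three_regular_graphs g n \<subseteq> {\<Gamma>. trivalent g n \<Gamma>}"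
    unfolding three_regular_graphs_eq by (rule class_representatives(1)) (use * in blast)+
  then show "trivalent g n \<Gamma>" if "\<Gamma> \<in> three_regular_graphs g n" for \<Gamma> using that by blast
  show "\<exists>\<Delta>\<in>three_regular_graphs g n. graph_iso \<Gamma> \<Delta>" if "trivalent g n \<Gamma>" for \<Gamma> :: "(nat, nat) graph"
    unfolding three_regular_graphs_eq by (rule class_representatives(2)) (use * that in blast)+
  show "\<Gamma> = \<Delta>" if "\<Gamma> \<in> three_regular_graphs g n" "\<Delta> \<in> three_regular_graphs g n" "graph_iso \<Gamma> \<Delta>" for \<Gamma> \<Delta>
    by (rule class_representatives(3)[of graph_iso "{\<Gamma>. trivalent g n \<Gamma>}"])
      (use * that three_regular_graphs_eq in blast)+
qed

lemma stable_graphs: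
  shows "\<And>\<Gamma> w. (\<Gamma>, w) \<in> stable_graphs g n \<Longrightarrow> stable_graph g n (\<Gamma>, w)"
    "\<And>\<Gamma> w. stable_graph g n (\<Gamma> :: (nat, nat) graph, w) \<Longrightarrow> \<exists>D\<in>stable_graphs g n. wgraph_iso (\<Gamma>, w) D"
    "\<And>G D. G \<in> stable_graphs g n \<Longrightarrow> D \<in> stable_graphs g n \<Longrightarrow> wgraph_iso G D \<Longrightarrow> G = D"
proof -
  have *: "wgraph_iso x x" "x \<in> {G. stable_graph g n G} \<Longrightarrow> wgraph_iso x y \<Longrightarrow> wgraph_iso y x"
    "x \<in> {G. stable_graph g n G} \<Longrightarrow> wgraph_iso x y \<Longrightarrow> wgraph_iso y z \<Longrightarrow> wgraph_iso x z" for x y z :: "(nat, nat) wgraph"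
    using wgraph_iso_refl wgraph_iso_sym[of n "fst x" "snd x" "fst y" "snd y"]
      wgraph_iso_trans[of n "fst x" "snd x" "fst y" "snd y" "fst z" "snd z"]
      stable_graphD(2)[of g n "fst x" "snd x"] by simp_all
  have "stable_graphs g n \<subseteq> {G. stable_graph g n G}"
    unfolding stable_graphs_def by (rule class_representatives(1)) (use * in blast)+
  then show "stable_graph g n (\<Gamma>, w)" if "(\<Gamma>, w) \<in> stable_graphs g n" for \<Gamma> w using that by blast
  show "\<exists>D\<in>stable_graphs g n. wgraph_iso (\<Gamma>, w) D" if "stable_graph g n (\<Gamma>, w)" for \<Gamma> :: "(nat, nat) graph" and w
    unfolding stable_graphs_def by (rule class_representatives(2)) (use * that in blast)+
  show "G = D" if "G \<in> stable_graphs g n" "D \<in> stable_graphs g n" "wgraph_iso G D" for G D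
    by (rule class_representatives(3)[of wgraph_iso "{G. stable_graph g n G}"])
      (use * that stable_graphs_def in blast)+
qed

text \<open>Normal forms of bounded size are finite in number, and choosing one for each
  representative is injective because distinct representatives are not isomorphic.\<close>

lemma finite_three_regular_graphs: "finite (three_regular_graphs g n)"
proof -
  \<comment> \<open>A 3-regular graph has \<open>2g - 2 + n\<close> vertices and
    \<open>6g - 6 + 3n\<close> half-edges; the bounds avoid subtraction of naturals.\<close>
  let ?N = "3 * g + n" and ?M = "6 * g + 3 * n"
  let ?F = "\<Union>a\<in>{..?N}. \<Union>b\<in>{..?M}.
     (\<lambda>(f, p, l). \<lparr>verts = {..<a}, halfs = {..<b}, bar = f, endpt = p, leg_list = l\<rparr>) `
       (({..<b} \<rightarrow>\<^sub>E {..<b}) \<times> ({..<b} \<rightarrow>\<^sub>E {..<a}) \<times> {l. set l \<subseteq> {..<b} \<and> length l = n})"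
  have fin: "finite ?F"
    by (intro finite_UN_I finite_atMost finite_imageI finite_cartesian_product finite_PiE
        finite_lists_length_eq finite_lessThan)
  have "\<exists>\<Delta>\<in>?F. graph_iso \<Gamma> \<Delta>" if \<Gamma>: "\<Gamma> \<in> three_regular_graphs g n" for \<Gamma>
  proof -
    have t: "trivalent g n \<Gamma>" using three_regular_graphs(1) \<Gamma> .
    note g = trivalent_leg_graph[OF t]
    obtain \<Delta> :: "(nat, nat) graph" and w' \<sigma> \<psi> where c: "contraction (\<Gamma>, \<lambda>_. 0) (\<Delta>, w') {} \<sigma> \<psi>"
      and v: "verts \<Delta> = {..<card (verts \<Gamma>)}" "halfs \<Delta> = {..<card (halfs \<Gamma>)}"
        "bar \<Delta> \<in> extensional (halfs \<Delta>)" "endpt \<Delta> \<in> extensional (halfs \<Delta>)"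
      using exists_nat_graph[OF g, of "\<lambda>_. 0"] by blast
    note D = leg_graphD[OF contraction_leg_graph[OF c g]]
    have e: "int (card (edges \<Gamma>)) = 3 * int g - 3 + int n" by (rule card_edges_trivalent[OF t])
    then have "card (halfs \<Gamma>) \<le> ?M" using card_halfs[OF g] by simp
    moreover have "int (card (edges \<Gamma>)) - int (card (verts \<Gamma>)) + 1 = int g"
      using t by (simp add: trivalent_def b1_def)
    then have "card (verts \<Gamma>) \<le> ?N" using e by simp
    moreover have "\<Delta> = (\<lambda>(f, p, l). \<lparr>verts = {..<card (verts \<Gamma>)}, halfs = {..<card (halfs \<Gamma>)}, bar = f, endpt = p, leg_list = l\<rparr>)
        (bar \<Delta>, endpt \<Delta>, leg_list \<Delta>)" using v by simp
    moreover have "(bar \<Delta>, endpt \<Delta>, leg_list \<Delta>) \<in> ({..<card (halfs \<Gamma>)} \<rightarrow>\<^sub>E {..<card (halfs \<Gamma>)}) \<times>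
      ({..<card (halfs \<Gamma>)} \<rightarrow>\<^sub>E {..<card (verts \<Gamma>)}) \<times> {l. set l \<subseteq> {..<card (halfs \<Gamma>)} \<and> length l = n}"
      using v D(4,6,8,9) by (auto simp: PiE_def legs_def)
    ultimately have "\<Delta> \<in> ?F"
      by (intro UN_I[of "card (verts \<Gamma>)"] UN_I[of "card (halfs \<Gamma>)"] image_eqI[where x = "(bar \<Delta>, endpt \<Delta>, leg_list \<Delta>)"])
        simp_all
    moreover have "graph_iso \<Gamma> \<Delta>"
      unfolding graph_iso_iff_wgraph_iso wgraph_iso_iff[OF g] using trivalent_iso(2)[OF c t] by blast
    ultimately show ?thesis by blast
  qed
  then have "\<forall>\<Gamma>\<in>three_regular_graphs g n. \<exists>\<Delta>. \<Delta> \<in> ?F \<and> graph_iso \<Gamma> \<Delta>"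
    unfolding Bex_def by (rule ballI)
  from bchoice[OF this] obtain f
    where f: "\<forall>\<Gamma>\<in>three_regular_graphs g n. f \<Gamma> \<in> ?F \<and> graph_iso \<Gamma> (f \<Gamma>)" ..
  have "inj_on f (three_regular_graphs g n)"
  proof (rule inj_onI)
    fix \<Gamma> \<Delta> assume *: "\<Gamma> \<in> three_regular_graphs g n" "\<Delta> \<in> three_regular_graphs g n" "f \<Gamma> = f \<Delta>"
    note g = trivalent_leg_graph[OF three_regular_graphs(1)]
    have "graph_iso \<Gamma> (f \<Gamma>)" using bspec[OF f *(1)] by (rule conjunct2)
    moreover have "graph_iso \<Delta> (f \<Gamma>)" unfolding *(3) using bspec[OF f *(2)] by (rule conjunct2)
    ultimately have "graph_iso \<Gamma> \<Delta>"
      unfolding graph_iso_iff_wgraph_iso using wgraph_iso_sym[OF g[OF *(2)]] wgraph_iso_trans[OF g[OF *(1)]] by blast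
    then show "\<Gamma> = \<Delta>" using three_regular_graphs(3) * by blast
  qed
  moreover have "f ` three_regular_graphs g n \<subseteq> ?F" using f by blast
  ultimately show ?thesis using fin by (rule inj_on_finite)
qed

section \<open>One-edge expansions\<close>

definition halfs_at :: "('v, 'h) graph \<Rightarrow> 'v \<Rightarrow> 'h set" where
  "halfs_at \<Gamma> v = {h \<in> halfs \<Gamma>. endpt \<Gamma> h = v}"

lemma valence_eq: "valence \<Gamma> v = card (halfs_at \<Gamma> v)"
  by (simp add: valence_def halfs_at_def)

lemma finite_halfs_at: "leg_graph n \<Gamma> \<Longrightarrow> finite (halfs_at \<Gamma> v)"
  by (simp add: halfs_at_def leg_graphD(3))

lemma can_deg_eq: "can_deg (\<Gamma>, w) v = 2 * int (w v) - 2 + int (card (halfs_at \<Gamma> v))"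
  by (simp add: can_deg_def valence_eq)

text \<open>The common frame of loops and splittings: the vertex set and the endpoints are still
  open, so that contracting the new edge is analysed once for both.\<close>

definition add_edge :: "('v, 'h) graph \<Rightarrow> 'h \<Rightarrow> 'h \<Rightarrow> 'v set \<Rightarrow> ('h \<Rightarrow> 'v) \<Rightarrow> ('v, 'h) graph" where
  "add_edge \<Gamma> a b V p = \<lparr>verts = V, halfs = insert a (insert b (halfs \<Gamma>)),
     bar = (bar \<Gamma>)(a := b, b := a), endpt = p, leg_list = leg_list \<Gamma>\<rparr>"

lemma add_edge_simps [simp]:
  "verts (add_edge \<Gamma> a b V p) = V" "halfs (add_edge \<Gamma> a b V p) = insert a (insert b (halfs \<Gamma>))"
  "bar (add_edge \<Gamma> a b V p) = (bar \<Gamma>)(a := b, b := a)" "endpt (add_edge \<Gamma> a b V p) = p"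
  "leg_list (add_edge \<Gamma> a b V p) = leg_list \<Gamma>"
  by (simp_all add: add_edge_def)

lemma leg_graph_add_edge:
  assumes g: "leg_graph n \<Gamma>" and ab: "a \<notin> halfs \<Gamma>" "b \<notin> halfs \<Gamma>" "a \<noteq> b"
    and V: "finite V" "p ` insert a (insert b (halfs \<Gamma>)) \<subseteq> V"
  shows "leg_graph n (add_edge \<Gamma> a b V p)"
proof -
  note D = leg_graphD[OF g]
  have nb: "bar \<Gamma> h \<noteq> a" "bar \<Gamma> h \<noteq> b" if "h \<in> halfs \<Gamma>" for h using D(4)[OF that] ab by auto
  have "legs (add_edge \<Gamma> a b V p) = legs \<Gamma>" using ab by (auto simp: legs_def)
  moreover have "V \<noteq> {}" using V by auto
  moreover have "\<forall>h\<in>insert a (insert b (halfs \<Gamma>)). p h \<in> V" using V(2) by blast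
  ultimately show ?thesis using D V(1) ab nb by (auto simp: leg_graph_def)
qed

lemma rtrancl_symmetric_pair: "(x, y) \<in> {(s, t), (t, s)}\<^sup>* \<longleftrightarrow> x = y \<or> (x, y) \<in> {(s, t), (t, s)}"
proof
  show "x = y \<or> (x, y) \<in> {(s, t), (t, s)}" if "(x, y) \<in> {(s, t), (t, s)}\<^sup>*"
    using that by (induction rule: rtrancl_induct) auto
qed auto

lemma contraction_add_edge:
  assumes g: "leg_graph n \<Gamma>" and ab: "a \<notin> halfs \<Gamma>" "b \<notin> halfs \<Gamma>" "a \<noteq> b"
    and \<sigma>: "\<sigma> ` V = verts \<Gamma>" and p: "\<And>h. h \<in> halfs \<Gamma> \<Longrightarrow> \<sigma> (p h) = endpt \<Gamma> h"
    and V: "\<And>x y. x \<in> V \<Longrightarrow> y \<in> V \<Longrightarrow> \<sigma> x = \<sigma> y \<longleftrightarrow> x = y \<or> (x, y) \<in> {(p a, p b), (p b, p a)}"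
    and k: "\<And>x. x \<in> verts \<Gamma> \<Longrightarrow>
      can_deg (\<Gamma>, w) x = (\<Sum>v | v \<in> V \<and> \<sigma> v = x. can_deg (add_edge \<Gamma> a b V p, w') v)"
  shows "contraction (add_edge \<Gamma> a b V p, w') (\<Gamma>, w) {{a, b}} \<sigma> id"
proof -
  note D = leg_graphD[OF g]
  let ?A = "add_edge \<Gamma> a b V p"
  have e: "{h, bar ?A h} = {a, b} \<longleftrightarrow> h = a \<or> h = b" if "h \<in> insert a (insert b (halfs \<Gamma>))" for h
    using that ab D(4)[of h] by (auto simp: doubleton_eq_iff)
  have adj: "adjacent_via ?A {{a, b}} = {(p a, p b), (p b, p a)}"
  proof -
    have "adjacent_via ?A {{a, b}} = (\<lambda>h. (p h, p (bar ?A h))) ` {h \<in> insert a (insert b (halfs \<Gamma>)). {h, bar ?A h} = {a, b}}"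
      by (auto simp: adjacent_via_def simp del: fun_upd_apply)
    also have "{h \<in> insert a (insert b (halfs \<Gamma>)). {h, bar ?A h} = {a, b}} = {a, b}"
      using e by blast
    finally show ?thesis using ab(3) by simp
  qed
  have free: "free_halfs ?A {{a, b}} = halfs \<Gamma>" using e ab by (auto simp: free_halfs_def)
  have "{a, b} \<in> edges ?A" using ab(3) by (auto simp: edges_def intro!: exI[of _ a])
  moreover have "\<forall>x\<in>V. \<forall>y\<in>V. \<sigma> x = \<sigma> y \<longleftrightarrow> (x, y) \<in> (adjacent_via ?A {{a, b}})\<^sup>*"
    unfolding adj rtrancl_symmetric_pair using V by blast
  moreover have "\<forall>h\<in>halfs \<Gamma>. h \<noteq> a \<and> h \<noteq> b" using ab by auto
  ultimately show ?thesis
    unfolding contraction_def case_prod_conv free using \<sigma> p k by simp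
qed

definition add_loop :: "('v, 'h) wgraph \<Rightarrow> 'v \<Rightarrow> 'h \<Rightarrow> 'h \<Rightarrow> ('v, 'h) wgraph" where
  "add_loop = (\<lambda>(\<Gamma>, w) v a b. (add_edge \<Gamma> a b (verts \<Gamma>) ((endpt \<Gamma>)(a := v, b := v)), w(v := w v - 1)))"

definition split_vertex ::
    "('v, 'h) wgraph \<Rightarrow> 'v \<Rightarrow> 'v \<Rightarrow> 'h \<Rightarrow> 'h \<Rightarrow> 'h set \<Rightarrow> nat \<Rightarrow> ('v, 'h) wgraph" where
  "split_vertex = (\<lambda>(\<Gamma>, w) v v' a b I j.
     (add_edge \<Gamma> a b (insert v' (verts \<Gamma>)) ((\<lambda>h. if h \<in> I then v' else endpt \<Gamma> h)(a := v, b := v')),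
      w(v := w v - j, v' := j)))"

text \<open>The choice of an expansion is separated from the names of the new vertex and half-edges,
  so that the same choice can be made in different graphs, in either order and under different
  names.\<close>

datatype ('v, 'h) expansion = Loop 'v | Split 'v "'h set" nat

fun centre :: "('v, 'h) expansion \<Rightarrow> 'v" where
  "centre (Loop v) = v"
| "centre (Split v I j) = v"

fun expand :: "('v, 'h) wgraph \<Rightarrow> ('v, 'h) expansion \<Rightarrow> 'v \<Rightarrow> 'h \<Rightarrow> 'h \<Rightarrow> ('v, 'h) wgraph" where
  "expand G (Loop v) v' a b = add_loop G v a b"
| "expand G (Split v I j) v' a b = split_vertex G v v' a b I j"

text \<open>The new edge adds one half-edge on each side of a splitting, so the two bounds say
  exactly that both parts have degree at least one.\<close>

fun admissible :: "('v, 'h) wgraph \<Rightarrow> ('v, 'h) expansion \<Rightarrow> bool" where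
  "admissible (\<Gamma>, w) (Loop v) \<longleftrightarrow> v \<in> verts \<Gamma> \<and> w v \<ge> 1"
| "admissible (\<Gamma>, w) (Split v I j) \<longleftrightarrow> v \<in> verts \<Gamma> \<and> I \<subseteq> halfs_at \<Gamma> v \<and> j \<le> w v \<and>
     2 * j + card I \<ge> 2 \<and> 2 * (w v - j) + card (halfs_at \<Gamma> v - I) \<ge> 2"

definition fresh :: "('v, 'h) graph \<Rightarrow> 'v \<Rightarrow> 'h \<Rightarrow> 'h \<Rightarrow> bool" where
  "fresh \<Gamma> v' a b \<longleftrightarrow> v' \<notin> verts \<Gamma> \<and> a \<notin> halfs \<Gamma> \<and> b \<notin> halfs \<Gamma> \<and> a \<noteq> b"

lemma halfs_at_add_loop:
  assumes "fresh \<Gamma> v' a b"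
  shows "halfs_at (fst (add_loop (\<Gamma>, w) v a b)) x =
    (if x = v then insert a (insert b (halfs_at \<Gamma> x)) else halfs_at \<Gamma> x)"
  using assms by (auto simp: add_loop_def halfs_at_def fresh_def)

lemma halfs_at_split_vertex:
  assumes "leg_graph n \<Gamma>" "fresh \<Gamma> v' a b" "v \<in> verts \<Gamma>" "I \<subseteq> halfs_at \<Gamma> v" "x \<in> insert v' (verts \<Gamma>)"
  shows "halfs_at (fst (split_vertex (\<Gamma>, w) v v' a b I j)) x =
    (if x = v' then insert b I else if x = v then insert a (halfs_at \<Gamma> v - I) else halfs_at \<Gamma> x)"
  using assms leg_graphD(6)[OF assms(1)] by (auto simp: split_vertex_def halfs_at_def fresh_def)

lemma can_deg_add_loop:
  assumes "leg_graph n \<Gamma>" "fresh \<Gamma> v' a b" "w v \<ge> 1"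
  shows "can_deg (add_loop (\<Gamma>, w) v a b) x = can_deg (\<Gamma>, w) x"
proof -
  have "a \<notin> halfs_at \<Gamma> x" "b \<notin> halfs_at \<Gamma> x" "a \<noteq> b" using assms(2) by (auto simp: fresh_def halfs_at_def)
  then show ?thesis
    using halfs_at_add_loop[OF assms(2), of w v x] finite_halfs_at[OF assms(1), of x] assms(3)
    by (cases "x = v") (simp_all add: add_loop_def can_deg_eq)
qed

lemma can_deg_split_vertex:
  assumes "leg_graph n \<Gamma>" "fresh \<Gamma> v' a b" "v \<in> verts \<Gamma>" "I \<subseteq> halfs_at \<Gamma> v" "j \<le> w v"
    and x: "x \<in> insert v' (verts \<Gamma>)"
  shows "can_deg (split_vertex (\<Gamma>, w) v v' a b I j) x =
    (if x = v' then 2 * int j + int (card I) - 1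
     else if x = v then 2 * int (w v - j) + int (card (halfs_at \<Gamma> v - I)) - 1 else can_deg (\<Gamma>, w) x)"
proof -
  have ab: "a \<notin> halfs_at \<Gamma> v" "b \<notin> I" "v' \<noteq> v"
    using assms(2-4) by (auto simp: fresh_def halfs_at_def)
  have fin: "finite I" "finite (halfs_at \<Gamma> v)" using finite_halfs_at[OF assms(1)] finite_subset[OF assms(4)] by auto
  show ?thesis
    using halfs_at_split_vertex[OF assms(1-4) x, of w j] ab fin by (simp add: split_vertex_def can_deg_eq)
qed

text \<open>A loop trades one unit of weight, counted twice in the degree, for two half-edges. A
  splitting divides weight and half-edges between two vertices, and the two new half-edges pay for
  the additional \<open>-2\<close>. So the degree sum over each fibre is preserved.\<close>

lemma contraction_expand:
  assumes g: "leg_graph n \<Gamma>" and f: "fresh \<Gamma> v' a b" and a: "admissible (\<Gamma>, w) \<epsilon>"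
  shows "leg_graph n (fst (expand (\<Gamma>, w) \<epsilon> v' a b))"
    "contraction (expand (\<Gamma>, w) \<epsilon> v' a b) (\<Gamma>, w) {{a, b}} (\<lambda>x. if x = v' then centre \<epsilon> else x) id"
proof -
  note D = leg_graphD[OF g]
  have fr: "v' \<notin> verts \<Gamma>" "a \<notin> halfs \<Gamma>" "b \<notin> halfs \<Gamma>" "a \<noteq> b" using f by (auto simp: fresh_def)
  have "leg_graph n (fst (expand (\<Gamma>, w) \<epsilon> v' a b)) \<and>
     contraction (expand (\<Gamma>, w) \<epsilon> v' a b) (\<Gamma>, w) {{a, b}} (\<lambda>x. if x = v' then centre \<epsilon> else x) id"
  proof (cases \<epsilon>)
    case (Loop v)
    then have v: "v \<in> verts \<Gamma>" "w v \<ge> 1" using a by auto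
    have k: "can_deg (add_edge \<Gamma> a b (verts \<Gamma>) ((endpt \<Gamma>)(a := v, b := v)), w(v := w v - 1)) x = can_deg (\<Gamma>, w) x" for x
      using can_deg_add_loop[OF g f, where w = w and v = v] v by (simp add: add_loop_def)
    have "contraction (add_edge \<Gamma> a b (verts \<Gamma>) ((endpt \<Gamma>)(a := v, b := v)), w(v := w v - 1)) (\<Gamma>, w) {{a, b}}
      (\<lambda>x. if x = v' then v else x) id"
    proof (rule contraction_add_edge[OF g fr(2-4)])
      fix x assume "x \<in> verts \<Gamma>"
      then have "{u. u \<in> verts \<Gamma> \<and> (if u = v' then v else u) = x} = {x}" using fr by auto
      then show "can_deg (\<Gamma>, w) x = (\<Sum>u | u \<in> verts \<Gamma> \<and> (if u = v' then v else u) = x.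
          can_deg (add_edge \<Gamma> a b (verts \<Gamma>) ((endpt \<Gamma>)(a := v, b := v)), w(v := w v - 1)) u)"
        by (simp add: k del: One_nat_def)
    next
      show "(\<lambda>x. if x = v' then v else x) ` verts \<Gamma> = verts \<Gamma>"
        using fr(1) image_cong[of "verts \<Gamma>" "verts \<Gamma>" "\<lambda>x. if x = v' then v else x" id] by auto
    next
      fix h assume h: "h \<in> halfs \<Gamma>"
      then have "h \<noteq> a" "h \<noteq> b" "endpt \<Gamma> h \<noteq> v'" using fr D(6)[OF h] by auto
      then show "(if ((endpt \<Gamma>)(a := v, b := v)) h = v' then v else ((endpt \<Gamma>)(a := v, b := v)) h) = endpt \<Gamma> h"
        by simp
    qed (use fr in auto)
    moreover have "leg_graph n (add_edge \<Gamma> a b (verts \<Gamma>) ((endpt \<Gamma>)(a := v, b := v)))"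
      by (rule leg_graph_add_edge[OF g fr(2-4) D(1)]) (use v D(6) in auto)
    ultimately show ?thesis
      unfolding Loop expand.simps centre.simps add_loop_def case_prod_conv fst_conv by blast
  next
    case (Split v I j)
    then have v: "v \<in> verts \<Gamma>" "I \<subseteq> halfs_at \<Gamma> v" "j \<le> w v" using a by auto
    let ?V = "insert v' (verts \<Gamma>)" and ?p = "(\<lambda>h. if h \<in> I then v' else endpt \<Gamma> h)(a := v, b := v')"
    let ?w = "w(v := w v - j, v' := j)" and ?\<sigma> = "\<lambda>x. if x = v' then v else x"
    have k: "can_deg (add_edge \<Gamma> a b ?V ?p, ?w) x =
      (if x = v' then 2 * int j + int (card I) - 1
       else if x = v then 2 * int (w v - j) + int (card (halfs_at \<Gamma> v - I)) - 1 else can_deg (\<Gamma>, w) x)"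
      if "x \<in> ?V" for x
      using can_deg_split_vertex[where w = w and j = j, OF g f v that] by (simp add: split_vertex_def)
    have "contraction (add_edge \<Gamma> a b ?V ?p, ?w) (\<Gamma>, w) {{a, b}} ?\<sigma> id"
    proof (rule contraction_add_edge[OF g fr(2-4)])
      fix x assume x: "x \<in> verts \<Gamma>"
      show "can_deg (\<Gamma>, w) x = (\<Sum>u | u \<in> ?V \<and> ?\<sigma> u = x. can_deg (add_edge \<Gamma> a b ?V ?p, ?w) u)"
      proof (cases "x = v")
        case True
        then have s: "{u. u \<in> ?V \<and> ?\<sigma> u = x} = {v', v}" using v by auto
        have "card (halfs_at \<Gamma> v) = card I + card (halfs_at \<Gamma> v - I)"
          using v(2) finite_halfs_at[OF g, of v] card_mono[OF finite_halfs_at[OF g] v(2)]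
          by (simp add: card_Diff_subset finite_subset)
        moreover have "v' \<noteq> v" using v fr by auto
        ultimately show ?thesis unfolding s using k[of v] k[of v'] v True by (simp add: can_deg_eq)
      next
        case False
        then have s: "{u. u \<in> ?V \<and> ?\<sigma> u = x} = {x}" using x fr by auto
        have "x \<noteq> v'" using x fr by auto
        then show ?thesis unfolding s using k[of x] x False by simp
      qed
    qed (use fr v D(6) in \<open>auto simp: halfs_at_def\<close>)
    moreover have "leg_graph n (add_edge \<Gamma> a b ?V ?p)"
      by (rule leg_graph_add_edge[OF g fr(2-4)]) (use v D(1,6) in auto)
    ultimately show ?thesis
      unfolding Split expand.simps centre.simps split_vertex_def case_prod_conv fst_conv by blast
  qed
  then show "leg_graph n (fst (expand (\<Gamma>, w) \<epsilon> v' a b))"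
    "contraction (expand (\<Gamma>, w) \<epsilon> v' a b) (\<Gamma>, w) {{a, b}} (\<lambda>x. if x = v' then centre \<epsilon> else x) id" by auto
qed

lemma stable_graph_expand:
  assumes s: "stable_graph g n (\<Gamma>, w)" and f: "fresh \<Gamma> v' a b" and a: "admissible (\<Gamma>, w) \<epsilon>"
  shows "stable_graph g n (expand (\<Gamma>, w) \<epsilon> v' a b)"
    "card (edges (fst (expand (\<Gamma>, w) \<epsilon> v' a b))) = card (edges \<Gamma>) + 1"
proof -
  note sD = stable_graphD[OF s]
  note c = contraction_expand[OF sD(2) f a]
  obtain \<Delta> w' where e: "expand (\<Gamma>, w) \<epsilon> v' a b = (\<Delta>, w')" by (cases "expand (\<Gamma>, w) \<epsilon> v' a b")
  obtain \<sigma> where \<sigma>: "contraction (\<Delta>, w') (\<Gamma>, w) {{a, b}} \<sigma> id" using c(2) unfolding e by blast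
  have g: "leg_graph n \<Delta>" using c(1) e by simp
  have "can_deg (\<Delta>, w') x \<ge> 1" if x: "x \<in> verts \<Delta>" for x
  proof (cases \<epsilon>)
    case (Loop v)
    then have "(\<Delta>, w') = add_loop (\<Gamma>, w) v a b" "w v \<ge> 1" using e a by auto
    moreover from this have "x \<in> verts \<Gamma>" using x by (auto simp: add_loop_def)
    ultimately show ?thesis using can_deg_add_loop[OF sD(2) f] sD(3) by simp
  next
    case (Split v I j)
    then have v: "v \<in> verts \<Gamma>" "I \<subseteq> halfs_at \<Gamma> v" "j \<le> w v" "2 * j + card I \<ge> 2"
      "2 * (w v - j) + card (halfs_at \<Gamma> v - I) \<ge> 2" using a by auto
    have d: "(\<Delta>, w') = split_vertex (\<Gamma>, w) v v' a b I j" using e Split by simp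
    then have x': "x \<in> insert v' (verts \<Gamma>)" using x by (auto simp: split_vertex_def)
    show ?thesis unfolding d can_deg_split_vertex[where w = w, OF sD(2) f v(1-3) x'] using v(4,5) sD(3) x' by auto
  qed
  then show "stable_graph g n (expand (\<Gamma>, w) \<epsilon> v' a b)"
    unfolding e using stable_graph_expansion[OF \<sigma> s g] by blast
  show "card (edges (fst (expand (\<Gamma>, w) \<epsilon> v' a b))) = card (edges \<Gamma>) + 1"
    using card_edges_contraction[OF \<sigma> g] e by simp
qed

text \<open>At weight zero a positive contribution to the codimension means valence at least 4,
  enough for two half-edges on each side of a splitting; at positive weight a loop can be
  added.\<close>

lemma exists_admissible:
  assumes s: "stable_graph g n (\<Gamma>, w)" and v: "v \<in> verts \<Gamma>" and c: "can_deg (\<Gamma>, w) v - 1 + int (w v) \<ge> 1"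
  shows "\<exists>\<epsilon>. admissible (\<Gamma>, w) \<epsilon> \<and> centre \<epsilon> = v"
proof (cases "w v = 0")
  case True
  then have H: "card (halfs_at \<Gamma> v) \<ge> 4" using c by (simp add: can_deg_eq)
  then have "2 \<le> card (halfs_at \<Gamma> v)" by simp
  then obtain I where I: "I \<subseteq> halfs_at \<Gamma> v" "card I = 2" by (rule obtain_subset_with_card_n)
  then have "card (halfs_at \<Gamma> v - I) \<ge> 2"
    using H finite_subset[OF I(1) finite_halfs_at[OF stable_graphD(2)[OF s]]] by (simp add: card_Diff_subset)
  then show ?thesis using I v True by (intro exI[of _ "Split v I 0"]) simp
next
  case False
  then show ?thesis using v by (intro exI[of _ "Loop v"]) simp
qed

definition contracts_to :: "('v, 'h) wgraph \<Rightarrow> ('v2, 'h2) wgraph \<Rightarrow> bool" where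
  "contracts_to G D \<longleftrightarrow> (\<exists>S \<sigma> \<psi>. contraction G D S \<sigma> \<psi>)"

lemma contracts_to_trans:
  assumes "contracts_to (\<Gamma>, w) (\<Delta>, w')" "contracts_to (\<Delta>, w') (\<Theta>, w'')" "leg_graph n \<Gamma>"
  shows "contracts_to (\<Gamma>, w) (\<Theta>, w'')"
  using assms contraction_comp unfolding contracts_to_def by blast

lemma contracts_to_expand:
  assumes "leg_graph n \<Gamma>" "fresh \<Gamma> v' a b" "admissible (\<Gamma>, w) \<epsilon>"
  shows "contracts_to (expand (\<Gamma>, w) \<epsilon> v' a b) (\<Gamma>, w)"
  using contraction_expand(2)[OF assms] unfolding contracts_to_def by blast

text \<open>Two disjoint supplies of names allow two expansions to be carried out in either order
  with the same result.\<close>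

lemma exists_fresh:
  fixes \<Gamma> :: "(nat, nat) graph"
  assumes "leg_graph n \<Gamma>"
  shows "\<exists>v' a b u' c d. fresh \<Gamma> v' a b \<and> fresh \<Gamma> u' c d \<and> u' \<noteq> v' \<and> {a, b} \<inter> {c, d} = {}"
proof -
  obtain N where N: "\<forall>v\<in>verts \<Gamma>. v < N" using leg_graphD(1)[OF assms] finite_nat_set_iff_bounded by metis
  obtain M where M: "\<forall>h\<in>halfs \<Gamma>. h < M" using leg_graphD(3)[OF assms] finite_nat_set_iff_bounded by metis
  show ?thesis
    by (rule exI[of _ N], rule exI[of _ M], rule exI[of _ "M + 1"], rule exI[of _ "N + 1"],
        rule exI[of _ "M + 2"], rule exI[of _ "M + 3"]) (use N M in \<open>auto simp: fresh_def\<close>)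
qed

theorem exists_trivalent_expansion:
  fixes \<Gamma> :: "(nat, nat) graph"
  assumes "stable_graph g n (\<Gamma>, w)"
  shows "\<exists>A :: (nat, nat) graph. trivalent g n A \<and> contracts_to (A, \<lambda>_. 0) (\<Gamma>, w)"
  using assms
proof (induction "nat (3 * int g - 3 + int n - int (card (edges \<Gamma>)))" arbitrary: \<Gamma> w rule: less_induct)
  case less
  note s = stable_graphD[OF less.prems]
  show ?case
  proof (cases "int (card (edges \<Gamma>)) = 3 * int g - 3 + int n")
    case True
    note t = trivalent_if_card_edges[OF less.prems True]
    \<comment> \<open>\<open>w\<close> is known to vanish on the vertices only, so the two weighted
      graphs need not be equal.\<close>
    have "contraction (\<Gamma>, \<lambda>_. 0) (\<Gamma>, w) {} id id"
      using contraction_id[OF s(2), of w] weight_cong(1)[of \<Gamma> w "\<lambda>_. 0"] t(2) by blast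
    then show ?thesis using t(1) unfolding contracts_to_def by blast
  next
    case False
    then have lt: "int (card (edges \<Gamma>)) < 3 * int g - 3 + int n" using card_edges_le(1)[OF less.prems] by simp
    have "\<exists>v\<in>verts \<Gamma>. can_deg (\<Gamma>, w) v - 1 + int (w v) \<ge> 1"
    proof (rule ccontr)
      assume "\<not> ?thesis"
      then have "(\<Sum>v\<in>verts \<Gamma>. can_deg (\<Gamma>, w) v - 1 + int (w v)) \<le> 0" by (intro sum_nonpos) auto
      then show False using card_edges_codim[OF s(2), of w, unfolded s(4)] lt by simp
    qed
    then obtain \<epsilon> where \<epsilon>: "admissible (\<Gamma>, w) \<epsilon>" using exists_admissible[OF less.prems] by blast
    obtain v' a b where f: "fresh \<Gamma> v' a b" using exists_fresh[OF s(2)] by blast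
    obtain \<Delta> w' where e: "expand (\<Gamma>, w) \<epsilon> v' a b = (\<Delta>, w')" by (cases "expand (\<Gamma>, w) \<epsilon> v' a b")
    have sD: "stable_graph g n (\<Delta>, w')" "card (edges \<Delta>) = card (edges \<Gamma>) + 1"
      using stable_graph_expand[OF less.prems f \<epsilon>] by (auto simp: e)
    obtain A :: "(nat, nat) graph" where A: "trivalent g n A" "contracts_to (A, \<lambda>_. 0) (\<Delta>, w')"
      using less.hyps[OF _ sD(1)] sD(2) lt by auto
    have "contracts_to (\<Delta>, w') (\<Gamma>, w)" using contracts_to_expand[OF s(2) f \<epsilon>] by (simp add: e)
    then show ?thesis using A contracts_to_trans[OF A(2) _ trivalent_leg_graph[OF A(1)]] by blast
  qed
qed

section \<open>Every one-edge contraction is an expansion\<close>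

text \<open>The converse of \<open>contraction_add_edge\<close>: \<open>A\<close> is
  \<open>\<Gamma>\<close> with one edge attached, and the bijection of half-edges is extended by the
  two contracted ones. Loops and edges with distinct ends differ only in the choice of
  \<open>\<tau>\<close> and \<open>p\<close>.\<close>

lemma isomorphism_add_edge:
  assumes g: "leg_graph n A" and c: "contraction (A, u) (\<Gamma>, w) {{a0, b0}} \<sigma> \<psi>"
    and a0: "a0 \<in> halfs A" "b0 = bar A a0" "a0 \<noteq> b0"
    and ab: "a \<notin> halfs \<Gamma>" "b \<notin> halfs \<Gamma>" "a \<noteq> b"
    and \<tau>: "bij_betw \<tau> (verts A) V"
    and p: "\<And>h. h \<in> free_halfs A {{a0, b0}} \<Longrightarrow> p (\<psi> h) = \<tau> (endpt A h)"
      "p a = \<tau> (endpt A a0)" "p b = \<tau> (endpt A b0)"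
  shows "graph_isomorphism A (add_edge \<Gamma> a b V p) \<tau> (\<psi>(a0 := a, b0 := b))"
proof -
  note C = contractionD[OF c] and D = leg_graphD[OF g]
  let ?F = "free_halfs A {{a0, b0}}" and ?\<psi> = "\<psi>(a0 := a, b0 := b)"
  have b0: "b0 \<in> halfs A" "bar A b0 = a0" using D(4,5) a0 by auto
  have e: "{h, bar A h} = {a0, b0} \<longleftrightarrow> h = a0 \<or> h = b0" for h
    using a0 b0 by (auto simp: doubleton_eq_iff)
  have H: "halfs A = insert a0 (insert b0 ?F)" "a0 \<notin> ?F" "b0 \<notin> ?F"
    using a0 b0 e by (auto simp: free_halfs_def)
  have \<psi>: "?\<psi> h = \<psi> h" if "h \<in> ?F" for h using that H by auto
  have F: "bar A h \<in> ?F" if "h \<in> ?F" for h by (rule free_halfs_bar[OF g that])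
  have im: "\<psi> h \<in> halfs \<Gamma>" "\<psi> h \<noteq> a" "\<psi> h \<noteq> b" if "h \<in> ?F" for h
    using bij_betw_apply[OF C(4) that] ab by auto
  have "bij_betw ?\<psi> (?F \<union> {b0} \<union> {a0}) (halfs \<Gamma> \<union> {b} \<union> {a})"
  proof (intro bij_betw_combine)
    show "bij_betw ?\<psi> ?F (halfs \<Gamma>)" using bij_betw_cong[of ?F ?\<psi> \<psi> "halfs \<Gamma>"] \<psi> C(4) by blast
  qed (use a0 ab in auto)
  then have "bij_betw ?\<psi> (halfs A) (insert a (insert b (halfs \<Gamma>)))" unfolding H(1) by (simp add: insert_commute Un_commute)
  moreover have "?\<psi> (bar A h) = ((bar \<Gamma>)(a := b, b := a)) (?\<psi> h)" if h: "h \<in> halfs A" for h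
  proof -
    consider "h = a0" | "h = b0" | "h \<in> ?F" using h H by auto
    then show ?thesis
    proof cases
      case 3
      then show ?thesis using \<psi> F im C(5) by simp
    qed (use a0 b0 ab in auto)
  qed
  moreover have "\<tau> (endpt A h) = p (?\<psi> h)" if h: "h \<in> halfs A" for h
  proof -
    consider "h = a0" | "h = b0" | "h \<in> ?F" using h H by auto
    then show ?thesis
    proof cases
      case 3
      then show ?thesis using \<psi> p(1) by simp
    qed (use a0 p in auto)
  qed
  moreover have "map ?\<psi> (leg_list A) = leg_list \<Gamma>"
  proof -
    have "set (leg_list A) \<subseteq> ?F" using legs_subset_free_halfs[OF g C(1)] D(8) by simp
    then have "map ?\<psi> (leg_list A) = map \<psi> (leg_list A)"
      using \<psi> by (intro map_cong[OF refl]) blast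
    then show ?thesis using C(7) by simp
  qed
  ultimately show ?thesis using \<tau> by (simp add: graph_isomorphism_def)
qed

lemma halfs_at_contraction:
  assumes "contraction (A, u) (\<Gamma>, w) S \<sigma> \<psi>"
  shows "halfs_at \<Gamma> x = \<psi> ` {h \<in> free_halfs A S. \<sigma> (endpt A h) = x}"
    "card (halfs_at \<Gamma> x) = card {h \<in> free_halfs A S. \<sigma> (endpt A h) = x}"
proof -
  note C = contractionD[OF assms]
  have im: "\<psi> ` free_halfs A S = halfs \<Gamma>" and inj: "inj_on \<psi> (free_halfs A S)"
    using C(4) by (auto simp: bij_betw_def)
  have "{k \<in> \<psi> ` free_halfs A S. endpt \<Gamma> k = x} = \<psi> ` {h \<in> free_halfs A S. \<sigma> (endpt A h) = x}"
    using C(6) by force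
  then show *: "halfs_at \<Gamma> x = \<psi> ` {h \<in> free_halfs A S. \<sigma> (endpt A h) = x}" unfolding im halfs_at_def .
  show "card (halfs_at \<Gamma> x) = card {h \<in> free_halfs A S. \<sigma> (endpt A h) = x}"
    unfolding * by (rule card_image) (rule inj_on_subset[OF inj], auto)
qed

text \<open>Contracting a loop identifies no vertices, so its vertex keeps its degree and loses two
  half-edges. Its weight must therefore have gone up by one, and adding a loop undoes this.\<close>

lemma one_edge_contraction_loop:
  assumes g: "leg_graph n A" and c: "contraction (A, u) (\<Gamma>, w) {{a0, b0}} \<sigma> \<psi>"
    and a0: "a0 \<in> halfs A" "b0 = bar A a0" "a0 \<noteq> b0" and l: "endpt A a0 = endpt A b0"
    and f: "fresh \<Gamma> v' a b"
  shows "admissible (\<Gamma>, w) (Loop (\<sigma> (endpt A a0)))"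
    "\<exists>\<tau> \<rho>. contraction (A, u) (expand (\<Gamma>, w) (Loop (\<sigma> (endpt A a0))) v' a b) {} \<tau> \<rho>"
proof -
  note C = contractionD[OF c] and D = leg_graphD[OF g]
  let ?F = "free_halfs A {{a0, b0}}" and ?p = "endpt A a0"
  have fr: "a \<notin> halfs \<Gamma>" "b \<notin> halfs \<Gamma>" "a \<noteq> b" using f by (auto simp: fresh_def)
  have b0: "b0 \<in> halfs A" "bar A b0 = a0" using D(4,5) a0 by auto
  have e: "{h, bar A h} = {a0, b0} \<longleftrightarrow> h = a0 \<or> h = b0" for h
    using a0 b0 by (auto simp: doubleton_eq_iff)
  have H: "h \<in> halfs A \<longleftrightarrow> h = a0 \<or> h = b0 \<or> h \<in> ?F" "a0 \<notin> ?F" "b0 \<notin> ?F" for h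
    using a0 b0 e by (auto simp: free_halfs_def)
  have loop: "adjacent_via A {{a0, b0}} \<subseteq> Id" using e l a0(2) b0(2) by (auto simp: adjacent_via_def)
  have "x = y" if "(x, y) \<in> (adjacent_via A {{a0, b0}})\<^sup>*" for x y
    using that by (induction rule: rtrancl_induct) (use loop in auto)
  then have inj: "inj_on \<sigma> (verts A)" using C(3) by (intro inj_onI) blast
  have p: "?p \<in> verts A" using D(6) a0 by blast
  have k: "can_deg (\<Gamma>, w) (\<sigma> x) = can_deg (A, u) x" if x: "x \<in> verts A" for x
  proof -
    have "{v. v \<in> verts A \<and> \<sigma> v = \<sigma> x} = {x}" using inj x by (auto dest: inj_onD)
    moreover have "\<sigma> x \<in> verts \<Gamma>" using x unfolding C(2)[symmetric] by (rule imageI)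
    ultimately show ?thesis using C(8) by simp
  qed
  have "halfs_at A ?p = insert a0 (insert b0 {h \<in> ?F. endpt A h = ?p})"
    using H l by (auto simp: halfs_at_def)
  moreover have "finite ?F" using D(3) by (simp add: free_halfs_def)
  ultimately have "card (halfs_at A ?p) = card {h \<in> ?F. endpt A h = ?p} + 2"
    using H(2,3) a0(3) by simp
  moreover have "{h \<in> ?F. \<sigma> (endpt A h) = \<sigma> ?p} = {h \<in> ?F. endpt A h = ?p}"
    using inj D(6) p H(1) by (auto dest: inj_onD)
  ultimately have "card (halfs_at A ?p) = card (halfs_at \<Gamma> (\<sigma> ?p)) + 2"
    using halfs_at_contraction(2)[OF c] by simp
  then have w: "w (\<sigma> ?p) \<ge> 1" using k[OF p] by (simp add: can_deg_eq)
  have v: "\<sigma> ?p \<in> verts \<Gamma>" using p unfolding C(2)[symmetric] by (rule imageI)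
  then show ad: "admissible (\<Gamma>, w) (Loop (\<sigma> ?p))" using w by simp
  let ?E = "add_edge \<Gamma> a b (verts \<Gamma>) ((endpt \<Gamma>)(a := \<sigma> ?p, b := \<sigma> ?p))"
  let ?\<rho> = "\<psi>(a0 := a, b0 := b)"
  have iso: "graph_isomorphism A ?E \<sigma> ?\<rho>"
  proof (rule isomorphism_add_edge[OF g c a0 fr])
    show "bij_betw \<sigma> (verts A) (verts \<Gamma>)" using inj C(2) by (simp add: bij_betw_def)
    fix h assume h: "h \<in> ?F"
    then have "\<psi> h \<noteq> a" "\<psi> h \<noteq> b" using bij_betw_apply[OF C(4) h] fr by auto
    then show "((endpt \<Gamma>)(a := \<sigma> ?p, b := \<sigma> ?p)) (\<psi> h) = \<sigma> (endpt A h)" using C(6)[OF h] by simp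
  qed (use l in auto)
  have "(w(\<sigma> ?p := w (\<sigma> ?p) - 1)) (\<sigma> x) = u x" if x: "x \<in> verts A" for x
  proof -
    have "can_deg (?E, w(\<sigma> ?p := w (\<sigma> ?p) - 1)) (\<sigma> x) = can_deg (\<Gamma>, w) (\<sigma> x)"
      using can_deg_add_loop[OF contraction_leg_graph[OF c g] f, of w "\<sigma> ?p"] w by (simp add: add_loop_def)
    then show ?thesis using k[OF x] valence_isomorphism[OF iso g x] by (simp add: can_deg_def)
  qed
  then have "contraction (A, u) (?E, w(\<sigma> ?p := w (\<sigma> ?p) - 1)) {} \<sigma> ?\<rho>"
    using iso contraction_empty_iff[OF g] by blast
  then show "\<exists>\<tau> \<rho>. contraction (A, u) (expand (\<Gamma>, w) (Loop (\<sigma> ?p)) v' a b) {} \<tau> \<rho>"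
    unfolding expand.simps add_loop_def case_prod_conv by blast
qed

text \<open>The end of \<open>b0\<close> becomes the new vertex and takes along its other half-edges
  and its weight. Comparing degrees and valences shows that the weights of the two ends add up to
  that of the contracted vertex, and stability of \<open>A\<close> at the two ends is admissibility
  of the splitting.\<close>

lemma one_edge_contraction_split:
  fixes \<Gamma> :: "('v, 'h) graph"
  assumes g: "leg_graph n A" and c: "contraction (A, u) (\<Gamma>, w) {{a0, b0}} \<sigma> \<psi>"
    and a0: "a0 \<in> halfs A" "b0 = bar A a0" "a0 \<noteq> b0" and l: "endpt A a0 \<noteq> endpt A b0"
    and f: "fresh \<Gamma> v' a b" and st: "\<And>x. x \<in> verts A \<Longrightarrow> can_deg (A, u) x \<ge> 1"
    and \<epsilon>: "\<epsilon> = Split (\<sigma> (endpt A a0)) (\<psi> ` {h \<in> free_halfs A {{a0, b0}}. endpt A h = endpt A b0}) (u (endpt A b0))"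
  shows "admissible (\<Gamma>, w) \<epsilon>" "\<exists>\<tau> \<rho>. contraction (A, u) (expand (\<Gamma>, w) \<epsilon> v' a b) {} \<tau> \<rho>"
proof -
  note C = contractionD[OF c] and D = leg_graphD[OF g]
  let ?F = "free_halfs A {{a0, b0}}" and ?p = "endpt A a0" and ?r = "endpt A b0"
  let ?I = "\<psi> ` {h \<in> ?F. endpt A h = ?r}" and ?j = "u ?r" and ?v = "\<sigma> ?p"
  have g': "leg_graph n \<Gamma>" by (rule contraction_leg_graph[OF c g])
  have fr: "a \<notin> halfs \<Gamma>" "b \<notin> halfs \<Gamma>" "a \<noteq> b" "v' \<notin> verts \<Gamma>" using f by (auto simp: fresh_def)
  have b0: "b0 \<in> halfs A" "bar A b0 = a0" using D(4,5) a0 by auto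
  have e: "{h, bar A h} = {a0, b0} \<longleftrightarrow> h = a0 \<or> h = b0" for h
    using a0 b0 by (auto simp: doubleton_eq_iff)
  have H: "h \<in> halfs A \<longleftrightarrow> h = a0 \<or> h = b0 \<or> h \<in> ?F" "a0 \<notin> ?F" "b0 \<notin> ?F" for h
    using a0 b0 e by (auto simp: free_halfs_def)
  have pr: "?p \<in> verts A" "?r \<in> verts A" using D(6) a0 b0 by auto
  have adj: "adjacent_via A {{a0, b0}} = {(?p, ?r), (?r, ?p)}"
    using e a0 b0 by (auto simp: adjacent_via_def)
  have \<sigma>: "\<sigma> x = \<sigma> y \<longleftrightarrow> x = y \<or> (x = ?p \<and> y = ?r) \<or> (x = ?r \<and> y = ?p)" if "x \<in> verts A" "y \<in> verts A" for x y
    using C(3)[OF that] unfolding adj rtrancl_symmetric_pair by auto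
  have v: "?v \<in> verts \<Gamma>" "\<sigma> ?r = ?v" using pr \<sigma>[OF pr(1,2)] unfolding C(2)[symmetric] by auto
  have finF: "finite ?F" using D(3) by (simp add: free_halfs_def)
  have inj\<psi>: "inj_on \<psi> ?F" using C(4) by (simp add: bij_betw_def)
  have Fv: "{h \<in> ?F. \<sigma> (endpt A h) = ?v} = {h \<in> ?F. endpt A h = ?p} \<union> {h \<in> ?F. endpt A h = ?r}"
    using \<sigma> pr D(6) H(1) by auto
  have I: "?I \<subseteq> halfs_at \<Gamma> ?v" unfolding halfs_at_contraction(1)[OF c] using v(2) by auto
  have cI: "card ?I = card {h \<in> ?F. endpt A h = ?r}"
    by (rule card_image) (rule inj_on_subset[OF inj\<psi>], auto)
  have cv: "card (halfs_at \<Gamma> ?v) = card {h \<in> ?F. endpt A h = ?p} + card {h \<in> ?F. endpt A h = ?r}"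
    unfolding halfs_at_contraction(2)[OF c] Fv by (rule card_Un_disjoint) (use finF l in auto)
  have "halfs_at A ?r = insert b0 {h \<in> ?F. endpt A h = ?r}" using H l by (auto simp: halfs_at_def)
  then have cr: "card (halfs_at A ?r) = card {h \<in> ?F. endpt A h = ?r} + 1" using finF H(3) by simp
  have "halfs_at A ?p = insert a0 {h \<in> ?F. endpt A h = ?p}" using H l by (auto simp: halfs_at_def)
  then have cp: "card (halfs_at A ?p) = card {h \<in> ?F. endpt A h = ?p} + 1" using finF H(2) by simp
  have "{x. x \<in> verts A \<and> \<sigma> x = ?v} = {?p, ?r}" using pr v(2) \<sigma> by auto
  then have kv: "can_deg (\<Gamma>, w) ?v = can_deg (A, u) ?p + can_deg (A, u) ?r" using C(8)[OF v(1)] l by simp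
  then have wv: "w ?v = u ?p + u ?r" using cv cr cp by (simp add: can_deg_eq)
  have cd: "card (halfs_at \<Gamma> ?v - ?I) = card {h \<in> ?F. endpt A h = ?p}"
    using I cI cv by (subst card_Diff_subset) (auto intro: finite_subset[OF I finite_halfs_at[OF g']])
  show "admissible (\<Gamma>, w) \<epsilon>"
    using v I wv st[OF pr(1)] st[OF pr(2)] cr cp cI cd by (simp add: \<epsilon> can_deg_eq)
  let ?V = "insert v' (verts \<Gamma>)" and ?q = "(\<lambda>h. if h \<in> ?I then v' else endpt \<Gamma> h)(a := ?v, b := v')"
  let ?E = "add_edge \<Gamma> a b ?V ?q" and ?w = "w(?v := w ?v - ?j, v' := ?j)"
  let ?\<rho> = "\<psi>(a0 := a, b0 := b)" and ?\<tau> = "\<sigma>(?r := v')"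
  have \<sigma>v: "\<sigma> x \<in> verts \<Gamma>" if "x \<in> verts A" for x using that unfolding C(2)[symmetric] by (rule imageI)
  have "inj_on ?\<tau> (verts A)"
    using \<sigma> \<sigma>v fr(4) by (auto simp: inj_on_def)
  moreover have "?\<tau> ` verts A = ?V"
  proof (intro equalityI subsetI)
    fix y assume "y \<in> ?V"
    then consider "y = v'" | "y \<in> \<sigma> ` verts A" using C(2) by auto
    then show "y \<in> ?\<tau> ` verts A"
    proof cases
      case 1
      then show ?thesis using pr(2) by (intro image_eqI[of _ _ ?r]) auto
    next
      case 2
      then obtain x where x: "x \<in> verts A" "y = \<sigma> x" by blast
      show ?thesis
      proof (cases "x = ?r")
        case True
        then show ?thesis using x pr l v(2) by (intro image_eqI[of _ _ ?p]) auto
      qed (use x in \<open>auto intro!: image_eqI[of _ _ x]\<close>)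
    qed
  qed (use \<sigma>v in auto)
  ultimately have \<tau>: "bij_betw ?\<tau> (verts A) ?V" by (simp add: bij_betw_def)
  have iso: "graph_isomorphism A ?E ?\<tau> ?\<rho>"
  proof (rule isomorphism_add_edge[OF g c a0 fr(1-3) \<tau>])
    fix h assume h: "h \<in> ?F"
    then have n: "\<psi> h \<noteq> a" "\<psi> h \<noteq> b" using bij_betw_apply[OF C(4) h] fr by auto
    have "\<psi> h \<in> ?I \<longleftrightarrow> endpt A h = ?r" using inj\<psi> h by (auto dest: inj_onD)
    then show "?q (\<psi> h) = ?\<tau> (endpt A h)" using C(6)[OF h] n by simp
  qed (use l fr in auto)
  have "?w (?\<tau> x) = u x" if x: "x \<in> verts A" for x
  proof -
    consider "x = ?r" | "x = ?p" | "x \<noteq> ?r" "x \<noteq> ?p" by blast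
    then show ?thesis
    proof cases
      case 2
      have "\<sigma> ?p \<noteq> v'" using \<sigma>v[OF pr(1)] fr by auto
      then show ?thesis using 2 l wv by simp
    next
      case 3
      then have n: "\<sigma> x \<noteq> ?v" "\<sigma> x \<noteq> v'" using \<sigma>[OF x pr(1)] \<sigma>v[OF x] fr by auto
      have "{y. y \<in> verts A \<and> \<sigma> y = \<sigma> x} = {x}" using 3 x \<sigma> by auto
      then have "can_deg (\<Gamma>, w) (\<sigma> x) = can_deg (A, u) x" using C(8)[OF \<sigma>v[OF x]] by simp
      moreover have "can_deg (?E, ?w) (\<sigma> x) = can_deg (\<Gamma>, w) (\<sigma> x)"
        using can_deg_split_vertex[where w = w and j = ?j and x = "\<sigma> x", OF g' f v(1) I] wv n \<sigma>v[OF x]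
        by (simp add: split_vertex_def)
      ultimately show ?thesis using valence_isomorphism[OF iso g x] 3 n by (simp add: can_deg_def)
    qed simp
  qed
  then have "contraction (A, u) (?E, ?w) {} ?\<tau> ?\<rho>" using iso contraction_empty_iff[OF g] by blast
  then show "\<exists>\<tau> \<rho>. contraction (A, u) (expand (\<Gamma>, w) \<epsilon> v' a b) {} \<tau> \<rho>"
    unfolding \<epsilon> expand.simps split_vertex_def case_prod_conv by blast
qed

lemma one_edge_contraction:
  assumes s: "stable_graph g n (A, u)" and c: "contraction (A, u) (\<Gamma>, w) {e} \<sigma> \<psi>" and f: "fresh \<Gamma> v' a b"
  shows "\<exists>\<epsilon>. admissible (\<Gamma>, w) \<epsilon> \<and> contracts_to (A, u) (expand (\<Gamma>, w) \<epsilon> v' a b)"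
proof -
  note g = stable_graphD(2)[OF s]
  have "e \<in> edges A" using contractionD(1)[OF c] by simp
  then obtain a0 where a0: "a0 \<in> halfs A" "bar A a0 \<noteq> a0" "e = {a0, bar A a0}" by (rule edgesE)
  note c' = c[unfolded a0(3)]
  show ?thesis
  proof (cases "endpt A a0 = endpt A (bar A a0)")
    case True
    note l = one_edge_contraction_loop[OF g c' a0(1) refl a0(2)[symmetric] True f]
    from l(2) obtain \<tau> \<rho>
      where "contraction (A, u) (expand (\<Gamma>, w) (Loop (\<sigma> (endpt A a0))) v' a b) {} \<tau> \<rho>" by (elim exE)
    then show ?thesis using l(1) unfolding contracts_to_def by (intro exI conjI)
  next
    case False
    note l = one_edge_contraction_split[OF g c' a0(1) refl a0(2)[symmetric] False f stable_graphD(3)[OF s] refl]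
    from l(2) show ?thesis using l(1) unfolding contracts_to_def by blast
  qed
qed

text \<open>Contract all edges of \<open>S\<close> but one; what remains is the contraction of a
  single edge, that is, an expansion read backwards.\<close>

lemma contraction_factor_expansion:
  assumes s: "stable_graph g n (A, u)" and c: "contraction (A, u) (\<Gamma>, w) S \<sigma> \<psi>" and S: "S \<noteq> {}"
    and f: "fresh \<Gamma> v' a b"
  shows "\<exists>\<epsilon>. admissible (\<Gamma>, w) \<epsilon> \<and> contracts_to (A, u) (expand (\<Gamma>, w) \<epsilon> v' a b)"
proof -
  note g = stable_graphD(2)[OF s]
  obtain e where e: "e \<in> S" using S by blast
  have sub: "S - {e} \<subseteq> edges A" using contractionD(1)[OF c] by (rule subset_trans[OF Diff_subset])
  note cX = contraction_contract[OF g sub, of u]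
  have "(`) id ` (S - (S - {e})) = {e}" using e by auto
  note cf = contraction_factor[OF cX c Diff_subset g, unfolded this]
  obtain \<epsilon> where \<epsilon>: "admissible (\<Gamma>, w) \<epsilon>"
    "contracts_to (contract A (S - {e}), contract_weight A u (S - {e})) (expand (\<Gamma>, w) \<epsilon> v' a b)"
    using one_edge_contraction[OF stable_graph_contraction[OF cX s] cf f] by (elim exE conjE)
  have X: "contracts_to (A, u) (contract A (S - {e}), contract_weight A u (S - {e}))"
    unfolding contracts_to_def using cX by (intro exI)
  obtain \<Delta> w' where d: "expand (\<Gamma>, w) \<epsilon> v' a b = (\<Delta>, w')" by (cases "expand (\<Gamma>, w) \<epsilon> v' a b")
  have "contracts_to (A, u) (expand (\<Gamma>, w) \<epsilon> v' a b)"
    using contracts_to_trans[OF X \<epsilon>(2)[unfolded d] g] unfolding d .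
  then show ?thesis using \<epsilon>(1) by (intro exI conjI)
qed

section \<open>Connectedness under flips\<close>

lemma free_halfs_expand:
  assumes g: "leg_graph n \<Gamma>" and f: "fresh \<Gamma> v' a b"
  shows "free_halfs (fst (expand (\<Gamma>, w) \<epsilon> v' a b)) {{a, b}} = halfs \<Gamma>"
proof -
  have fr: "a \<notin> halfs \<Gamma>" "b \<notin> halfs \<Gamma>" "a \<noteq> b" using f by (auto simp: fresh_def)
  have "free_halfs (add_edge \<Gamma> a b V p) {{a, b}} = halfs \<Gamma>" for V and p :: "'b \<Rightarrow> 'a"
    using fr leg_graphD(4)[OF g] by (auto simp: free_halfs_def doubleton_eq_iff)
  then show ?thesis by (cases \<epsilon>) (simp_all add: add_loop_def split_vertex_def)
qed

section \<open>Renaming the new edge and exchanging its ends\<close>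

text \<open>The graph with names \<open>u', c, d\<close> contracts to \<open>\<Gamma>\<close> along
  one edge. Reading off its expansion data and expanding with the names \<open>v', a, b\<close>
  gives back \<open>\<epsilon>\<close>, so no renaming map has to be written down.\<close>

lemma expand_rename:
  assumes s: "stable_graph g n (\<Gamma>, w)" and f: "fresh \<Gamma> v' a b" and f': "fresh \<Gamma> u' c d"
    and a: "admissible (\<Gamma>, w) \<epsilon>"
  shows "contracts_to (expand (\<Gamma>, w) \<epsilon> u' c d) (expand (\<Gamma>, w) \<epsilon> v' a b)"
proof -
  note g = stable_graphD(2)[OF s]
  obtain A u where e: "expand (\<Gamma>, w) \<epsilon> u' c d = (A, u)" by (cases "expand (\<Gamma>, w) \<epsilon> u' c d")
  have c: "contraction (A, u) (\<Gamma>, w) {{c, d}} (\<lambda>x. if x = u' then centre \<epsilon> else x) id"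
    using contraction_expand(2)[OF g f' a] unfolding e .
  have gA: "leg_graph n A" using contraction_expand(1)[OF g f' a] by (simp add: e)
  have sA: "stable_graph g n (A, u)" using stable_graph_expand(1)[OF s f' a] by (simp add: e)
  have F: "free_halfs A {{c, d}} = halfs \<Gamma>" using free_halfs_expand[OF g f', of w \<epsilon>] by (simp add: e)
  show ?thesis
  proof (cases \<epsilon>)
    case (Loop v)
    have v: "v \<in> verts \<Gamma>" "v \<noteq> u'" using a f' by (auto simp: Loop fresh_def)
    have A: "c \<in> halfs A" "d = bar A c" "c \<noteq> d" "endpt A c = v" "endpt A d = v"
      using e f' by (auto simp: Loop add_loop_def fresh_def)
    have "\<exists>\<tau> \<rho>. contraction (A, u) (expand (\<Gamma>, w) (Loop (if endpt A c = u' then centre \<epsilon> else endpt A c)) v' a b) {} \<tau> \<rho>"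
      by (rule one_edge_contraction_loop(2)[OF gA c A(1-3) _ f]) (use A in simp)
    then show ?thesis unfolding e using A(4) v(2) by (auto simp: Loop contracts_to_def)
  next
    case (Split v I j)
    have v: "v \<in> verts \<Gamma>" "v \<noteq> u'" "I \<subseteq> halfs_at \<Gamma> v" using a f' by (auto simp: Split fresh_def)
    have A: "c \<in> halfs A" "d = bar A c" "c \<noteq> d" "endpt A c = v" "endpt A d = u'" "u u' = j"
      using e f' v by (auto simp: Split split_vertex_def fresh_def)
    have I: "{h \<in> free_halfs A {{c, d}}. endpt A h = endpt A d} = I"
      unfolding F A(5) using e f' v(3) leg_graphD(6)[OF g] by (auto simp: Split split_vertex_def fresh_def halfs_at_def split: if_splits)
    have "\<exists>\<tau> \<rho>. contraction (A, u) (expand (\<Gamma>, w) (Split (if endpt A c = u' then centre \<epsilon> else endpt A c)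
        (id ` {h \<in> free_halfs A {{c, d}}. endpt A h = endpt A d}) (u (endpt A d))) v' a b) {} \<tau> \<rho>"
      by (rule one_edge_contraction_split(2)[OF gA c A(1-3) _ f stable_graphD(3)[OF sA] refl]) (use A v in simp)
    then show ?thesis unfolding e I using A(4-6) v(2) by (auto simp: Split contracts_to_def)
  qed
qed

lemma admissible_complement:
  assumes "admissible (\<Gamma>, w) (Split v I j)"
  shows "admissible (\<Gamma>, w) (Split v (halfs_at \<Gamma> v - I) (w v - j))"
proof -
  have "halfs_at \<Gamma> v - (halfs_at \<Gamma> v - I) = I" using assms by auto
  then show ?thesis using assms by simp
qed

text \<open>The new edge is read in the opposite direction: the old vertex then plays the part of
  the new one and is described by the complementary half-edges and weight.\<close>

lemma split_complement:
  assumes s: "stable_graph g n (\<Gamma>, w)" and f: "fresh \<Gamma> v' a b" and a: "admissible (\<Gamma>, w) (Split v I j)"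
  shows "contracts_to (expand (\<Gamma>, w) (Split v I j) v' a b)
    (expand (\<Gamma>, w) (Split v (halfs_at \<Gamma> v - I) (w v - j)) v' a b)"
proof -
  note g = stable_graphD(2)[OF s]
  obtain A u where e: "expand (\<Gamma>, w) (Split v I j) v' a b = (A, u)"
    by (cases "expand (\<Gamma>, w) (Split v I j) v' a b")
  \<comment> \<open>Writing the edge from \<open>b\<close> makes the end of \<open>a\<close> the
    vertex that is split off.\<close>
  have c: "contraction (A, u) (\<Gamma>, w) {{b, a}} (\<lambda>x. if x = v' then v else x) id"
    using contraction_expand(2)[OF g f a] unfolding e centre.simps by (simp only: insert_commute)
  have gA: "leg_graph n A" using contraction_expand(1)[OF g f a] unfolding e fst_conv .
  have sA: "stable_graph g n (A, u)" using stable_graph_expand(1)[OF s f a] unfolding e .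
  have F: "free_halfs A {{b, a}} = halfs \<Gamma>" using free_halfs_expand[OF g f, of w "Split v I j"] unfolding e fst_conv by (simp only: insert_commute)
  have v: "v \<in> verts \<Gamma>" "v \<noteq> v'" "I \<subseteq> halfs_at \<Gamma> v" using a f by (auto simp: fresh_def)
  have A: "b \<in> halfs A" "a = bar A b" "b \<noteq> a" "endpt A a = v" "endpt A b = v'" "u v = w v - j"
    using e f v by (auto simp: split_vertex_def fresh_def)
  have I: "{h \<in> free_halfs A {{b, a}}. endpt A h = endpt A a} = halfs_at \<Gamma> v - I"
    unfolding F A(4) using e f v leg_graphD(6)[OF g]
    by (auto simp: split_vertex_def fresh_def halfs_at_def split: if_splits)
  have "\<exists>\<tau> \<rho>. contraction (A, u) (expand (\<Gamma>, w) (Split (if endpt A b = v' then v else endpt A b)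
      (id ` {h \<in> free_halfs A {{b, a}}. endpt A h = endpt A a}) (u (endpt A a))) v' a b) {} \<tau> \<rho>"
    by (rule one_edge_contraction_split(2)[OF gA c A(1-3) _ f stable_graphD(3)[OF sA] refl]) (use A v in simp)
  then show ?thesis unfolding e I using A(4-6) v(2) by (auto simp: contracts_to_def)
qed

text \<open>Compatible expansions commute on the nose, up to choosing the names of the new half-edges; hence
  they have a common expansion.\<close>

fun compatible :: "('v, 'h) wgraph \<Rightarrow> ('v, 'h) expansion \<Rightarrow> ('v, 'h) expansion \<Rightarrow> bool" where
  "compatible (\<Gamma>, w) (Loop u) (Loop v) \<longleftrightarrow> u \<noteq> v"
| "compatible (\<Gamma>, w) (Loop u) (Split v I j) \<longleftrightarrow> (u = v \<longrightarrow> w v - j \<ge> 1)"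
| "compatible (\<Gamma>, w) (Split v I j) (Loop u) \<longleftrightarrow> (u = v \<longrightarrow> w v - j \<ge> 1)"
| "compatible (\<Gamma>, w) (Split u I j) (Split v J k) \<longleftrightarrow>
     (u = v \<longrightarrow> I \<inter> J = {} \<and> j + k \<le> w v \<and> 2 * (w v - (j + k)) + card (halfs_at \<Gamma> v - (I \<union> J)) \<ge> 1)"

lemma compatible_sym: "compatible (\<Gamma>, w) \<epsilon> \<delta> \<Longrightarrow> compatible (\<Gamma>, w) \<delta> \<epsilon>"
  by (cases \<epsilon>; cases \<delta>) (auto simp: Int_commute Un_commute add.commute)

lemma compatible_if_centre_neq: "centre \<epsilon> \<noteq> centre \<delta> \<Longrightarrow> compatible (\<Gamma>, w) \<epsilon> \<delta>"
  by (cases \<epsilon>; cases \<delta>) auto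

text \<open>The bounds in \<open>compatible\<close> originate here. After a splitting the half-edge
  \<open>a\<close> stays at \<open>v\<close> and supplies one of the two units required of the
  remaining part, so 1 is asked of the rest. After a loop its two half-edges stay at
  \<open>v\<close> and suffice alone, but one unit of weight is consumed, which must not be part of
  \<open>j\<close>.\<close>

lemma admissible_expand:
  assumes g: "leg_graph n \<Gamma>" and f: "fresh \<Gamma> v' a b"
    and \<epsilon>: "admissible (\<Gamma>, w) \<epsilon>" and \<delta>: "admissible (\<Gamma>, w) \<delta>" and c: "compatible (\<Gamma>, w) \<epsilon> \<delta>"
  shows "admissible (expand (\<Gamma>, w) \<epsilon> v' a b) \<delta>"
proof (cases \<epsilon>)
  case (Loop u)
  obtain \<Delta> w' where e: "add_loop (\<Gamma>, w) u a b = (\<Delta>, w')" by (cases "add_loop (\<Gamma>, w) u a b")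
  have V: "verts \<Delta> = verts \<Gamma>" and w': "w' = w(u := w u - 1)" using e by (auto simp: add_loop_def)
  have H: "halfs_at \<Delta> x = (if x = u then insert a (insert b (halfs_at \<Gamma> x)) else halfs_at \<Gamma> x)" for x
    using halfs_at_add_loop[OF f, of w u x] by (simp add: e)
  show ?thesis
  proof (cases \<delta>)
    case \<delta>': (Loop v)
    then show ?thesis using \<delta> c V w' by (simp add: Loop e)
  next
    case (Split v I j)
    have "2 \<le> card (insert a (insert b (halfs_at \<Gamma> v)) - I)" if "I \<subseteq> halfs_at \<Gamma> v"
    proof -
      have "{a, b} \<subseteq> insert a (insert b (halfs_at \<Gamma> v)) - I" using that f by (auto simp: fresh_def halfs_at_def)
      then have "card {a, b} \<le> card (insert a (insert b (halfs_at \<Gamma> v)) - I)"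
        using finite_halfs_at[OF g] by (intro card_mono) auto
      then show ?thesis using f by (simp add: fresh_def)
    qed
    then show ?thesis using \<delta> c V w' H[of v] by (auto simp: Loop Split e)
  qed
next
  case (Split u I j)
  then have u: "u \<in> verts \<Gamma>" "I \<subseteq> halfs_at \<Gamma> u" "j \<le> w u" using \<epsilon> by auto
  obtain \<Delta> w' where e: "split_vertex (\<Gamma>, w) u v' a b I j = (\<Delta>, w')" by (cases "split_vertex (\<Gamma>, w) u v' a b I j")
  have V: "verts \<Delta> = insert v' (verts \<Gamma>)" and w': "w' = w(u := w u - j, v' := j)"
    using e by (auto simp: split_vertex_def)
  have n: "x \<noteq> v'" if "x \<in> verts \<Gamma>" for x using that f by (auto simp: fresh_def)
  have H: "halfs_at \<Delta> x = (if x = u then insert a (halfs_at \<Gamma> u - I) else halfs_at \<Gamma> x)" if "x \<in> verts \<Gamma>" for x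
    using halfs_at_split_vertex[OF g f u(1,2), of x w j] that n[OF that] by (simp add: e)
  show ?thesis
  proof (cases \<delta>)
    case (Loop v)
    then show ?thesis using \<delta> c V w' n[of v] by (auto simp: Split e)
  next
    case \<delta>': (Split v J k)
    then have v: "v \<in> verts \<Gamma>" "J \<subseteq> halfs_at \<Gamma> v" using \<delta> by auto
    show ?thesis
    proof (cases "u = v")
      case True
      have "a \<notin> halfs_at \<Gamma> v" using f by (auto simp: fresh_def halfs_at_def)
      then have "insert a (halfs_at \<Gamma> v - I) - J = insert a (halfs_at \<Gamma> v - (I \<union> J))" using v(2) by auto
      then have "card (insert a (halfs_at \<Gamma> v - I) - J) = card (halfs_at \<Gamma> v - (I \<union> J)) + 1"
        using \<open>a \<notin> halfs_at \<Gamma> v\<close> finite_halfs_at[OF g, of v] by simp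
      then show ?thesis using \<delta> c V w' n[OF v(1)] H[OF v(1)] True
        unfolding Split expand.simps e by (auto simp: \<delta>')
    next
      case False
      then show ?thesis using \<delta> V w' n[OF v(1)] H[OF v(1)] unfolding Split expand.simps e by (simp add: \<delta>')
    qed
  qed
qed

text \<open>The records agree, not only up to isomorphism: the half-edges of \<open>I\<close> and of
  \<open>J\<close> are moved once in either order because the sets are disjoint, and the new
  half-edges belong to neither set and stay where they were attached.\<close>

lemma expand_commute:
  assumes g: "leg_graph n \<Gamma>" and f: "fresh \<Gamma> v' a b" and f': "fresh \<Gamma> u' c d"
    and ne: "u' \<noteq> v'" "{a, b} \<inter> {c, d} = {}"
    and \<epsilon>: "admissible (\<Gamma>, w) \<epsilon>" and \<delta>: "admissible (\<Gamma>, w) \<delta>" and co: "compatible (\<Gamma>, w) \<epsilon> \<delta>"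
  shows "expand (expand (\<Gamma>, w) \<epsilon> v' a b) \<delta> u' c d = expand (expand (\<Gamma>, w) \<delta> u' c d) \<epsilon> v' a b"
proof -
  have n: "x \<noteq> v'" "x \<noteq> u'" if "x \<in> verts \<Gamma>" for x using that f f' by (auto simp: fresh_def)
  have nh: "{a, b, c, d} \<inter> halfs_at \<Gamma> v = {}" for v using f f' by (auto simp: fresh_def halfs_at_def)
  have disj: "I \<inter> J = {}" if "I \<subseteq> halfs_at \<Gamma> u" "J \<subseteq> halfs_at \<Gamma> v" "u \<noteq> v" for I J u v
    using that by (auto simp: halfs_at_def)
  have comm: "insert c (insert d (insert a (insert b X))) = insert a (insert b (insert c (insert d X)))" for X
    by auto
  show ?thesis
  proof (cases \<epsilon>)
    case (Loop u)
    show ?thesis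
    proof (cases \<delta>)
      case \<delta>': (Loop v)
      then show ?thesis using ne co by (auto simp: Loop add_loop_def add_edge_def fun_eq_iff)
    next
      case (Split v I j)
      have "a \<notin> I" "b \<notin> I" "u \<noteq> u'" using nh[of v] \<delta> \<epsilon> n by (auto simp: Loop Split)
      then show ?thesis using ne by (auto simp: Loop Split add_loop_def split_vertex_def add_edge_def fun_eq_iff)
    qed
  next
    case (Split u I j)
    have I: "c \<notin> I" "d \<notin> I" "u \<noteq> u'" "u \<noteq> v'" using nh[of u] \<epsilon> n by (auto simp: Split)
    show ?thesis
    proof (cases \<delta>)
      case (Loop v)
      then have "v \<noteq> v'" using \<delta> n by auto
      then show ?thesis using I ne by (auto simp: Loop Split add_loop_def split_vertex_def add_edge_def fun_eq_iff)
    next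
      case \<delta>': (Split v J k)
      have J: "a \<notin> J" "b \<notin> J" "v \<noteq> v'" "v \<noteq> u'" using nh[of v] \<delta> n by (auto simp: \<delta>')
      have IJ: "I \<inter> J = {}"
      proof (cases "u = v")
        case False
        show ?thesis by (rule disj[OF _ _ False]) (use \<epsilon> \<delta> in \<open>auto simp: Split \<delta>'\<close>)
      qed (use co in \<open>simp add: Split \<delta>'\<close>)
      then have "\<And>h. h \<in> I \<Longrightarrow> h \<notin> J" by blast
      then show ?thesis using I J ne
        by (auto simp: Split \<delta>' split_vertex_def add_edge_def fun_eq_iff)
    qed
  qed
qed

lemma common_expansion:
  fixes \<Gamma> :: "('v, 'h) graph"
  assumes s: "stable_graph g n (\<Gamma>, w)" and f: "fresh \<Gamma> v' a b" and f': "fresh \<Gamma> u' c d"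
    and ne: "u' \<noteq> v'" "{a, b} \<inter> {c, d} = {}"
    and \<epsilon>: "admissible (\<Gamma>, w) \<epsilon>" and \<delta>: "admissible (\<Gamma>, w) \<delta>" and co: "compatible (\<Gamma>, w) \<epsilon> \<delta>"
  shows "\<exists>(\<Delta> :: ('v, 'h) graph) w'. stable_graph g n (\<Delta>, w') \<and> contracts_to (\<Delta>, w') (expand (\<Gamma>, w) \<epsilon> v' a b) \<and>
    contracts_to (\<Delta>, w') (expand (\<Gamma>, w) \<delta> u' c d)"
proof -
  note g = stable_graphD(2)[OF s]
  obtain A x where A: "expand (\<Gamma>, w) \<epsilon> v' a b = (A, x)" by (cases "expand (\<Gamma>, w) \<epsilon> v' a b")
  obtain B y where B: "expand (\<Gamma>, w) \<delta> u' c d = (B, y)" by (cases "expand (\<Gamma>, w) \<delta> u' c d")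
  have sA: "stable_graph g n (A, x)" using stable_graph_expand(1)[OF s f \<epsilon>] by (simp add: A)
  have sB: "stable_graph g n (B, y)" using stable_graph_expand(1)[OF s f' \<delta>] by (simp add: B)
  have fA: "fresh A u' c d" using A f' ne by (cases \<epsilon>) (auto simp: fresh_def add_loop_def split_vertex_def)
  have fB: "fresh B v' a b" using B f ne by (cases \<delta>) (auto simp: fresh_def add_loop_def split_vertex_def)
  have aA: "admissible (A, x) \<delta>" using admissible_expand[OF g f \<epsilon> \<delta> co] by (simp add: A)
  have aB: "admissible (B, y) \<epsilon>" using admissible_expand[OF g f' \<delta> \<epsilon> compatible_sym[OF co]] by (simp add: B)
  obtain \<Delta> w' where C: "expand (A, x) \<delta> u' c d = (\<Delta>, w')" by (cases "expand (A, x) \<delta> u' c d")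
  have C': "expand (B, y) \<epsilon> v' a b = (\<Delta>, w')" using expand_commute[OF g f f' ne \<epsilon> \<delta> co] A B C by simp
  have "stable_graph g n (\<Delta>, w')" using stable_graph_expand(1)[OF sA fA aA] by (simp add: C)
  moreover have "contracts_to (\<Delta>, w') (A, x)" using contracts_to_expand[OF stable_graphD(2)[OF sA] fA aA] by (simp add: C)
  moreover have "contracts_to (\<Delta>, w') (B, y)" using contracts_to_expand[OF stable_graphD(2)[OF sB] fB aB] by (simp add: C')
  ultimately show ?thesis unfolding A B by blast
qed

section \<open>Flips between three-regular graphs\<close>

text \<open>Equal numbers of edges are allowed, so isomorphic graphs are related as well; otherwise
  \<open>\<Delta>\<close> is a common face of codimension one.\<close>

definition flip :: "nat \<Rightarrow> nat \<Rightarrow> (nat, nat) graph \<Rightarrow> (nat, nat) graph \<Rightarrow> bool" where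
  "flip g n A B \<longleftrightarrow> trivalent g n A \<and> trivalent g n B \<and>
     (\<exists>(\<Delta> :: (nat, nat) graph) w. card (edges A) \<le> card (edges \<Delta>) + 1 \<and>
        contracts_to (A, \<lambda>_. 0) (\<Delta>, w) \<and> contracts_to (B, \<lambda>_. 0) (\<Delta>, w))"

lemma flip_sym:
  assumes "flip g n A B"
  shows "flip g n B A"
proof -
  have "card (edges A) = card (edges B)"
    using card_edges_trivalent[of g n A] card_edges_trivalent[of g n B] assms by (simp add: flip_def)
  then show ?thesis using assms by (auto simp: flip_def)
qed

lemma flips_sym:
  assumes "(flip g n)\<^sup>*\<^sup>* A B"
  shows "(flip g n)\<^sup>*\<^sup>* B A"
proof -
  have "symp (flip g n)" using flip_sym by (rule sympI)
  then show ?thesis using assms by (rule sympD[OF symp_rtranclp])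
qed

text \<open>
  Expansions at different vertices are compatible, and at a vertex of positive weight each is
  compatible with adding a loop (which goes to a part of positive weight). At a vertex of weight zero
  and valence at least 5, two splittings have sides meeting in at least two half-edges, and both are linked to
  splitting off this intersection. In valence 4 one passes through an expansion at another vertex.
\<close>

lemma flips_of_common_contraction:
  fixes \<Gamma> :: "(nat, nat) graph"
  assumes "stable_graph g n (\<Gamma>, w)" "trivalent g n A" "trivalent g n B"
    "contracts_to (A, \<lambda>_. 0) (\<Gamma>, w)" "contracts_to (B, \<lambda>_. 0) (\<Gamma>, w)"
  shows "(flip g n)\<^sup>*\<^sup>* A B"
  using assms
proof (induction "nat (3 * int g - 3 + int n - int (card (edges \<Gamma>)))" arbitrary: \<Gamma> w A B rule: less_induct)
  case less
  note s = less.prems(1)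
  note sD = stable_graphD[OF s]
  show ?case
  proof (cases "3 * int g - 3 + int n \<le> int (card (edges \<Gamma>)) + 1")
    case True
    then have "card (edges A) \<le> card (edges \<Gamma>) + 1" using card_edges_trivalent[OF less.prems(2)] by simp
    then have "flip g n A B" using less.prems unfolding flip_def by blast
    then show ?thesis by blast
  next
    case False
    have IH: "(flip g n)\<^sup>*\<^sup>* A' B'" if "stable_graph g n D" "card (edges (fst D)) = card (edges \<Gamma>) + 1"
      "trivalent g n A'" "trivalent g n B'" "contracts_to (A', \<lambda>_. 0) D" "contracts_to (B', \<lambda>_. 0) D"
      for A' B' and D :: "(nat, nat) wgraph"
    proof -
      obtain \<Delta> w' where D: "D = (\<Delta>, w')" by (cases D)
      show ?thesis by (rule less.hyps[of \<Delta> w']) (use that False in \<open>auto simp: D\<close>)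
    qed
    obtain v' a b u' c d where f: "fresh \<Gamma> v' a b" and f': "fresh \<Gamma> u' c d"
      and ne: "u' \<noteq> v'" "{a, b} \<inter> {c, d} = {}"
      using exists_fresh[OF sD(2)] by blast
    define X where "X \<epsilon> = expand (\<Gamma>, w) \<epsilon> v' a b" for \<epsilon>
    \<comment> \<open>\<open>Q\<close> compares all 3-regular graphs above two expansions. Graphs
      above the same expansion are linked by induction, so it is enough to join two expansions by a
      chain; transitivity uses that every term of the chain has some 3-regular graph above
      it.\<close>
    define Q where "Q \<epsilon> \<delta> \<longleftrightarrow> (\<forall>A B. trivalent g n A \<longrightarrow> trivalent g n B \<longrightarrow>
      contracts_to (A, \<lambda>_. 0) (X \<epsilon>) \<longrightarrow> contracts_to (B, \<lambda>_. 0) (X \<delta>) \<longrightarrow> (flip g n)\<^sup>*\<^sup>* A B)" for \<epsilon> \<delta>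
    let ?adm = "admissible (\<Gamma>, w)"
    have X: "stable_graph g n (X \<epsilon>)" "card (edges (fst (X \<epsilon>))) = card (edges \<Gamma>) + 1" if "?adm \<epsilon>" for \<epsilon>
      using stable_graph_expand[OF s f that] by (auto simp: X_def)
    have tr: "contracts_to (A, \<lambda>_. 0) D2" if "trivalent g n A" "contracts_to (A, \<lambda>_. 0) D1" "contracts_to D1 D2"
      for A :: "(nat, nat) graph" and D1 D2 :: "(nat, nat) wgraph"
      using contracts_to_trans[OF _ _ trivalent_leg_graph[OF that(1)]] that(2,3) by (cases D1; cases D2) blast
    have ex: "\<exists>A :: (nat, nat) graph. trivalent g n A \<and> contracts_to (A, \<lambda>_. 0) D"
      if "stable_graph g n D" for D :: "(nat, nat) wgraph"
      using exists_trivalent_expansion that by (cases D) blast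
    have Q_refl: "Q \<epsilon> \<epsilon>" if "?adm \<epsilon>" for \<epsilon>
      unfolding Q_def using IH[OF X[OF that]] by blast
    have Q_sym: "Q \<delta> \<epsilon>" if "Q \<epsilon> \<delta>" for \<epsilon> \<delta>
      using that flips_sym unfolding Q_def by blast
    have Q_trans: "Q \<epsilon> \<eta>" if "Q \<epsilon> \<delta>" "Q \<delta> \<eta>" "?adm \<delta>" for \<epsilon> \<delta> \<eta>
      using that(1,2) ex[OF X(1)[OF that(3)]] rtranclp_trans[of "flip g n"] unfolding Q_def by blast
    have Q_compl: "Q (Split v I j) (Split v (halfs_at \<Gamma> v - I) (w v - j))" if "?adm (Split v I j)" for v I j
      unfolding Q_def using tr[OF _ _ split_complement[OF s f that, folded X_def]] IH[OF X[OF admissible_complement[OF that]]]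
      by blast
    \<comment> \<open>A 3-regular graph above a common expansion lies above both
      \<open>X \<epsilon>\<close> and \<open>X \<delta>\<close> and serves as a midpoint.\<close>
    have Q_compat: "Q \<epsilon> \<delta>" if \<epsilon>: "?adm \<epsilon>" and \<delta>: "?adm \<delta>" and co: "compatible (\<Gamma>, w) \<epsilon> \<delta>" for \<epsilon> \<delta>
    proof -
      obtain \<Delta> :: "(nat, nat) graph" and x where C: "stable_graph g n (\<Delta>, x)" "contracts_to (\<Delta>, x) (X \<epsilon>)"
        "contracts_to (\<Delta>, x) (expand (\<Gamma>, w) \<delta> u' c d)"
        using common_expansion[OF s f f' ne \<epsilon> \<delta> co, folded X_def] by blast
      obtain M :: "(nat, nat) graph" where M: "trivalent g n M" "contracts_to (M, \<lambda>_. 0) (\<Delta>, x)" using ex[OF C(1)] by blast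
      have 1: "contracts_to (M, \<lambda>_. 0) (X \<epsilon>)" by (rule tr[OF M C(2)])
      \<comment> \<open>The second expansion was made under its own names, while \<open>X\<close>
        uses fixed ones.\<close>
      have 2: "contracts_to (M, \<lambda>_. 0) (X \<delta>)"
        by (rule tr[OF M(1) tr[OF M C(3)] expand_rename[OF s f f' \<delta>, folded X_def]])
      show ?thesis unfolding Q_def
        using IH[OF X[OF \<epsilon>] _ M(1) _ 1] IH[OF X[OF \<delta>] M(1) _ 2] rtranclp_trans[of "flip g n"] by blast
    qed
    have Q_loop: "Q \<epsilon> (Loop v)" if \<epsilon>: "?adm \<epsilon>" "centre \<epsilon> = v" and v: "w v \<ge> 1" "v \<in> verts \<Gamma>" for \<epsilon> v
    proof -
      have L: "?adm (Loop v)" using v by simp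
      show ?thesis
      proof (cases \<epsilon>)
        case (Loop u)
        then show ?thesis using Q_refl[OF L] \<epsilon>(2) by simp
      next
        case (Split u I j)
        then have S: "?adm (Split v I j)" "\<epsilon> = Split v I j" using \<epsilon> by auto
        show ?thesis
        proof (cases "w v - j \<ge> 1")
          case True
          show ?thesis unfolding S(2) by (rule Q_compat[OF S(1) L]) (use True in simp)
        next
          case False
          moreover have "j \<le> w v" using S(1) by simp
          \<comment> \<open>All the weight sits on the part split off. The complementary description
            of the same splitting leaves it at \<open>v\<close>, where a loop can be added.\<close>
          ultimately have j: "j = w v" by linarith
          note S' = admissible_complement[OF S(1)]
          have "Q (Split v (halfs_at \<Gamma> v - I) (w v - j)) (Loop v)"
            by (rule Q_compat[OF S' L]) (use j v in simp)
          then show ?thesis unfolding S(2) using Q_trans[OF Q_compl[OF S(1)] _ S'] by blast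
        qed
      qed
    qed
    have Q_all: "Q \<epsilon> \<delta>" if \<epsilon>: "?adm \<epsilon>" and \<delta>: "?adm \<delta>" for \<epsilon> \<delta>
    proof (cases "centre \<epsilon> = centre \<delta>")
      case False
      then show ?thesis by (intro Q_compat[OF \<epsilon> \<delta>] compatible_if_centre_neq)
    next
      case True
      define v where "v = centre \<delta>"
      have v: "centre \<epsilon> = v" "centre \<delta> = v" "v \<in> verts \<Gamma>"
        using True v_def \<delta> by (cases \<delta>; auto)+
      let ?H = "halfs_at \<Gamma> v"
      have finH: "finite ?H" by (rule finite_halfs_at[OF sD(2)])
      show ?thesis
      proof (cases "w v \<ge> 1")
        case True
        have "?adm (Loop v)" using True v by simp
        then show ?thesis using Q_trans[OF Q_loop[OF \<epsilon> v(1) True v(3)] Q_sym[OF Q_loop[OF \<delta> v(2) True v(3)]]] by blast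
      next
        case False
        then have w0: "w v = 0" by simp
        obtain I where I: "\<epsilon> = Split v I 0" "I \<subseteq> ?H" "card I \<ge> 2" "card (?H - I) \<ge> 2"
          using \<epsilon> v(1) w0 by (cases \<epsilon>) auto
        obtain J where J: "\<delta> = Split v J 0" "J \<subseteq> ?H" "card J \<ge> 2" "card (?H - J) \<ge> 2"
          using \<delta> v(2) w0 by (cases \<delta>) auto
        show ?thesis
        proof (cases "card ?H \<ge> 5")
          case True
          \<comment> \<open>The complement of \<open>I\<close> is disjoint from \<open>K\<close>,
            and for \<open>K \<noteq> I\<close> some half-edge lies in neither, so the two can be
            split off together.\<close>
          have half: "Q (Split v I 0) (Split v K 0)" if a: "?adm (Split v I 0)" "K \<subseteq> I" "card K \<ge> 2" for I K
          proof -
            have fI: "I \<subseteq> ?H" "finite I" using a(1) finite_subset[OF _ finH] by auto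
            have "card (?H - I) \<le> card (?H - K)" using finH a(2) by (intro card_mono) auto
            then have K: "?adm (Split v K 0)" using a by auto
            show ?thesis
            proof (cases "K = I")
              case True
              then show ?thesis using Q_refl[OF a(1)] by simp
            next
              case False
              note c = admissible_complement[OF a(1)]
              have "?H - ((?H - I) \<union> K) = I - K" using fI by auto
              moreover have "card (I - K) \<ge> 1"
                using False a(2) fI by (auto simp: Suc_le_eq card_gt_0_iff)
              ultimately have "Q (Split v (?H - I) (w v - 0)) (Split v K 0)"
                using a(2) w0 by (intro Q_compat[OF c K]) auto
              then show ?thesis using Q_trans[OF Q_compl[OF a(1)] _ c] by blast
            qed
          qed
          have meet: "Q (Split v I 0) (Split v J 0)"
            if a: "?adm (Split v I 0)" "?adm (Split v J 0)" "card (I \<inter> J) \<ge> 2" for I J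
          proof -
            have fI: "finite I" using a(1) finite_subset[OF _ finH] by auto
            have "card (?H - I) \<le> card (?H - I \<inter> J)" using finH by (intro card_mono) auto
            then have "?adm (Split v (I \<inter> J) 0)" using a by auto
            then show ?thesis
              using Q_trans[OF half[OF a(1) _ a(3)] Q_sym[OF half[OF a(2) _ a(3)]]] by blast
          qed
          have compl: "?adm (Split v (?H - K) 0)" "Q (Split v K 0) (Split v (?H - K) 0)" if "?adm (Split v K 0)" for K
            using admissible_complement[OF that] Q_compl[OF that] w0 by simp_all
          have aI: "?adm (Split v I 0)" and aJ: "?adm (Split v J 0)" using \<epsilon> \<delta> I J by auto
          have fI: "finite I" "finite (?H - I)" using finite_subset[OF I(2) finH] finH by auto
          have "card I = card (I \<inter> J) + card (I \<inter> (?H - J))"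
          proof -
            have "I = (I \<inter> J) \<union> (I \<inter> (?H - J))" using I(2) by auto
            moreover have "card ((I \<inter> J) \<union> (I \<inter> (?H - J))) = card (I \<inter> J) + card (I \<inter> (?H - J))"
              by (rule card_Un_disjoint) (use fI in auto)
            ultimately show ?thesis by simp
          qed
          moreover have "card (?H - I) = card ((?H - I) \<inter> J) + card ((?H - I) \<inter> (?H - J))"
          proof -
            have "?H - I = ((?H - I) \<inter> J) \<union> ((?H - I) \<inter> (?H - J))" by auto
            moreover have "card (((?H - I) \<inter> J) \<union> ((?H - I) \<inter> (?H - J))) = card ((?H - I) \<inter> J) + card ((?H - I) \<inter> (?H - J))"
              by (rule card_Un_disjoint) (use fI in auto)
            ultimately show ?thesis by simp
          qed
          moreover have "card ?H = card I + card (?H - I)"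
            using I(2) finH card_mono[OF finH I(2)] by (simp add: card_Diff_subset finite_subset)
          \<comment> \<open>Four numbers with sum at least 5 cannot all be at most 1; this is where
            valence 5 enters.\<close>
          ultimately consider "card (I \<inter> J) \<ge> 2" | "card (I \<inter> (?H - J)) \<ge> 2" | "card ((?H - I) \<inter> J) \<ge> 2"
            | "card ((?H - I) \<inter> (?H - J)) \<ge> 2"
            using True by linarith
          then have "Q (Split v I 0) (Split v J 0)"
          proof cases
            case 1
            then show ?thesis by (rule meet[OF aI aJ])
          next
            case 2
            show ?thesis
              by (rule Q_trans[OF meet[OF aI compl(1)[OF aJ] 2] Q_sym[OF compl(2)[OF aJ]] compl(1)[OF aJ]])
          next
            case 3
            show ?thesis
              by (rule Q_trans[OF compl(2)[OF aI] meet[OF compl(1)[OF aI] aJ 3] compl(1)[OF aI]])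
          next
            case 4
            have "Q (Split v (?H - I) 0) (Split v J 0)"
              by (rule Q_trans[OF meet[OF compl(1)[OF aI] compl(1)[OF aJ] 4] Q_sym[OF compl(2)[OF aJ]] compl(1)[OF aJ]])
            then show ?thesis by (rule Q_trans[OF compl(2)[OF aI] _ compl(1)[OF aI]])
          qed
          then show ?thesis unfolding I(1) J(1) .
        next
          case H: False
          let ?k = "\<lambda>u. can_deg (\<Gamma>, w) u - 1 + int (w u)"
          \<comment> \<open>The vertex \<open>v\<close> accounts for codimension at most one, while
            the total is at least two outside the base case.\<close>
          have "?k v \<le> 1" using H w0 by (simp add: can_deg_eq)
          moreover have "(\<Sum>u\<in>verts \<Gamma>. ?k u) \<ge> 2"
            using card_edges_codim[OF sD(2), of w, unfolded sD(4)] False \<open>\<not> 3 * int g - 3 + int n \<le> int (card (edges \<Gamma>)) + 1\<close>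
            by simp
          moreover have "(\<Sum>u\<in>verts \<Gamma>. ?k u) = ?k v + (\<Sum>u\<in>verts \<Gamma> - {v}. ?k u)"
            using v(3) leg_graphD(1)[OF sD(2)] by (rule sum.remove[rotated])
          ultimately have "(\<Sum>u\<in>verts \<Gamma> - {v}. ?k u) > 0" by linarith
          then obtain u where u: "u \<in> verts \<Gamma>" "u \<noteq> v" "?k u \<ge> 1"
          proof (atomize_elim, rule_tac ccontr)
            assume "0 < (\<Sum>u\<in>verts \<Gamma> - {v}. ?k u)" and n: "\<not> (\<exists>u. u \<in> verts \<Gamma> \<and> u \<noteq> v \<and> 1 \<le> ?k u)"
            moreover have "(\<Sum>u\<in>verts \<Gamma> - {v}. ?k u) \<le> 0"
              by (rule sum_nonpos) (use n in force)
            ultimately show False by simp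
          qed
          obtain \<eta> where \<eta>: "?adm \<eta>" "centre \<eta> = u" using exists_admissible[OF s u(1,3)] by blast
          have "Q \<epsilon> \<eta>" by (rule Q_compat[OF \<epsilon> \<eta>(1)], rule compatible_if_centre_neq) (use \<eta> u v in auto)
          moreover have "Q \<eta> \<delta>" by (rule Q_compat[OF \<eta>(1) \<delta>], rule compatible_if_centre_neq) (use \<eta> u v in auto)
          ultimately show ?thesis by (rule Q_trans[OF _ _ \<eta>(1)])
        qed
      qed
    qed
    have fac: "\<exists>\<epsilon>. ?adm \<epsilon> \<and> contracts_to (A, \<lambda>_. 0) (X \<epsilon>)"
      if t: "trivalent g n A" and c: "contracts_to (A, \<lambda>_. 0) (\<Gamma>, w)" for A :: "(nat, nat) graph"
    proof -
      obtain S \<sigma> \<psi> where S: "contraction (A, \<lambda>_. 0) (\<Gamma>, w) S \<sigma> \<psi>" using c unfolding contracts_to_def by blast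
      \<comment> \<open>The codimension is positive here, so at least one edge is contracted and can
        be read as an expansion.\<close>
      have "card (edges A) = card (edges \<Gamma>) + card S" by (rule card_edges_contraction[OF S trivalent_leg_graph[OF t]])
      then have "S \<noteq> {}" using card_edges_trivalent[OF t] False by auto
      then show ?thesis
        unfolding X_def by (rule contraction_factor_expansion[OF trivalent_stable_graph[OF t] S _ f])
    qed
    obtain \<epsilon> \<delta> where "?adm \<epsilon>" "contracts_to (A, \<lambda>_. 0) (X \<epsilon>)" "?adm \<delta>" "contracts_to (B, \<lambda>_. 0) (X \<delta>)"
      using fac[OF less.prems(2,4)] fac[OF less.prems(3,5)] by blast
    then show ?thesis using Q_all[of \<epsilon> \<delta>] less.prems(2,3) unfolding Q_def by blast
  qed
qed

definition one_vertex_graph :: "nat \<Rightarrow> (nat, nat) graph" where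
  "one_vertex_graph n = \<lparr>verts = {0}, halfs = {..<n}, bar = id, endpt = (\<lambda>_. 0), leg_list = [0..<n]\<rparr>"

text \<open>All edges are contracted. The degree of the remaining vertex is then the total degree
  \<open>2g - 2 + n\<close>, which is the degree for weight \<open>g\<close> and \<open>n\<close>
  legs.\<close>

lemma contracts_to_one_vertex:
  assumes s: "stable_graph g n (\<Gamma>, w)"
  shows "contracts_to (\<Gamma>, w) (one_vertex_graph n, \<lambda>_. g)"
proof -
  note sD = stable_graphD[OF s]
  note D = leg_graphD[OF sD(2)]
  \<comment> \<open>A leg is sent to its position in the list of legs.\<close>
  let ?\<psi> = "inv_into {..<n} ((!) (leg_list \<Gamma>))"
  have bij: "bij_betw ((!) (leg_list \<Gamma>)) {..<n} (legs \<Gamma>)"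
    using bij_betw_nth[OF D(7), of "{..<n}" "legs \<Gamma>"] D(8,9) by simp
  have free: "free_halfs \<Gamma> (edges \<Gamma>) = legs \<Gamma>"
    using edges_iff[OF sD(2)] by (auto simp: free_halfs_def legs_def)
  have core: "edges (one_vertex_graph n) = {}" by (auto simp: edges_def one_vertex_graph_def)
  have lc: "leg_graph n (one_vertex_graph n)"
    by (auto simp: leg_graph_def one_vertex_graph_def legs_def)
  have "can_deg (one_vertex_graph n, \<lambda>_. g) 0 = 2 * int g - 2 + int n"
    by (simp add: can_deg_def valence_def one_vertex_graph_def)
  then have k: "can_deg (one_vertex_graph n, \<lambda>_. g) 0 = (\<Sum>v\<in>verts \<Gamma>. can_deg (\<Gamma>, w) v)"
    using sum_can_deg[OF sD(2), of w] sD(4) by simp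
  have "map ?\<psi> (leg_list \<Gamma>) = [0..<n]"
  proof (rule nth_equalityI)
    fix i assume "i < length (map ?\<psi> (leg_list \<Gamma>))"
    then have i: "i < n" using D(9) by simp
    have "?\<psi> (leg_list \<Gamma> ! i) = i" using bij i by (intro inv_into_f_f) (auto simp: bij_betw_def)
    then show "map ?\<psi> (leg_list \<Gamma>) ! i = [0..<n] ! i" using i D(9) by simp
  qed (use D(9) in simp)
  moreover have "bij_betw ?\<psi> (legs \<Gamma>) {..<n}" by (rule bij_betw_inv_into[OF bij])
  moreover have "\<forall>u\<in>verts \<Gamma>. \<forall>v\<in>verts \<Gamma>. (u, v) \<in> (adjacent_via \<Gamma> (edges \<Gamma>))\<^sup>*"
    using sD(1) by (simp add: is_graph_iff connected_graph_def)
  moreover have "\<forall>h\<in>legs \<Gamma>. ?\<psi> (bar \<Gamma> h) = ?\<psi> h" by (simp add: legs_def)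
  moreover have "(\<lambda>_. 0 :: nat) ` verts \<Gamma> = {0}" using D(2) by auto
  ultimately have "contraction (\<Gamma>, w) (one_vertex_graph n, \<lambda>_. g) (edges \<Gamma>) (\<lambda>_. 0) ?\<psi>"
    unfolding contraction_def case_prod_conv free using k by (simp add: one_vertex_graph_def)
  then show ?thesis unfolding contracts_to_def by blast
qed

theorem flips_connected:
  assumes "trivalent g n A" "trivalent g n B"
  shows "(flip g n)\<^sup>*\<^sup>* A B"
proof -
  note c = contracts_to_one_vertex[OF trivalent_stable_graph[OF assms(1)]]
    contracts_to_one_vertex[OF trivalent_stable_graph[OF assms(2)]]
  obtain S \<sigma> \<psi> where "contraction (A, \<lambda>_. 0) (one_vertex_graph n, \<lambda>_. g) S \<sigma> \<psi>"
    using c(1) unfolding contracts_to_def by blast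
  \<comment> \<open>The one-vertex graph inherits stability from \<open>A\<close>.\<close>
  note s = stable_graph_contraction[OF this trivalent_stable_graph[OF assms(1)]]
  show ?thesis by (rule flips_of_common_contraction[OF s assms c])
qed

section \<open>Cells\<close>

lemma nonneg_ext_iff [simp]: "None \<in> nonneg_ext" "Some x \<in> nonneg_ext \<longleftrightarrow> 0 \<le> x"
  by (auto simp: nonneg_ext_def)

lemma pos_ext_iff [simp]: "None \<in> pos_ext" "Some x \<in> pos_ext \<longleftrightarrow> 0 < x"
  by (auto simp: pos_ext_def)

lemma topspace_ext_halfline [simp]: "topspace ext_halfline = nonneg_ext"
  by (auto simp: ext_halfline_def image_iff option.nchotomy split_option_ex)

lemma Hausdorff_space_ext_halfline: "Hausdorff_space ext_halfline"
  unfolding ext_halfline_def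
  by (intro Hausdorff_space_subtopology)
    (simp add: Hausdorff_space_Alexandroff_compactification locally_compact_space_euclidean)

lemma compact_space_ext_halfline: "compact_space ext_halfline"
proof -
  let ?A = "Alexandroff_compactification euclideanreal"
  have "openin ?A (Some ` {..<0})" by simp
  moreover have "topspace ?A - Some ` {..<0} = nonneg_ext"
  proof -
    have "x \<in> topspace ?A - Some ` {..<0} \<longleftrightarrow> x \<in> nonneg_ext" for x by (cases x) auto
    then show ?thesis by blast
  qed
  ultimately have "closedin ?A nonneg_ext" by (metis closedin_diff closedin_topspace)
  then have "compactin ?A nonneg_ext"
    by (rule closedin_compact_space[OF compact_space_Alexandroff_compactification])
  then show ?thesis unfolding ext_halfline_def by (rule compact_space_subtopology)
qed

lemma openin_Alexandroff_None:
  assumes "openin (Alexandroff_compactification euclideanreal) T" "None \<in> T"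
  shows "\<exists>B. \<forall>x>B. Some x \<in> T"
proof -
  obtain C :: "real set" where C: "compact C" "T = insert None (Some ` (UNIV - C))"
    using assms by (auto simp: openin_Alexandroff_compactification)
  obtain B where "\<forall>x\<in>C. \<bar>x\<bar> \<le> B" using compact_imp_bounded[OF C(1)] by (auto simp: bounded_iff)
  then have "\<forall>x>B. Some x \<in> T" unfolding C(2) by fastforce
  then show ?thesis ..
qed

text \<open>One point would be enough for the closure of the positive reals. Infinitely many are
  provided because curves with pairwise distinct lengths are found by choosing coordinates that
  avoid each other.\<close>

lemma infinite_positive_in_open:
  assumes O: "openin ext_halfline U" and z: "z \<in> U"
  shows "infinite {x. 0 < x \<and> Some x \<in> U}"
proof -
  obtain T where T: "openin (Alexandroff_compactification euclideanreal) T" "U = T \<inter> nonneg_ext"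
    using O unfolding ext_halfline_def openin_subtopology by blast
  show ?thesis
  proof (cases z)
    case None
    then obtain B where B: "\<forall>x>B. Some x \<in> T" using openin_Alexandroff_None[OF T(1)] z T(2) by blast
    have "{max B 0<..<max B 0 + 1} \<subseteq> {x. 0 < x \<and> Some x \<in> U}"
      using B unfolding T(2) by auto
    moreover have "infinite {max B 0<..<max B 0 + 1}" by (rule infinite_Ioo) simp
    ultimately show ?thesis using infinite_super by blast
  next
    case (Some x)
    then have x: "x \<ge> 0" "Some x \<in> T" using z T(2) by auto
    have "openin euclideanreal {y \<in> topspace euclideanreal. Some y \<in> T}"
      using continuous_map_Some T(1) by (rule openin_continuous_map_preimage)
    then have "open {y. Some y \<in> T}" by simp
    then obtain e where e: "e > 0" "\<forall>y. dist y x < e \<longrightarrow> Some y \<in> T"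
      using x(2) by (auto simp: open_dist)
    have "{x<..<x + e} \<subseteq> {x. 0 < x \<and> Some x \<in> U}"
      using e x(1) unfolding T(2) by (auto simp: dist_real_def)
    moreover have "infinite {x<..<x + e}" using e(1) by (intro infinite_Ioo) simp
    ultimately show ?thesis using infinite_super by blast
  qed
qed

text \<open>Such a set lies between the connected ray of positive reals and its closure. This covers
  the factors \<open>pos_ext\<close> of the strata and \<open>nonneg_ext\<close> of the closed
  cells.\<close>

lemma connectedin_ext_halfline:
  assumes "Some ` {0<..} \<subseteq> T" "T \<subseteq> nonneg_ext"
  shows "connectedin ext_halfline T"
proof (rule connectedin_intermediate_closure_of)
  let ?A = "Alexandroff_compactification euclideanreal"
  have "connectedin ?A (Some ` {0<..})"
    by (rule connectedin_continuous_map_image[OF continuous_map_Some]) (simp add: connected_Ioi)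
  then show "connectedin ext_halfline (Some ` {0<..})"
    by (auto simp: ext_halfline_def connectedin_subtopology)
  show "T \<subseteq> ext_halfline closure_of (Some ` {0<..})"
  proof
    fix t assume t: "t \<in> T"
    show "t \<in> ext_halfline closure_of (Some ` {0<..})"
      unfolding in_closure_of
    proof (intro conjI allI impI)
      show "t \<in> topspace ext_halfline" using t assms(2) by auto
      fix U assume "t \<in> U \<and> openin ext_halfline U"
      then have "infinite {x. 0 < x \<and> Some x \<in> U}" using infinite_positive_in_open by blast
      then obtain x where "x \<in> {x. 0 < x \<and> Some x \<in> U}" by (metis finite.emptyI equals0I)
      then show "\<exists>y. y \<in> Some ` {0<..} \<and> y \<in> U" by auto
    qed
  qed
qed (rule assms(1))

abbreviation cell :: "('v, 'h) graph \<Rightarrow> ('h set \<Rightarrow> real option) set" where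
  "cell \<Gamma> \<equiv> edges \<Gamma> \<rightarrow>\<^sub>E nonneg_ext"

lemma closed_cell_eq: "closed_cell (\<Gamma>, w) = product_topology (\<lambda>_. ext_halfline) (edges \<Gamma>)"
  by (simp add: closed_cell_def)

lemma topspace_closed_cell [simp]: "topspace (closed_cell (\<Gamma>, w)) = cell \<Gamma>"
  by (simp add: closed_cell_eq)

lemma compact_space_closed_cell: "compact_space (closed_cell (\<Gamma>, w))"
  by (simp add: closed_cell_eq compact_space_product_topology compact_space_ext_halfline)

lemma Hausdorff_space_closed_cell: "Hausdorff_space (closed_cell (\<Gamma>, w))"
  by (simp add: closed_cell_eq Hausdorff_space_product_topology Hausdorff_space_ext_halfline)

lemma continuous_map_face_map:
  assumes "\<And>e. e \<in> edges \<Gamma> - S \<Longrightarrow> \<beta> e \<in> edges \<Delta>"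
  shows "continuous_map (closed_cell (\<Delta>, w')) (closed_cell (\<Gamma>, w)) (face_map (edges \<Gamma>) S \<beta>)"
  unfolding closed_cell_eq continuous_map_componentwise
proof (intro conjI ballI)
  show "face_map (edges \<Gamma>) S \<beta> ` topspace (product_topology (\<lambda>_. ext_halfline) (edges \<Delta>)) \<subseteq> extensional (edges \<Gamma>)"
    by (auto simp: face_map_def)
  fix e assume e: "e \<in> edges \<Gamma>"
  show "continuous_map (product_topology (\<lambda>_. ext_halfline) (edges \<Delta>)) ext_halfline
      (\<lambda>u. face_map (edges \<Gamma>) S \<beta> u e)"
  proof (cases "e \<in> S")
    case True
    then show ?thesis using e by (simp add: face_map_def)
  next
    case False
    then show ?thesis
      using e assms continuous_map_product_projection[of "\<beta> e" "edges \<Delta>" "\<lambda>_. ext_halfline"]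
      by (simp add: face_map_def)
  qed
qed

lemma face_map_in_cell:
  assumes "\<And>e. e \<in> edges \<Gamma> - S \<Longrightarrow> \<beta> e \<in> edges \<Delta>" "u \<in> cell \<Delta>"
  shows "face_map (edges \<Gamma>) S \<beta> u \<in> cell \<Gamma>"
proof (rule PiE_I)
  fix e assume "e \<in> edges \<Gamma>"
  then show "face_map (edges \<Gamma>) S \<beta> u e \<in> nonneg_ext"
    using PiE_mem[OF assms(2) assms(1)] by (cases "e \<in> S") (simp_all add: face_map_def)
qed (simp add: face_map_def)

lemma face_map_cong:
  assumes "\<And>e. e \<in> E - S \<Longrightarrow> \<beta> e = \<beta>' e"
  shows "face_map E S \<beta> = face_map E S \<beta>'"
  using assms by (auto simp: face_map_def fun_eq_iff restrict_def)

section \<open>The moduli space as a quotient of the disjoint union of the cells\<close>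

type_synonym cell_point = "(nat, nat) graph \<times> (nat set \<Rightarrow> real option)"

definition cells :: "nat \<Rightarrow> nat \<Rightarrow> cell_point topology" where
  "cells g n = sum_topology (\<lambda>\<Gamma>. closed_cell (\<Gamma>, \<lambda>_. 0)) (three_regular_graphs g n)"

definition curve_of :: "cell_point \<Rightarrow> (nat set, nat) curve" where
  "curve_of = (\<lambda>(\<Gamma>, t). curve_at (\<Gamma>, \<lambda>_. 0) t)"

definition cell_rel :: "(nat, nat) graph \<Rightarrow> ((nat set \<Rightarrow> real option) \<times> (nat set \<Rightarrow> real option)) set" where
  "cell_rel \<Gamma> = {(s, t). s \<in> cell \<Gamma> \<and> t \<in> cell \<Gamma> \<and> curve_iso (curve_of (\<Gamma>, s)) (curve_of (\<Gamma>, t))}"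

definition proj :: "nat \<Rightarrow> nat \<Rightarrow> cell_point \<Rightarrow> moduli_point" where
  "proj g n = (\<lambda>(\<Gamma>, t). moduli_rel g n `` {(\<Gamma>, cell_rel \<Gamma> `` {t})})"

lemma topspace_cells: "(\<Gamma>, t) \<in> topspace (cells g n) \<longleftrightarrow> \<Gamma> \<in> three_regular_graphs g n \<and> t \<in> cell \<Gamma>"
  by (simp add: cells_def)

lemma closedin_cells:
  "closedin (cells g n) U \<longleftrightarrow> U \<subseteq> topspace (cells g n) \<and>
     (\<forall>\<Gamma>\<in>three_regular_graphs g n. closedin (closed_cell (\<Gamma>, \<lambda>_. 0)) {t. (\<Gamma>, t) \<in> U})"
  by (simp add: cells_def closedin_sum_topology)

lemma openin_cells:
  "openin (cells g n) U \<longleftrightarrow> U \<subseteq> topspace (cells g n) \<and>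
     (\<forall>\<Gamma>\<in>three_regular_graphs g n. openin (closed_cell (\<Gamma>, \<lambda>_. 0)) {t. (\<Gamma>, t) \<in> U})"
  by (simp add: cells_def openin_sum_topology)

lemma cell_quotient_eq: "cell_quotient (\<Gamma>, \<lambda>_. 0) = quotient_topology (closed_cell (\<Gamma>, \<lambda>_. 0)) (cell_rel \<Gamma>)"
  by (simp add: cell_quotient_def cell_rel_def curve_of_def)

lemma curve_of_iso_sym:
  assumes "\<Gamma> \<in> three_regular_graphs g n" "curve_iso (curve_of (\<Gamma>, s)) C"
  shows "curve_iso C (curve_of (\<Gamma>, s))"
proof -
  note g = trivalent_leg_graph[OF three_regular_graphs(1)[OF assms(1)]]
  show ?thesis
    using assms(2) curve_iso_sym[OF _ leg_graph_contract[OF g zero_edges_subset]]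
    by (cases C) (auto simp: curve_of_def curve_at_eq)
qed

lemma curve_of_iso_trans:
  assumes "\<Gamma> \<in> three_regular_graphs g n" "curve_iso (curve_of (\<Gamma>, s)) C" "curve_iso C D"
  shows "curve_iso (curve_of (\<Gamma>, s)) D"
proof -
  note g = trivalent_leg_graph[OF three_regular_graphs(1)[OF assms(1)]]
  show ?thesis
    using assms(2,3) curve_iso_trans[OF _ _ leg_graph_contract[OF g zero_edges_subset]]
    by (cases C; cases D) (auto simp: curve_of_def curve_at_eq)
qed

lemma topspace_cells_union:
  "(\<Gamma>, a) \<in> topspace (cells_union g n) \<longleftrightarrow>
     \<Gamma> \<in> three_regular_graphs g n \<and> (\<exists>t\<in>cell \<Gamma>. a = cell_rel \<Gamma> `` {t})"
  by (auto simp: cells_union_def cell_quotient_eq quotient_def)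

text \<open>A point of the first quotient is a whole class, and \<open>moduli_rel\<close> asks for
  some members to be isomorphic. Members of one class are isomorphic to each other, so the given
  \<open>s\<close> and \<open>t\<close> can take their place.\<close>

lemma moduli_rel_iff:
  assumes p: "(\<Gamma>, s) \<in> topspace (cells g n)" and q: "(\<Delta>, t) \<in> topspace (cells g n)"
  shows "((\<Gamma>, cell_rel \<Gamma> `` {s}), (\<Delta>, cell_rel \<Delta> `` {t})) \<in> moduli_rel g n \<longleftrightarrow>
    curve_iso (curve_of (\<Gamma>, s)) (curve_of (\<Delta>, t))"
proof
  note p' = p[unfolded topspace_cells] and q' = q[unfolded topspace_cells]
  assume "((\<Gamma>, cell_rel \<Gamma> `` {s}), (\<Delta>, cell_rel \<Delta> `` {t})) \<in> moduli_rel g n"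
  then obtain s' t' where st: "(s, s') \<in> cell_rel \<Gamma>" "(t, t') \<in> cell_rel \<Delta>"
    "curve_iso (curve_of (\<Gamma>, s')) (curve_of (\<Delta>, t'))"
    by (auto simp: moduli_rel_def curve_of_def)
  have "curve_iso (curve_of (\<Gamma>, s)) (curve_of (\<Gamma>, s'))" "curve_iso (curve_of (\<Delta>, t)) (curve_of (\<Delta>, t'))"
    using st by (auto simp: cell_rel_def)
  then show "curve_iso (curve_of (\<Gamma>, s)) (curve_of (\<Delta>, t))"
    using curve_of_iso_trans[OF conjunct1[OF p']] curve_of_iso_sym[OF conjunct1[OF q']] st(3) by blast
next
  note p' = p[unfolded topspace_cells] and q' = q[unfolded topspace_cells]
  assume i: "curve_iso (curve_of (\<Gamma>, s)) (curve_of (\<Delta>, t))"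
  have "s \<in> cell_rel \<Gamma> `` {s}" "t \<in> cell_rel \<Delta> `` {t}"
    using p' q' by (auto simp: cell_rel_def curve_iso_refl)
  moreover have "(\<Gamma>, cell_rel \<Gamma> `` {s}) \<in> topspace (cells_union g n)"
    "(\<Delta>, cell_rel \<Delta> `` {t}) \<in> topspace (cells_union g n)"
    using p' q' by (auto simp: topspace_cells_union)
  ultimately show "((\<Gamma>, cell_rel \<Gamma> `` {s}), (\<Delta>, cell_rel \<Delta> `` {t})) \<in> moduli_rel g n"
    using i unfolding moduli_rel_def curve_of_def case_prod_conv by blast
qed

lemma mem_proj_iff:
  assumes "(\<Gamma>, s) \<in> topspace (cells g n)"
  shows "(\<Delta>, b) \<in> proj g n (\<Gamma>, s) \<longleftrightarrow>
    (\<exists>t. (\<Delta>, t) \<in> topspace (cells g n) \<and> b = cell_rel \<Delta> `` {t} \<and> curve_iso (curve_of (\<Gamma>, s)) (curve_of (\<Delta>, t)))"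
proof
  assume "(\<Delta>, b) \<in> proj g n (\<Gamma>, s)"
  then have r: "((\<Gamma>, cell_rel \<Gamma> `` {s}), (\<Delta>, b)) \<in> moduli_rel g n" by (simp add: proj_def)
  then have "(\<Delta>, b) \<in> topspace (cells_union g n)" by (simp add: moduli_rel_def)
  then obtain t where t: "(\<Delta>, t) \<in> topspace (cells g n)" "b = cell_rel \<Delta> `` {t}"
    by (auto simp: topspace_cells_union topspace_cells)
  then show "\<exists>t. (\<Delta>, t) \<in> topspace (cells g n) \<and> b = cell_rel \<Delta> `` {t} \<and> curve_iso (curve_of (\<Gamma>, s)) (curve_of (\<Delta>, t))"
    using moduli_rel_iff[OF assms t(1)] r by blast
next
  assume "\<exists>t. (\<Delta>, t) \<in> topspace (cells g n) \<and> b = cell_rel \<Delta> `` {t} \<and> curve_iso (curve_of (\<Gamma>, s)) (curve_of (\<Delta>, t))"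
  then show "(\<Delta>, b) \<in> proj g n (\<Gamma>, s)" using moduli_rel_iff[OF assms] by (auto simp: proj_def)
qed

lemma proj_eq_iff:
  assumes p: "p \<in> topspace (cells g n)" and q: "q \<in> topspace (cells g n)"
  shows "proj g n p = proj g n q \<longleftrightarrow> curve_iso (curve_of p) (curve_of q)"
proof -
  obtain \<Gamma> s \<Delta> t where pq: "p = (\<Gamma>, s)" "q = (\<Delta>, t)" by (cases p; cases q)
  note P = p[unfolded pq] and Q = q[unfolded pq]
  note P' = conjunct1[OF P[unfolded topspace_cells]] and Q' = conjunct1[OF Q[unfolded topspace_cells]]
  show ?thesis unfolding pq
  proof
    assume e: "proj g n (\<Gamma>, s) = proj g n (\<Delta>, t)"
    have "(\<Delta>, cell_rel \<Delta> `` {t}) \<in> proj g n (\<Delta>, t)" using mem_proj_iff[OF Q] Q curve_iso_refl by blast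
    then have "(\<Delta>, cell_rel \<Delta> `` {t}) \<in> proj g n (\<Gamma>, s)" using e by simp
    then have "((\<Gamma>, cell_rel \<Gamma> `` {s}), (\<Delta>, cell_rel \<Delta> `` {t})) \<in> moduli_rel g n" by (simp add: proj_def)
    then show "curve_iso (curve_of (\<Gamma>, s)) (curve_of (\<Delta>, t))" using moduli_rel_iff[OF P Q] by blast
  next
    assume i: "curve_iso (curve_of (\<Gamma>, s)) (curve_of (\<Delta>, t))"
    have "curve_iso (curve_of (\<Gamma>, s)) C \<longleftrightarrow> curve_iso (curve_of (\<Delta>, t)) C" for C :: "(nat set, nat) curve"
      using curve_of_iso_trans[OF P'] curve_of_iso_trans[OF Q'] i curve_of_iso_sym[OF P' i] by blast
    then have "(\<Theta>, b) \<in> proj g n (\<Gamma>, s) \<longleftrightarrow> (\<Theta>, b) \<in> proj g n (\<Delta>, t)" for \<Theta> b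
      unfolding mem_proj_iff[OF P] mem_proj_iff[OF Q] by blast
    then show "proj g n (\<Gamma>, s) = proj g n (\<Delta>, t)" by auto
  qed
qed

lemma quotient_map_cells_union:
  "quotient_map (cells g n) (cells_union g n) (\<lambda>(\<Gamma>, t). (\<Gamma>, cell_rel \<Gamma> `` {t}))"
  unfolding quotient_map_def
proof (intro conjI allI impI)
  let ?T = "three_regular_graphs g n" and ?f = "\<lambda>(\<Gamma>, t). (\<Gamma>, cell_rel \<Gamma> `` {t})"
  show "?f ` topspace (cells g n) = topspace (cells_union g n)"
    by (force simp: topspace_cells_union topspace_cells)
  fix U assume U: "U \<subseteq> topspace (cells_union g n)"
  have "openin (cells g n) {x \<in> topspace (cells g n). ?f x \<in> U} \<longleftrightarrow>
      (\<forall>\<Gamma>\<in>?T. openin (closed_cell (\<Gamma>, \<lambda>_. 0)) {t \<in> cell \<Gamma>. (\<Gamma>, cell_rel \<Gamma> `` {t}) \<in> U})"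
  proof -
    have "{t. (\<Gamma>, t) \<in> {x \<in> topspace (cells g n). ?f x \<in> U}} = {t \<in> cell \<Gamma>. (\<Gamma>, cell_rel \<Gamma> `` {t}) \<in> U}"
      if "\<Gamma> \<in> ?T" for \<Gamma> using that by (auto simp: topspace_cells)
    moreover have "{x \<in> topspace (cells g n). ?f x \<in> U} \<subseteq> topspace (cells g n)" by (rule Collect_restrict)
    ultimately show ?thesis unfolding openin_cells by (simp only: simp_thms cong: ball_cong)
  qed
  also have "\<dots> \<longleftrightarrow> (\<forall>\<Gamma>\<in>?T. openin (cell_quotient (\<Gamma>, \<lambda>_. 0)) {a. (\<Gamma>, a) \<in> U})"
  proof (intro ball_cong refl)
    fix \<Gamma> assume \<Gamma>: "\<Gamma> \<in> ?T"
    have "{a. (\<Gamma>, a) \<in> U} \<subseteq> cell \<Gamma> // cell_rel \<Gamma>"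
      using U by (auto simp: cells_union_def cell_quotient_eq)
    then show "openin (closed_cell (\<Gamma>, \<lambda>_. 0)) {t \<in> cell \<Gamma>. (\<Gamma>, cell_rel \<Gamma> `` {t}) \<in> U} \<longleftrightarrow>
      openin (cell_quotient (\<Gamma>, \<lambda>_. 0)) {a. (\<Gamma>, a) \<in> U}"
      by (simp add: cell_quotient_eq openin_quotient_topology)
  qed
  also have "\<dots> \<longleftrightarrow> openin (cells_union g n) U"
    using U unfolding cells_union_def openin_sum_topology topspace_sum_topology by blast
  finally show "openin (cells g n) {x \<in> topspace (cells g n). ?f x \<in> U} \<longleftrightarrow> openin (cells_union g n) U" .
qed

text \<open>The moduli space is formed in two stages, within each cell and then across cells. The
  quotient maps compose, so open and closed sets can be tested on the disjoint union of the cells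
  themselves.\<close>

lemma quotient_map_proj: "quotient_map (cells g n) (Mbar g n) (proj g n)"
proof -
  have "proj g n = (\<lambda>y. moduli_rel g n `` {y}) \<circ> (\<lambda>(\<Gamma>, t). (\<Gamma>, cell_rel \<Gamma> `` {t}))"
    by (auto simp: proj_def fun_eq_iff)
  then show ?thesis
    using quotient_map_compose[OF quotient_map_cells_union quotient_map_quotient_topology] by (simp add: Mbar_def)
qed

lemma curve_class_proj:
  assumes p: "p \<in> topspace (cells g n)"
  shows "curve_class g n (proj g n p) = {C. extended_tropical_curve g n C \<and> curve_iso (curve_of p) C}"
proof -
  obtain \<Gamma> s where ps: "p = (\<Gamma>, s)" by (cases p)
  note P = p[unfolded ps]
  note P' = conjunct1[OF P[unfolded topspace_cells]]
  have "(\<exists>(\<Delta>, a)\<in>proj g n (\<Gamma>, s). \<exists>t\<in>a. curve_iso (curve_at (\<Delta>, \<lambda>_. 0) t) C) \<longleftrightarrow> curve_iso (curve_of (\<Gamma>, s)) C"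
    for C :: "(nat, nat) curve"
  proof
    assume "\<exists>(\<Delta>, a)\<in>proj g n (\<Gamma>, s). \<exists>t\<in>a. curve_iso (curve_at (\<Delta>, \<lambda>_. 0) t) C"
    then obtain \<Delta> a t' where a: "(\<Delta>, a) \<in> proj g n (\<Gamma>, s)" "t' \<in> a" "curve_iso (curve_of (\<Delta>, t')) C"
      by (auto simp: curve_of_def)
    then obtain t where t: "(\<Delta>, t) \<in> topspace (cells g n)" "a = cell_rel \<Delta> `` {t}"
      "curve_iso (curve_of (\<Gamma>, s)) (curve_of (\<Delta>, t))" using mem_proj_iff[OF P] by blast
    have "curve_iso (curve_of (\<Delta>, t)) (curve_of (\<Delta>, t'))" using a(2) t(2) by (simp add: cell_rel_def)
    then have "curve_iso (curve_of (\<Gamma>, s)) (curve_of (\<Delta>, t'))" by (rule curve_of_iso_trans[OF P' t(3)])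
    then show "curve_iso (curve_of (\<Gamma>, s)) C" using a(3) by (rule curve_of_iso_trans[OF P'])
  next
    assume C: "curve_iso (curve_of (\<Gamma>, s)) C"
    have "(\<Gamma>, cell_rel \<Gamma> `` {s}) \<in> proj g n (\<Gamma>, s)" using mem_proj_iff[OF P] P curve_iso_refl by blast
    moreover have "s \<in> cell_rel \<Gamma> `` {s}" using P by (auto simp: cell_rel_def curve_iso_refl topspace_cells)
    ultimately show "\<exists>(\<Delta>, a)\<in>proj g n (\<Gamma>, s). \<exists>t\<in>a. curve_iso (curve_at (\<Delta>, \<lambda>_. 0) t) C"
      using C by (intro bexI[of _ "(\<Gamma>, cell_rel \<Gamma> `` {s})"]) (auto simp: curve_of_def)
  qed
  then show ?thesis unfolding ps curve_class_def by simp
qed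

section \<open>Compactness and the Hausdorff property\<close>

text \<open>Points \<open>s\<close> and \<open>t\<close> have isomorphic curves exactly when both
  are images of one point \<open>u\<close> in the cell of a contraction of \<open>\<Delta>\<close>
  under two face inclusions. Once \<open>\<psi>\<close> is replaced by the map
  \<open>\<beta>\<close> that it induces on edges, there are finitely many pairs of inclusions, and
  each contributes the image under a closed map of a continuous preimage of
  \<open>K\<close>.\<close>

lemma closedin_isomorphic_points:
  assumes \<Gamma>: "\<Gamma> \<in> three_regular_graphs g n" and \<Delta>: "\<Delta> \<in> three_regular_graphs g n"
    and K: "closedin (closed_cell (\<Gamma>, \<lambda>_. 0)) K"
  shows "closedin (closed_cell (\<Delta>, \<lambda>_. 0)) {t \<in> cell \<Delta>. \<exists>s\<in>K. curve_iso (curve_of (\<Gamma>, s)) (curve_of (\<Delta>, t))}"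
proof -
  note g\<Gamma> = trivalent_leg_graph[OF three_regular_graphs(1)[OF \<Gamma>]]
  note g\<Delta> = trivalent_leg_graph[OF three_regular_graphs(1)[OF \<Delta>]]
  have Ksub: "K \<subseteq> cell \<Gamma>" using closedin_subset[OF K] by simp
  define I where "I = {(T, S, \<beta>). T \<subseteq> edges \<Delta> \<and> S \<subseteq> edges \<Gamma> \<and> \<beta> \<in> (edges \<Gamma> - S) \<rightarrow>\<^sub>E (edges \<Delta> - T) \<and>
    (\<exists>\<sigma> \<psi>. contraction (\<Gamma>, \<lambda>_. 0) (contract \<Delta> T, contract_weight \<Delta> (\<lambda>_. 0) T) S \<sigma> \<psi> \<and>
      (\<forall>e\<in>edges \<Gamma> - S. \<beta> e = \<psi> ` e))}"
  have "I \<subseteq> (SIGMA T:Pow (edges \<Delta>). SIGMA S:Pow (edges \<Gamma>). (edges \<Gamma> - S) \<rightarrow>\<^sub>E (edges \<Delta> - T))"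
    by (auto simp: I_def)
  moreover have "finite (SIGMA T:Pow (edges \<Delta>). SIGMA S:Pow (edges \<Gamma>). (edges \<Gamma> - S) \<rightarrow>\<^sub>E (edges \<Delta> - T))"
    using finite_edges[OF g\<Gamma>] finite_edges[OF g\<Delta>] by (auto intro!: finite_SigmaI finite_PiE)
  ultimately have "finite I" by (rule finite_subset)
  let ?F = "\<lambda>(T, S, \<beta>). face_map (edges \<Delta>) T (\<lambda>e. e) ` {u \<in> cell (contract \<Delta> T). face_map (edges \<Gamma>) S \<beta> u \<in> K}"
  have "{t \<in> cell \<Delta>. \<exists>s\<in>K. curve_iso (curve_of (\<Gamma>, s)) (curve_of (\<Delta>, t))} = (\<Union>i\<in>I. ?F i)"
  proof (intro equalityI subsetI)
    fix t assume "t \<in> {t \<in> cell \<Delta>. \<exists>s\<in>K. curve_iso (curve_of (\<Gamma>, s)) (curve_of (\<Delta>, t))}"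
    then obtain s where t: "t \<in> cell \<Delta>" and s: "s \<in> K" and i: "curve_iso (curve_of (\<Gamma>, s)) (curve_of (\<Delta>, t))"
      by auto
    let ?T = "zero_edges \<Delta> t" and ?S = "zero_edges \<Gamma> s"
    obtain \<sigma> \<psi> where c: "contraction (\<Gamma>, \<lambda>_. 0) (contract \<Delta> ?T, contract_weight \<Delta> (\<lambda>_. 0) ?T) ?S \<sigma> \<psi>"
      and l: "\<forall>e\<in>edges \<Gamma> - ?S. (if \<psi> ` e \<in> edges \<Delta> - ?T then t (\<psi> ` e) else None) = s e"
      using i unfolding curve_of_def case_prod_conv curve_at_eq[of \<Delta>] curve_iso_curve_at_iff[OF g\<Gamma>] by blast
    define \<beta> where "\<beta> = (\<lambda>e\<in>edges \<Gamma> - ?S. \<psi> ` e)"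
    have \<psi>: "\<psi> ` e \<in> edges \<Delta> - ?T" if "e \<in> edges \<Gamma> - ?S" for e
      using bij_betw_apply[OF contraction_edges[OF c g\<Gamma>] that] by (simp add: edges_contract)
    then have i: "(?T, ?S, \<beta>) \<in> I"
      using c zero_edges_subset unfolding I_def \<beta>_def by auto
    \<comment> \<open>The nonzero lengths of \<open>t\<close>; transported along
      \<open>\<beta>\<close> they are the nonzero lengths of \<open>s\<close>.\<close>
    define u where "u = (\<lambda>e\<in>edges \<Delta> - ?T. t e)"
    have "u \<in> cell (contract \<Delta> ?T)" using t by (auto simp: u_def edges_contract)
    moreover have "face_map (edges \<Gamma>) ?S \<beta> u = s"
    proof
      fix e
      have "s e = undefined" if "e \<notin> edges \<Gamma>" using s Ksub that by auto
      moreover have "s e = Some 0" if "e \<in> ?S" using that by (simp add: zero_edges_def)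
      moreover have "u (\<beta> e) = s e" if "e \<in> edges \<Gamma> - ?S"
        using \<psi>[OF that] bspec[OF l that] that by (simp add: u_def \<beta>_def)
      ultimately show "face_map (edges \<Gamma>) ?S \<beta> u e = s e" by (auto simp: face_map_def)
    qed
    moreover have "t = face_map (edges \<Delta>) ?T (\<lambda>e. e) u"
    proof
      fix e
      show "t e = face_map (edges \<Delta>) ?T (\<lambda>e. e) u e"
        using t by (auto simp: face_map_def u_def zero_edges_def PiE_def extensional_def)
    qed
    ultimately have "t \<in> ?F (?T, ?S, \<beta>)" using s by auto
    then show "t \<in> (\<Union>i\<in>I. ?F i)" using i by blast
  next
    \<comment> \<open>Here \<open>u\<close> may have zero coordinates too, so that more than
      \<open>S\<close> and \<open>T\<close> is contracted; the curves remain isomorphic to the one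
      at \<open>u\<close>.\<close>
    fix t assume "t \<in> (\<Union>i\<in>I. ?F i)"
    then obtain T S \<beta> u where i: "(T, S, \<beta>) \<in> I" and u: "u \<in> cell (contract \<Delta> T)" "face_map (edges \<Gamma>) S \<beta> u \<in> K"
      and t: "t = face_map (edges \<Delta>) T (\<lambda>e. e) u" by auto
    from i obtain \<sigma> \<psi> where T: "T \<subseteq> edges \<Delta>"
      and c: "contraction (\<Gamma>, \<lambda>_. 0) (contract \<Delta> T, contract_weight \<Delta> (\<lambda>_. 0) T) S \<sigma> \<psi>"
      and \<beta>: "\<forall>e\<in>edges \<Gamma> - S. \<beta> e = \<psi> ` e" unfolding I_def by auto
    let ?s = "face_map (edges \<Gamma>) S \<beta> u"
    have s: "?s = face_map (edges \<Gamma>) S ((`) \<psi>) u" using \<beta> face_map_cong[of "edges \<Gamma>" S \<beta> "(`) \<psi>"] by simp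
    have "curve_iso (curve_of (\<Gamma>, ?s)) (curve_at (contract \<Delta> T, contract_weight \<Delta> (\<lambda>_. 0) T) u)"
      using curve_iso_face_map[OF c g\<Gamma>] unfolding s by (simp add: curve_of_def)
    moreover have "curve_iso (curve_of (\<Delta>, t)) (curve_at (contract \<Delta> T, contract_weight \<Delta> (\<lambda>_. 0) T) u)"
      using curve_iso_face_map[OF contraction_contract[OF g\<Delta> T] g\<Delta>, of "\<lambda>_. 0" u]
      unfolding t image_id by (simp add: curve_of_def id_def)
    ultimately have "curve_iso (curve_of (\<Gamma>, ?s)) (curve_of (\<Delta>, t))"
      using curve_of_iso_trans[OF \<Gamma>] curve_of_iso_sym[OF \<Delta>] by blast
    moreover have "t \<in> cell \<Delta>"
      unfolding t by (rule face_map_in_cell[OF _ u(1)]) (simp add: edges_contract)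
    ultimately show "t \<in> {t \<in> cell \<Delta>. \<exists>s\<in>K. curve_iso (curve_of (\<Gamma>, s)) (curve_of (\<Delta>, t))}" using u(2) by blast
  qed
  moreover have F: "closedin (closed_cell (\<Delta>, \<lambda>_. 0)) (?F i)" if "i \<in> I" for i
  proof -
    obtain T S \<beta> where i: "i = (T, S, \<beta>)" by (cases i)
    let ?D = "closed_cell (contract \<Delta> T, \<lambda>_. 0)"
    have \<beta>: "\<beta> e \<in> edges (contract \<Delta> T)" if "e \<in> edges \<Gamma> - S" for e
      using that \<open>i \<in> I\<close> by (auto simp: i I_def edges_contract)
    have "closedin ?D {u \<in> topspace ?D. face_map (edges \<Gamma>) S \<beta> u \<in> K}"
      by (rule closedin_continuous_map_preimage[OF continuous_map_face_map[OF \<beta>] K])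
    moreover have "closed_map ?D (closed_cell (\<Delta>, \<lambda>_. 0)) (face_map (edges \<Delta>) T (\<lambda>e. e))"
      by (intro continuous_imp_closed_map continuous_map_face_map compact_space_closed_cell Hausdorff_space_closed_cell)
        (simp add: edges_contract)
    ultimately show ?thesis unfolding i case_prod_conv closed_map_def by simp
  qed
  moreover have "closedin (closed_cell (\<Delta>, \<lambda>_. 0)) (\<Union>i\<in>I. ?F i)"
  proof (rule closedin_Union)
    show "finite (?F ` I)" using \<open>finite I\<close> by (rule finite_imageI)
    fix S assume "S \<in> ?F ` I"
    then show "closedin (closed_cell (\<Delta>, \<lambda>_. 0)) S" by (elim imageE) (simp only: F)
  qed
  ultimately show ?thesis by (simp only:)
qed

text \<open>For a quotient map it suffices that the saturation of \<open>K\<close> is closed. Within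
  a cell it is a union of sets as in \<open>closedin_isomorphic_points\<close>, one for each of the
  finitely many cells.\<close>

lemma closed_map_proj: "closed_map (cells g n) (Mbar g n) (proj g n)"
  unfolding closed_map_def
proof (intro allI impI)
  fix K assume K: "closedin (cells g n) K"
  let ?T = "three_regular_graphs g n"
  have Ks: "K \<subseteq> topspace (cells g n)" by (rule closedin_subset[OF K])
  have K\<Gamma>: "closedin (closed_cell (\<Gamma>, \<lambda>_. 0)) {s. (\<Gamma>, s) \<in> K}" if "\<Gamma> \<in> ?T" for \<Gamma>
    using K that by (simp add: closedin_cells)
  have "closedin (cells g n) {p \<in> topspace (cells g n). proj g n p \<in> proj g n ` K}"
    unfolding closedin_cells
  proof (intro conjI ballI)
    show "{p \<in> topspace (cells g n). proj g n p \<in> proj g n ` K} \<subseteq> topspace (cells g n)" by (rule Collect_restrict)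
    fix \<Delta> assume \<Delta>: "\<Delta> \<in> ?T"
    have "{t. (\<Delta>, t) \<in> {p \<in> topspace (cells g n). proj g n p \<in> proj g n ` K}} =
      (\<Union>\<Gamma>\<in>?T. {t \<in> cell \<Delta>. \<exists>s\<in>{s. (\<Gamma>, s) \<in> K}. curve_iso (curve_of (\<Gamma>, s)) (curve_of (\<Delta>, t))})"
    proof (intro equalityI subsetI)
      fix t assume "t \<in> {t. (\<Delta>, t) \<in> {p \<in> topspace (cells g n). proj g n p \<in> proj g n ` K}}"
      then obtain \<Gamma> s where s: "(\<Delta>, t) \<in> topspace (cells g n)" "(\<Gamma>, s) \<in> K" "proj g n (\<Delta>, t) = proj g n (\<Gamma>, s)"
        by auto
      then have "(\<Gamma>, s) \<in> topspace (cells g n)" using Ks by blast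
      then show "t \<in> (\<Union>\<Gamma>\<in>?T. {t \<in> cell \<Delta>. \<exists>s\<in>{s. (\<Gamma>, s) \<in> K}. curve_iso (curve_of (\<Gamma>, s)) (curve_of (\<Delta>, t))})"
        using proj_eq_iff[of "(\<Gamma>, s)" g n "(\<Delta>, t)"] s unfolding topspace_cells by auto
    next
      fix t assume "t \<in> (\<Union>\<Gamma>\<in>?T. {t \<in> cell \<Delta>. \<exists>s\<in>{s. (\<Gamma>, s) \<in> K}. curve_iso (curve_of (\<Gamma>, s)) (curve_of (\<Delta>, t))})"
      then obtain \<Gamma> s where s: "t \<in> cell \<Delta>" "(\<Gamma>, s) \<in> K" "curve_iso (curve_of (\<Gamma>, s)) (curve_of (\<Delta>, t))" by auto
      have t: "(\<Delta>, t) \<in> topspace (cells g n)" using s(1) \<Delta> by (simp add: topspace_cells)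
      have "proj g n (\<Gamma>, s) = proj g n (\<Delta>, t)" using proj_eq_iff[OF _ t] s(2,3) Ks by blast
      then have "proj g n (\<Delta>, t) \<in> proj g n ` K" using imageI[OF s(2), of "proj g n"] by (simp only:)
      then show "t \<in> {t. (\<Delta>, t) \<in> {p \<in> topspace (cells g n). proj g n p \<in> proj g n ` K}}"
        using t by (intro CollectI conjI)
    qed
    moreover have "closedin (closed_cell (\<Delta>, \<lambda>_. 0))
      (\<Union>\<Gamma>\<in>?T. {t \<in> cell \<Delta>. \<exists>s\<in>{s. (\<Gamma>, s) \<in> K}. curve_iso (curve_of (\<Gamma>, s)) (curve_of (\<Delta>, t))})"
      by (intro closedin_Union finite_imageI finite_three_regular_graphs)
        (use closedin_isomorphic_points[OF _ \<Delta> K\<Gamma>] in auto)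
    ultimately show "closedin (closed_cell (\<Delta>, \<lambda>_. 0)) {t. (\<Delta>, t) \<in> {p \<in> topspace (cells g n). proj g n p \<in> proj g n ` K}}"
      by simp
  qed
  moreover have "proj g n ` K \<subseteq> topspace (Mbar g n)"
    using Ks quotient_imp_surjective_map[OF quotient_map_proj] by blast
  ultimately show "closedin (Mbar g n) (proj g n ` K)"
    using quotient_map_proj[of g n] unfolding quotient_map_closedin by blast
qed

lemma compact_space_cells: "compact_space (cells g n)"
proof -
  have "compactin (cells g n) (\<Union>\<Gamma>\<in>three_regular_graphs g n. (\<lambda>t. (\<Gamma>, t)) ` cell \<Gamma>)"
  proof (rule compactin_Union)
    fix S assume "S \<in> (\<lambda>\<Gamma>. (\<lambda>t. (\<Gamma>, t)) ` cell \<Gamma>) ` three_regular_graphs g n"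
    then obtain \<Gamma> where \<Gamma>: "\<Gamma> \<in> three_regular_graphs g n" "S = (\<lambda>t. (\<Gamma>, t)) ` cell \<Gamma>" by auto
    have "compactin (closed_cell (\<Gamma>, \<lambda>_. 0)) (cell \<Gamma>)"
      using compact_space_closed_cell[of \<Gamma> "\<lambda>_. 0"] by (simp add: compact_space_def)
    then show "compactin (cells g n) S"
      unfolding \<Gamma>(2) cells_def by (rule image_compactin) (rule continuous_map_component_injection[OF \<Gamma>(1)])
  qed (use finite_three_regular_graphs in auto)
  moreover have "(\<Union>\<Gamma>\<in>three_regular_graphs g n. (\<lambda>t. (\<Gamma>, t)) ` cell \<Gamma>) = topspace (cells g n)"
    by (auto simp: topspace_cells)
  ultimately show ?thesis by (simp add: compact_space_def)
qed

lemma Hausdorff_space_cells: "Hausdorff_space (cells g n)"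
  unfolding Hausdorff_space_def
proof (intro allI impI, elim conjE)
  fix p q assume p: "p \<in> topspace (cells g n)" and q: "q \<in> topspace (cells g n)" and ne: "p \<noteq> q"
  obtain \<Gamma> s \<Delta> t where pq: "p = (\<Gamma>, s)" "q = (\<Delta>, t)" by (cases p; cases q)
  have \<Gamma>: "\<Gamma> \<in> three_regular_graphs g n" "s \<in> cell \<Gamma>" and \<Delta>: "\<Delta> \<in> three_regular_graphs g n" "t \<in> cell \<Delta>"
    using p q by (auto simp: pq topspace_cells)
  have op: "openin (cells g n) ((\<lambda>t. (\<Gamma>, t)) ` U)"
    if "\<Gamma> \<in> three_regular_graphs g n" "openin (closed_cell (\<Gamma>, \<lambda>_. 0)) U" for \<Gamma> U
    using open_map_component_injection[OF that(1), of "\<lambda>\<Gamma>. closed_cell (\<Gamma>, \<lambda>_. 0)"] that(2)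
    by (simp add: cells_def open_map_def)
  show "\<exists>U V. openin (cells g n) U \<and> openin (cells g n) V \<and> p \<in> U \<and> q \<in> V \<and> disjnt U V"
  proof (cases "\<Gamma> = \<Delta>")
    case True
    then have "s \<noteq> t" using ne pq by simp
    moreover note spec[OF spec[OF Hausdorff_space_closed_cell[of \<Gamma> "\<lambda>_. 0", unfolded Hausdorff_space_def topspace_closed_cell], of s], of t]
    ultimately have "\<exists>U V. openin (closed_cell (\<Gamma>, \<lambda>_. 0)) U \<and> openin (closed_cell (\<Gamma>, \<lambda>_. 0)) V \<and> s \<in> U \<and> t \<in> V \<and> disjnt U V"
      using \<Gamma>(2) \<Delta>(2) True by simp
    then obtain U V where UV: "openin (closed_cell (\<Gamma>, \<lambda>_. 0)) U" "openin (closed_cell (\<Gamma>, \<lambda>_. 0)) V" "s \<in> U" "t \<in> V" "disjnt U V"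
      by (elim exE conjE)
    show ?thesis
      by (rule exI[of _ "(\<lambda>t. (\<Gamma>, t)) ` U"], rule exI[of _ "(\<lambda>t. (\<Gamma>, t)) ` V"])
        (use UV op[OF \<Gamma>(1)] pq True in \<open>auto simp: disjnt_iff\<close>)
  next
    case False
    have "openin (closed_cell (\<Theta>, \<lambda>_. 0)) (cell \<Theta>)" for \<Theta> :: "(nat, nat) graph"
      using openin_topspace[of "closed_cell (\<Theta>, \<lambda>_. 0)"] by simp
    then show ?thesis
      by (intro exI[of _ "(\<lambda>t. (\<Gamma>, t)) ` cell \<Gamma>"] exI[of _ "(\<lambda>t. (\<Delta>, t)) ` cell \<Delta>"])
        (use op \<Gamma> \<Delta> pq False in \<open>auto simp: disjnt_iff\<close>)
  qed
qed

lemma compact_space_Mbar: "compact_space (Mbar g n)"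
  using compact_space_cells quotient_imp_continuous_map[OF quotient_map_proj]
    quotient_imp_surjective_map[OF quotient_map_proj] image_compactin[of "cells g n" "topspace (cells g n)" "Mbar g n" "proj g n"]
  by (simp add: compact_space_def)

text \<open>Injectivity fails, so separation cannot be pulled back point by point. Instead disjoint
  closed fibres are separated in the compact Hausdorff, hence normal, union of cells, and the closed
  projection carries this over.\<close>

lemma Hausdorff_space_Mbar: "Hausdorff_space (Mbar g n)"
proof -
  have "normal_space (cells g n)"
    using compact_Hausdorff_or_regular_imp_normal_space[OF compact_space_cells] Hausdorff_space_cells by blast
  then show ?thesis
    using normal_Hausdorff_space_closed_continuous_map_image[OF _ Hausdorff_space_cells closed_map_proj
        quotient_imp_continuous_map[OF quotient_map_proj] quotient_imp_surjective_map[OF quotient_map_proj]] by blast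
qed

section \<open>Points of the moduli space and isomorphism classes of curves\<close>

lemma curve_iso_imp_wgraph_iso: "curve_iso (\<Gamma>, w, l) (\<Delta>, w', l') \<Longrightarrow> wgraph_iso (\<Gamma>, w) (\<Delta>, w')"
  by (auto simp: curve_iso_def wgraph_iso_def)

lemma extended_tropical_curveD:
  assumes "extended_tropical_curve g n (\<Gamma>, w, l)"
  shows "stable_graph g n (\<Gamma>, w)" "leg_graph n \<Gamma>"
    "\<And>e. e \<in> edges \<Gamma> \<Longrightarrow> l e \<in> pos_ext" "\<And>x. x \<in> legs \<Gamma> \<Longrightarrow> l {x} = None"
  using assms stable_graphD(2) by (auto simp: extended_tropical_curve_def)

lemma extended_tropical_curve_iso_trans:
  assumes "extended_tropical_curve g n C" "curve_iso C D" "curve_iso D E"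
  shows "curve_iso C E"
proof -
  obtain \<Gamma> w l \<Delta> w' l' \<Theta> w'' l'' where e: "C = (\<Gamma>, w, l)" "D = (\<Delta>, w', l')" "E = (\<Theta>, w'', l'')"
    by (cases C; cases D; cases E)
  show ?thesis
    using curve_iso_trans[OF assms(2,3)[unfolded e] extended_tropical_curveD(2)[OF assms(1)[unfolded e]]]
    unfolding e .
qed

lemma contracts_to_representative:
  assumes t: "trivalent g n (A :: (nat, nat) graph)" and i: "graph_iso A \<Gamma>"
    and c: "contracts_to (A, \<lambda>_. 0) (\<Delta>, w)"
  shows "contracts_to (\<Gamma> :: (nat, nat) graph, \<lambda>_. 0) (\<Delta>, w)"
proof -
  note g = trivalent_leg_graph[OF t]
  obtain \<sigma> \<psi> where iso: "contraction (A, \<lambda>_. 0) (\<Gamma>, \<lambda>_. 0) {} \<sigma> \<psi>"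
    using i unfolding graph_iso_iff_wgraph_iso wgraph_iso_iff[OF g] by blast
  have "contracts_to (\<Gamma>, \<lambda>_. 0) (A, \<lambda>_. 0)"
    using contraction_iso_sym[OF iso g] unfolding contracts_to_def by blast
  then show ?thesis using c contraction_leg_graph[OF iso g] by (rule contracts_to_trans)
qed

lemma exists_cell_over:
  assumes "stable_graph g n (\<Delta> :: (nat, nat) graph, w)"
  shows "\<exists>\<Gamma>\<in>three_regular_graphs g n. contracts_to (\<Gamma>, \<lambda>_. 0) (\<Delta>, w)"
proof -
  obtain A :: "(nat, nat) graph" where A: "trivalent g n A" "contracts_to (A, \<lambda>_. 0) (\<Delta>, w)"
    using exists_trivalent_expansion[OF assms] by blast
  obtain \<Gamma> where "\<Gamma> \<in> three_regular_graphs g n" "graph_iso A \<Gamma>" using three_regular_graphs(2)[OF A(1)] by blast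
  then show ?thesis using contracts_to_representative[OF A(1) _ A(2)] by blast
qed

lemma face_map_point:
  assumes \<Gamma>: "\<Gamma> \<in> three_regular_graphs g n" and c: "contraction (\<Gamma>, \<lambda>_. 0) (\<Delta>, w) S \<sigma> \<psi>" and u: "u \<in> cell \<Delta>"
  shows "(\<Gamma>, face_map (edges \<Gamma>) S ((`) \<psi>) u) \<in> topspace (cells g n)"
    "curve_iso (curve_of (\<Gamma>, face_map (edges \<Gamma>) S ((`) \<psi>) u)) (curve_at (\<Delta>, w) u)"
proof -
  note g = trivalent_leg_graph[OF three_regular_graphs(1)[OF \<Gamma>]]
  show "(\<Gamma>, face_map (edges \<Gamma>) S ((`) \<psi>) u) \<in> topspace (cells g n)"
    unfolding topspace_cells
  proof (intro conjI face_map_in_cell[OF _ u])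
    show "\<psi> ` e \<in> edges \<Delta>" if "e \<in> edges \<Gamma> - S" for e
      using contraction_edges[OF c g] that by (rule bij_betw_apply)
  qed (rule \<Gamma>)
  show "curve_iso (curve_of (\<Gamma>, face_map (edges \<Gamma>) S ((`) \<psi>) u)) (curve_at (\<Delta>, w) u)"
    using curve_iso_face_map[OF c g] by (simp add: curve_of_def)
qed

text \<open>Contracting no edge still replaces vertices by singletons, so the two curves have
  different types and are compared by an isomorphism.\<close>

lemma curve_iso_curve_at_positive:
  assumes "extended_tropical_curve g n (\<Delta>, w, l)" "\<And>e. e \<in> edges \<Delta> \<Longrightarrow> u e = l e"
  shows "curve_iso (curve_at (\<Delta>, w) u) (\<Delta>, w, l)"
proof -
  note E = extended_tropical_curveD[OF assms(1)]
  have "u e \<noteq> Some 0" if "e \<in> edges \<Delta>" for e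
    using E(3)[OF that] assms(2)[OF that] by auto
  then have z: "zero_edges \<Delta> u = {}" by (auto simp: zero_edges_def)
  have "(\<forall>e\<in>edges \<Delta> - zero_edges \<Delta> u. l (id ` e) = u e) \<and> (\<forall>x\<in>legs \<Delta>. l {id x} = None)"
    using assms(2) E(4) by simp
  moreover have "contraction (\<Delta>, w) (\<Delta>, w) (zero_edges \<Delta> u) id id"
    unfolding z by (rule contraction_id[OF E(2)])
  ultimately show ?thesis unfolding curve_iso_curve_at_iff[OF E(2)] by blast
qed

text \<open>This gives surjectivity onto isomorphism classes: the lengths form a point in the cell
  of the curve's own graph, and that cell is a face of the cell of a 3-regular graph above
  it.\<close>

lemma exists_point_of_curve:
  assumes "extended_tropical_curve g n (C :: (nat, nat) curve)"
  shows "\<exists>p\<in>topspace (cells g n). curve_iso (curve_of p) C"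
proof -
  obtain \<Delta> w l where C: "C = (\<Delta>, w, l)" by (cases C)
  note E = extended_tropical_curveD[OF assms[unfolded C]]
  obtain \<Gamma> S \<sigma> \<psi> where \<Gamma>: "\<Gamma> \<in> three_regular_graphs g n" and c: "contraction (\<Gamma>, \<lambda>_. 0) (\<Delta>, w) S \<sigma> \<psi>"
    using exists_cell_over[OF E(1)] unfolding contracts_to_def by blast
  let ?u = "\<lambda>e\<in>edges \<Delta>. l e"
  have "pos_ext \<subseteq> nonneg_ext" by (auto simp: pos_ext_def nonneg_ext_def)
  then have "?u \<in> cell \<Delta>" using E(3) by auto
  note p = face_map_point[OF \<Gamma> c this]
  have "curve_iso (curve_at (\<Delta>, w) ?u) C"
    unfolding C by (rule curve_iso_curve_at_positive[OF assms[unfolded C]]) simp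
  then show ?thesis using p(1) curve_of_iso_trans[OF \<Gamma> p(2)] by blast
qed

text \<open>The target graph is prescribed, so that the curve at \<open>t\<close> can be realized on
  a chosen representative; the lengths are carried over by the bijection of surviving edges, none of
  which has length zero.\<close>

lemma exists_length_function:
  assumes \<Gamma>: "\<Gamma> \<in> three_regular_graphs g n" and t: "t \<in> cell \<Gamma>"
    and c: "contraction (\<Gamma>, \<lambda>_. 0) (\<Delta>, w) (zero_edges \<Gamma> t) \<sigma> \<psi>"
  shows "\<exists>l. extended_tropical_curve g n (\<Delta>, w, l) \<and> curve_iso (curve_of (\<Gamma>, t)) (\<Delta>, w, l)"
proof -
  note tr = three_regular_graphs(1)[OF \<Gamma>]
  note g = trivalent_leg_graph[OF tr]
  let ?Z = "zero_edges \<Gamma> t"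
  \<comment> \<open>The default off the edges is infinity, as required on legs.\<close>
  let ?l = "\<lambda>e. if e \<in> edges \<Delta> then t (inv_into (edges \<Gamma> - ?Z) ((`) \<psi>) e) else None"
  note b = contraction_edges[OF c g]
  have s: "stable_graph g n (\<Delta>, w)" by (rule stable_graph_contraction[OF c trivalent_stable_graph[OF tr]])
  note gD = stable_graphD(2)[OF s]
  have "?l e \<in> pos_ext" if e: "e \<in> edges \<Delta>" for e
  proof -
    have i: "inv_into (edges \<Gamma> - ?Z) ((`) \<psi>) e \<in> edges \<Gamma> - ?Z"
      using bij_betw_apply[OF bij_betw_inv_into[OF b] e] .
    then have "t (inv_into (edges \<Gamma> - ?Z) ((`) \<psi>) e) \<in> nonneg_ext" using t by (auto intro: PiE_mem)
    moreover have "t (inv_into (edges \<Gamma> - ?Z) ((`) \<psi>) e) \<noteq> Some 0" using i by (auto simp: zero_edges_def)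
    ultimately show ?thesis using e by (auto simp: nonneg_ext_def pos_ext_def)
  qed
  moreover have "?l {x} = None" if "x \<in> legs \<Delta>" for x using leg_not_edge[OF gD that] by simp
  ultimately have ext: "extended_tropical_curve g n (\<Delta>, w, ?l)"
    using s unfolding extended_tropical_curve_def case_prod_conv by blast
  have "?l (\<psi> ` e) = t e" if "e \<in> edges \<Gamma> - ?Z" for e
    using bij_betw_apply[OF b that] bij_betw_inv_into_left[OF b that] by simp
  moreover have "?l {\<psi> x} = None" if x: "x \<in> legs \<Gamma>" for x
  proof -
    have "\<psi> x \<in> set (map \<psi> (leg_list \<Gamma>))" using x leg_graphD(8)[OF g] by simp
    then have "\<psi> x \<in> legs \<Delta>" using contractionD(7)[OF c] leg_graphD(8)[OF gD] by simp
    then show ?thesis using leg_not_edge[OF gD] by simp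
  qed
  ultimately have "curve_iso (curve_of (\<Gamma>, t)) (\<Delta>, w, ?l)"
    unfolding curve_of_def case_prod_conv curve_iso_curve_at_iff[OF g] using c by blast
  then show ?thesis using ext by blast
qed

text \<open>The contracted graph has sets of naturals as vertices. It is relabelled by naturals and
  then carried to the representative of its class before lengths are put on it.\<close>

lemma exists_stratum:
  assumes p: "(\<Gamma>, t) \<in> topspace (cells g n)"
  shows "\<exists>(\<Delta>, w)\<in>stable_graphs g n. \<exists>l. extended_tropical_curve g n (\<Delta>, w, l) \<and> curve_iso (curve_of (\<Gamma>, t)) (\<Delta>, w, l)"
proof -
  have \<Gamma>: "\<Gamma> \<in> three_regular_graphs g n" and t: "t \<in> cell \<Gamma>" using p by (auto simp: topspace_cells)
  note tr = three_regular_graphs(1)[OF \<Gamma>]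
  note g = trivalent_leg_graph[OF tr]
  let ?Z = "zero_edges \<Gamma> t"
  note c = contraction_contract[OF g zero_edges_subset[of \<Gamma> t], of "\<lambda>_. 0"]
  note gc = leg_graph_contract[OF g zero_edges_subset[of \<Gamma> t]]
  obtain A :: "(nat, nat) graph" and u \<sigma> \<psi>
    where A: "contraction (contract \<Gamma> ?Z, contract_weight \<Gamma> (\<lambda>_. 0) ?Z) (A, u) {} \<sigma> \<psi>"
    using exists_nat_graph[OF gc] by blast
  note cA = contraction_comp_iso[OF c A g]
  note sA = stable_graph_contraction[OF cA trivalent_stable_graph[OF tr]]
  obtain \<Delta> w where D: "(\<Delta>, w) \<in> stable_graphs g n" "wgraph_iso (A, u) (\<Delta>, w)"
    using stable_graphs(2)[OF sA] by fast
  obtain \<tau> \<rho> where "contraction (A, u) (\<Delta>, w) {} \<tau> \<rho>"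
    using D(2) unfolding wgraph_iso_iff[OF stable_graphD(2)[OF sA]] by blast
  note cD = contraction_comp_iso[OF cA this g]
  show ?thesis using D(1) exists_length_function[OF \<Gamma> t cD] by blast
qed

lemma topspace_Mbar: "topspace (Mbar g n) = proj g n ` topspace (cells g n)"
  using quotient_imp_surjective_map[OF quotient_map_proj] by blast

theorem bij_betw_curve_class:
  "bij_betw (curve_class g n) (topspace (Mbar g n)) (curve_classes g n)"
  unfolding bij_betw_def
proof
  \<comment> \<open>Injectivity rests on this: two points with equal classes are compared through a
    common member, so no class may be empty.\<close>
  have C: "\<exists>C :: (nat, nat) curve. extended_tropical_curve g n C \<and> curve_iso (curve_of p) C"
    if "p \<in> topspace (cells g n)" for p
    using exists_stratum[of "fst p" "snd p" g n] that by auto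
  have sym: "curve_iso D (curve_of p)" if "p \<in> topspace (cells g n)" "curve_iso (curve_of p) D"
    for p and D :: "(nat, nat) curve"
    using curve_of_iso_sym[of "fst p" g n "snd p" D] that topspace_cells[of "fst p" "snd p" g n] by simp
  show "inj_on (curve_class g n) (topspace (Mbar g n))"
    unfolding topspace_Mbar
  proof (rule inj_onI, elim imageE, hypsubst)
    fix p q assume p: "p \<in> topspace (cells g n)" and q: "q \<in> topspace (cells g n)"
      and e: "curve_class g n (proj g n p) = curve_class g n (proj g n q)"
    obtain D :: "(nat, nat) curve" where D: "extended_tropical_curve g n D" "curve_iso (curve_of p) D"
      using C[OF p] by blast
    then have "curve_iso (curve_of q) D" using e unfolding curve_class_proj[OF p] curve_class_proj[OF q] by blast
    note sym[OF q this]
    then have "curve_iso (curve_of p) (curve_of q)"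
      using curve_of_iso_trans[of "fst p" g n "snd p" D "curve_of q"] p D(2) topspace_cells[of "fst p" "snd p" g n]
      by simp
    then show "proj g n p = proj g n q" using proj_eq_iff[OF p q] by blast
  qed
  let ?r = "{(C :: (nat, nat) curve, D). extended_tropical_curve g n C \<and> extended_tropical_curve g n D \<and> curve_iso C D}"
  have cls: "curve_class g n (proj g n p) = ?r `` {D}"
    if p: "p \<in> topspace (cells g n)" and D: "extended_tropical_curve g n D" "curve_iso (curve_of p) D"
    for p and D :: "(nat, nat) curve"
  proof -
    have "curve_iso (curve_of p) E \<longleftrightarrow> curve_iso D E" for E :: "(nat, nat) curve"
    proof
      show "curve_iso D E" if "curve_iso (curve_of p) E"
        by (rule extended_tropical_curve_iso_trans[OF D(1) sym[OF p D(2)] that])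
      show "curve_iso (curve_of p) E" if "curve_iso D E"
        using curve_of_iso_trans[of "fst p" g n "snd p" D E] p D(2) that topspace_cells[of "fst p" "snd p" g n]
        by simp
    qed
    then show ?thesis unfolding curve_class_proj[OF p] using D(1) by auto
  qed
  show "curve_class g n ` topspace (Mbar g n) = curve_classes g n"
    unfolding topspace_Mbar curve_classes_def
  proof (intro equalityI subsetI)
    fix c assume "c \<in> curve_class g n ` proj g n ` topspace (cells g n)"
    then obtain p where p: "p \<in> topspace (cells g n)" "c = curve_class g n (proj g n p)" by blast
    obtain D :: "(nat, nat) curve" where D: "extended_tropical_curve g n D" "curve_iso (curve_of p) D"
      using C[OF p(1)] by blast
    show "c \<in> {C. extended_tropical_curve g n C} // ?r"
      unfolding p(2) cls[OF p(1) D] by (rule quotientI) (simp add: D(1))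
  next
    fix c assume "c \<in> {C. extended_tropical_curve g n C} // ?r"
    then obtain D where D: "extended_tropical_curve g n D" "c = ?r `` {D}" by (auto elim!: quotientE)
    obtain p where p: "p \<in> topspace (cells g n)" "curve_iso (curve_of p) D"
      using exists_point_of_curve[OF D(1)] by blast
    show "c \<in> curve_class g n ` proj g n ` topspace (cells g n)"
      unfolding D(2) cls[OF p(1) D(1) p(2), symmetric] using p(1) by (intro imageI)
  qed
qed

section \<open>Strata\<close>

lemma proj_in_stratum_iff:
  assumes "p \<in> topspace (cells g n)"
  shows "proj g n p \<in> stratum g n (\<Delta>, w) \<longleftrightarrow>
    (\<exists>l. extended_tropical_curve g n (\<Delta>, w, l) \<and> curve_iso (curve_of p) (\<Delta>, w, l))"
  using assms curve_class_proj[OF assms] by (simp add: stratum_def topspace_Mbar)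

text \<open>A curve class in two strata would make the two representatives isomorphic, hence
  equal.\<close>

lemma disjoint_strata: "disjoint_family_on (stratum g n) (stable_graphs g n)"
  unfolding disjoint_family_on_def
proof (intro ballI impI, rule ccontr)
  fix G D assume G: "G \<in> stable_graphs g n" and D: "D \<in> stable_graphs g n" and ne: "G \<noteq> D"
    and "stratum g n G \<inter> stratum g n D \<noteq> {}"
  then obtain x where x: "x \<in> stratum g n G" "x \<in> stratum g n D" by blast
  obtain \<Delta> w \<Theta> u where GD: "G = (\<Delta>, w)" "D = (\<Theta>, u)" by (cases G; cases D)
  obtain p where p: "p \<in> topspace (cells g n)" "x = proj g n p"
    using x(1) by (auto simp: stratum_def GD topspace_Mbar)
  obtain l where l: "extended_tropical_curve g n (\<Delta>, w, l)" "curve_iso (curve_of p) (\<Delta>, w, l)"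
    using x(1) proj_in_stratum_iff[OF p(1)] unfolding p(2) GD by blast
  obtain l' where l': "curve_iso (curve_of p) (\<Theta>, u, l')"
    using x(2) proj_in_stratum_iff[OF p(1)] unfolding p(2) GD by blast
  have "curve_iso (\<Delta>, w, l) (curve_of p)"
    using curve_of_iso_sym[of "fst p" g n "snd p" "(\<Delta>, w, l)"] p(1) l(2) topspace_cells[of "fst p" "snd p" g n] by simp
  then have "curve_iso (\<Delta>, w, l) (\<Theta>, u, l')" using extended_tropical_curve_iso_trans[OF l(1)] l' by blast
  then have "wgraph_iso G D" unfolding GD by (rule curve_iso_imp_wgraph_iso)
  then show False using stable_graphs(3)[OF G D] ne by blast
qed

lemma Union_strata: "(\<Union>i\<in>stable_graphs g n. stratum g n i) = topspace (Mbar g n)"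
proof (intro equalityI subsetI)
  fix x assume "x \<in> topspace (Mbar g n)"
  then obtain \<Gamma> t where p: "(\<Gamma>, t) \<in> topspace (cells g n)" "x = proj g n (\<Gamma>, t)" unfolding topspace_Mbar by auto
  then show "x \<in> (\<Union>i\<in>stable_graphs g n. stratum g n i)"
    using exists_stratum[OF p(1)] proj_in_stratum_iff[OF p(1)] by fastforce
qed (auto simp: stratum_def)

lemma continuous_map_proj_cell:
  assumes "\<Gamma> \<in> three_regular_graphs g n"
  shows "continuous_map (closed_cell (\<Gamma>, \<lambda>_. 0)) (Mbar g n) (\<lambda>t. proj g n (\<Gamma>, t))"
  using continuous_map_compose[OF continuous_map_component_injection[OF assms, of "\<lambda>\<Gamma>. closed_cell (\<Gamma>, \<lambda>_. 0)", folded cells_def]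
      quotient_imp_continuous_map[OF quotient_map_proj]]
  by (simp add: o_def)

text \<open>A product of copies of the connected set of positive extended lengths maps onto the
  stratum, by a face inclusion followed by the projection.\<close>

lemma connectedin_stratum:
  assumes "i \<in> stable_graphs g n"
  shows "connectedin (Mbar g n) (stratum g n i)"
proof -
  obtain \<Delta> w where i: "i = (\<Delta>, w)" by (cases i)
  note s = stable_graphs(1)[OF assms[unfolded i]]
  obtain \<Gamma> S \<sigma> \<psi> where \<Gamma>: "\<Gamma> \<in> three_regular_graphs g n" and c: "contraction (\<Gamma>, \<lambda>_. 0) (\<Delta>, w) S \<sigma> \<psi>"
    using exists_cell_over[OF s] unfolding contracts_to_def by blast
  note g = trivalent_leg_graph[OF three_regular_graphs(1)[OF \<Gamma>]]
  let ?f = "face_map (edges \<Gamma>) S ((`) \<psi>)" and ?P = "edges \<Delta> \<rightarrow>\<^sub>E pos_ext"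
  have pn: "pos_ext \<subseteq> nonneg_ext" by (auto simp: pos_ext_def nonneg_ext_def)
  then have PC: "?P \<subseteq> cell \<Delta>" by (rule PiE_mono)
  have "stratum g n i = (\<lambda>u. proj g n (\<Gamma>, ?f u)) ` ?P"
  proof (intro equalityI subsetI)
    fix x assume x: "x \<in> stratum g n i"
    then obtain p where p: "p \<in> topspace (cells g n)" "x = proj g n p"
      by (auto simp: stratum_def i topspace_Mbar)
    obtain l where l: "extended_tropical_curve g n (\<Delta>, w, l)" "curve_iso (curve_of p) (\<Delta>, w, l)"
      using x proj_in_stratum_iff[OF p(1)] unfolding p(2) i by blast
    let ?u = "\<lambda>e\<in>edges \<Delta>. l e"
    have u: "?u \<in> ?P" using extended_tropical_curveD(3)[OF l(1)] by auto
    note fp = face_map_point[OF \<Gamma> c subsetD[OF PC u]]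
    have "curve_iso (curve_at (\<Delta>, w) ?u) (\<Delta>, w, l)" by (rule curve_iso_curve_at_positive[OF l(1)]) simp
    then have "curve_iso (curve_of (\<Gamma>, ?f ?u)) (\<Delta>, w, l)" by (rule curve_of_iso_trans[OF \<Gamma> fp(2)])
    moreover have "curve_iso (\<Delta>, w, l) (curve_of p)"
      using curve_of_iso_sym[of "fst p" g n "snd p" "(\<Delta>, w, l)"] p(1) l(2) topspace_cells[of "fst p" "snd p" g n] by simp
    ultimately have "curve_iso (curve_of (\<Gamma>, ?f ?u)) (curve_of p)" by (rule curve_of_iso_trans[OF \<Gamma>])
    then have "x = proj g n (\<Gamma>, ?f ?u)" using proj_eq_iff[OF fp(1) p(1)] p(2) by simp
    then show "x \<in> (\<lambda>u. proj g n (\<Gamma>, ?f u)) ` ?P" using u by (rule image_eqI)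
  next
    fix x assume "x \<in> (\<lambda>u. proj g n (\<Gamma>, ?f u)) ` ?P"
    then obtain u where u: "u \<in> ?P" "x = proj g n (\<Gamma>, ?f u)" by blast
    note fp = face_map_point[OF \<Gamma> c subsetD[OF PC u(1)]]
    let ?l = "\<lambda>e. if e \<in> edges \<Delta> then u e else None"
    have "?l {y} = None" if "y \<in> legs \<Delta>" for y using leg_not_edge[OF stable_graphD(2)[OF s] that] by simp
    then have e: "extended_tropical_curve g n (\<Delta>, w, ?l)"
      using s u(1) by (auto simp: extended_tropical_curve_def intro: PiE_mem)
    have "curve_iso (curve_at (\<Delta>, w) u) (\<Delta>, w, ?l)" by (rule curve_iso_curve_at_positive[OF e]) simp
    then have "curve_iso (curve_of (\<Gamma>, ?f u)) (\<Delta>, w, ?l)" by (rule curve_of_iso_trans[OF \<Gamma> fp(2)])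
    then show "x \<in> stratum g n i" unfolding i u(2) proj_in_stratum_iff[OF fp(1)] using e by blast
  qed
  moreover have "connectedin (closed_cell (\<Delta>, w)) ?P"
    unfolding closed_cell_eq connectedin_PiE
    using connectedin_ext_halfline[of pos_ext] pn by (auto simp: pos_ext_def)
  moreover have "continuous_map (closed_cell (\<Delta>, w)) (Mbar g n) (\<lambda>u. proj g n (\<Gamma>, ?f u))"
  proof -
    have "continuous_map (closed_cell (\<Delta>, w)) (closed_cell (\<Gamma>, \<lambda>_. 0)) ?f"
      by (rule continuous_map_face_map) (rule bij_betw_apply[OF contraction_edges[OF c g]])
    from continuous_map_compose[OF this continuous_map_proj_cell[OF \<Gamma>]] show ?thesis by (simp add: o_def)
  qed
  ultimately show ?thesis using connectedin_continuous_map_image by metis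
qed

section \<open>Connectedness through codimension one\<close>

definition codim_one_points :: "(nat, nat) graph \<Rightarrow> (nat set \<Rightarrow> real option) set" where
  "codim_one_points \<Gamma> = {t \<in> cell \<Gamma>. card (zero_edges \<Gamma> t) \<le> 1}"

text \<open>For each edge, the points where only this edge may vanish form a connected product, and
  all these products contain the point with every length one.\<close>

lemma connectedin_codim_one_points:
  assumes g: "leg_graph n \<Gamma>"
  shows "connectedin (closed_cell (\<Gamma>, w)) (codim_one_points \<Gamma>)"
proof -
  let ?P = "\<lambda>Z. PiE (edges \<Gamma>) (\<lambda>e. if e \<in> Z then nonneg_ext else pos_ext)"
  have fin: "finite (edges \<Gamma>)" by (rule finite_edges[OF g])
  have pn: "pos_ext \<subseteq> nonneg_ext" by (auto simp: pos_ext_def nonneg_ext_def)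
  have "codim_one_points \<Gamma> = \<Union>(insert (?P {}) ((\<lambda>e. ?P {e}) ` edges \<Gamma>))"
  proof (intro equalityI subsetI)
    fix t assume t: "t \<in> codim_one_points \<Gamma>"
    then have tc: "t \<in> cell \<Gamma>" and "card (zero_edges \<Gamma> t) \<le> 1" by (auto simp: codim_one_points_def)
    moreover have "finite (zero_edges \<Gamma> t)" using fin by (simp add: zero_edges_def)
    ultimately have eq: "\<forall>e\<in>zero_edges \<Gamma> t. \<forall>e'\<in>zero_edges \<Gamma> t. e = e'" using card_le_Suc0_iff_eq[of "zero_edges \<Gamma> t"] by simp
    have pos: "t e \<in> pos_ext" if "e \<in> edges \<Gamma>" "e \<notin> zero_edges \<Gamma> t" for e
      using PiE_mem[OF tc that(1)] that by (cases "t e") (auto simp: zero_edges_def order_less_le)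
    show "t \<in> \<Union>(insert (?P {}) ((\<lambda>e. ?P {e}) ` edges \<Gamma>))"
    proof (cases "zero_edges \<Gamma> t = {}")
      case True
      then have "t \<in> ?P {}" using tc pos by (auto simp: PiE_iff)
      then show ?thesis by blast
    next
      case False
      then obtain e where e: "e \<in> zero_edges \<Gamma> t" by blast
      then have "t \<in> ?P {e}" using tc pos eq by (auto simp: PiE_iff)
      moreover have "e \<in> edges \<Gamma>" using e by (simp add: zero_edges_def)
      ultimately show ?thesis by blast
    qed
  next
    fix t assume "t \<in> \<Union>(insert (?P {}) ((\<lambda>e. ?P {e}) ` edges \<Gamma>))"
    then obtain Z where Z: "t \<in> ?P Z" "Z = {} \<or> (\<exists>e. Z = {e})" by blast
    have "t e \<in> nonneg_ext" if "e \<in> edges \<Gamma>" for e using PiE_mem[OF Z(1) that] pn by (auto split: if_splits)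
    then have "t \<in> cell \<Gamma>" using Z(1) by (auto simp: PiE_iff)
    moreover have "zero_edges \<Gamma> t \<subseteq> Z"
    proof
      fix e assume e: "e \<in> zero_edges \<Gamma> t"
      then have "e \<in> edges \<Gamma>" "t e = Some 0" by (auto simp: zero_edges_def)
      then show "e \<in> Z" using PiE_mem[OF Z(1), of e] by (auto split: if_splits)
    qed
    then have "card (zero_edges \<Gamma> t) \<le> card Z" using Z(2) by (intro card_mono) auto
    moreover have "card Z \<le> 1" using Z(2) by auto
    ultimately show "t \<in> codim_one_points \<Gamma>" by (simp add: codim_one_points_def)
  qed
  moreover have "connectedin (closed_cell (\<Gamma>, w)) (\<Union>(insert (?P {}) ((\<lambda>e. ?P {e}) ` edges \<Gamma>)))"
  proof (rule connectedin_Union)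
    have P: "connectedin (closed_cell (\<Gamma>, w)) (?P Z)" for Z
      unfolding closed_cell_eq connectedin_PiE
      using connectedin_ext_halfline[of pos_ext] connectedin_ext_halfline[of nonneg_ext] pn
      by (auto simp: pos_ext_def nonneg_ext_def)
    show "connectedin (closed_cell (\<Gamma>, w)) S" if "S \<in> insert (?P {}) ((\<lambda>e. ?P {e}) ` edges \<Gamma>)" for S
      using that P by (elim insertE imageE) (simp_all only:)
    have "(\<lambda>e\<in>edges \<Gamma>. Some 1) \<in> ?P Z" for Z by auto
    then have "(\<lambda>e\<in>edges \<Gamma>. Some 1) \<in> \<Inter>(insert (?P {}) ((\<lambda>e. ?P {e}) ` edges \<Gamma>))" by blast
    then show "\<Inter>(insert (?P {}) ((\<lambda>e. ?P {e}) ` edges \<Gamma>)) \<noteq> {}" by blast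
  qed
  ultimately show ?thesis by (simp only:)
qed

definition codim_one_cell :: "nat \<Rightarrow> nat \<Rightarrow> (nat, nat) graph \<Rightarrow> moduli_point set" where
  "codim_one_cell g n \<Gamma> = (\<lambda>t. proj g n (\<Gamma>, t)) ` codim_one_points \<Gamma>"

lemma connectedin_codim_one_cell:
  assumes "\<Gamma> \<in> three_regular_graphs g n"
  shows "connectedin (Mbar g n) (codim_one_cell g n \<Gamma>)"
  unfolding codim_one_cell_def
  using connectedin_continuous_map_image[OF continuous_map_proj_cell[OF assms]
      connectedin_codim_one_points[OF trivalent_leg_graph[OF three_regular_graphs(1)[OF assms]]]] .

lemma card_edges_stratum:
  assumes p: "(\<Gamma>, t) \<in> topspace (cells g n)" and i: "curve_iso (curve_of (\<Gamma>, t)) (\<Delta>, w, l)"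
  shows "card (edges \<Gamma>) = card (edges \<Delta>) + card (zero_edges \<Gamma> t)"
proof -
  note g = trivalent_leg_graph[OF three_regular_graphs(1)[OF conjunct1[OF p[unfolded topspace_cells]]]]
  obtain \<sigma> \<psi> where "contraction (\<Gamma>, \<lambda>_. 0) (\<Delta>, w) (zero_edges \<Gamma> t) \<sigma> \<psi>"
    using i unfolding curve_of_def case_prod_conv curve_iso_curve_at_iff[OF g] by blast
  then show ?thesis using card_edges_contraction g by blast
qed

lemma card_edges_representative:
  assumes "\<Gamma> \<in> three_regular_graphs g n" "g \<ge> 2"
  shows "card (edges \<Gamma>) = 3 * g - 3 + n"
  using card_edges_trivalent[OF three_regular_graphs(1)[OF assms(1)]] assms(2) by linarith

text \<open>All cells have \<open>3g - 3 + n\<close> edges, so the number of zero lengths of a point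
  is the codimension of its stratum. With \<open>g \<ge> 2\<close> the subtraction of naturals is
  exact.\<close>

lemma codim_one_strata:
  assumes g2: "g \<ge> 2"
  shows "(\<Union>i\<in>{i \<in> stable_graphs g n. stratum_dim i + 1 \<ge> 3 * g - 3 + n}. stratum g n i) =
    (\<Union>\<Gamma>\<in>three_regular_graphs g n. codim_one_cell g n \<Gamma>)" (is "?L = ?R")
proof (intro equalityI subsetI)
  fix x assume "x \<in> ?L"
  then obtain \<Delta> w where D: "(\<Delta>, w) \<in> stable_graphs g n" "card (edges \<Delta>) + 1 \<ge> 3 * g - 3 + n" "x \<in> stratum g n (\<Delta>, w)"
    by (auto simp: stratum_dim_def)
  obtain \<Gamma> t where p: "(\<Gamma>, t) \<in> topspace (cells g n)" "x = proj g n (\<Gamma>, t)"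
    using D(3) by (auto simp: stratum_def topspace_Mbar)
  obtain l where "curve_iso (curve_of (\<Gamma>, t)) (\<Delta>, w, l)"
    using D(3) unfolding p(2) proj_in_stratum_iff[OF p(1)] by blast
  note card_edges_stratum[OF p(1) this]
  moreover have \<Gamma>: "\<Gamma> \<in> three_regular_graphs g n" "t \<in> cell \<Gamma>" using p(1) by (auto simp: topspace_cells)
  ultimately have "card (zero_edges \<Gamma> t) \<le> 1" using card_edges_representative[OF \<Gamma>(1) g2] D(2) by linarith
  then show "x \<in> ?R" using \<Gamma> by (auto simp: codim_one_cell_def codim_one_points_def p(2))
next
  fix x assume "x \<in> ?R"
  then obtain \<Gamma> t where \<Gamma>: "\<Gamma> \<in> three_regular_graphs g n" and t: "t \<in> cell \<Gamma>" "card (zero_edges \<Gamma> t) \<le> 1"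
    and x: "x = proj g n (\<Gamma>, t)" by (auto simp: codim_one_cell_def codim_one_points_def)
  have p: "(\<Gamma>, t) \<in> topspace (cells g n)" using \<Gamma> t by (simp add: topspace_cells)
  obtain \<Delta> w l where D: "(\<Delta>, w) \<in> stable_graphs g n" "extended_tropical_curve g n (\<Delta>, w, l)"
    "curve_iso (curve_of (\<Gamma>, t)) (\<Delta>, w, l)" using exists_stratum[OF p] by blast
  have "x \<in> stratum g n (\<Delta>, w)" unfolding x proj_in_stratum_iff[OF p] using D by blast
  moreover have "stratum_dim (\<Delta>, w) + 1 \<ge> 3 * g - 3 + n"
    using card_edges_stratum[OF p D(3)] card_edges_representative[OF \<Gamma> g2] t(2) by (simp add: stratum_dim_def)
  ultimately show "x \<in> ?L" using D(1) by blast
qed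

text \<open>The curve on \<open>\<Delta>\<close> with all edge lengths one lies in both sets, since
  the count of edges leaves at most one edge to be contracted in each graph.\<close>

lemma codim_one_cells_meet:
  assumes A: "\<Gamma> \<in> three_regular_graphs g n" "contracts_to (\<Gamma>, \<lambda>_. 0) (\<Delta>, w)"
    and B: "\<Gamma>' \<in> three_regular_graphs g n" "contracts_to (\<Gamma>', \<lambda>_. 0) (\<Delta>, w)"
    and card: "3 * int g - 3 + int n \<le> int (card (edges \<Delta>)) + 1"
  shows "codim_one_cell g n \<Gamma> \<inter> codim_one_cell g n \<Gamma>' \<noteq> {}"
proof -
  let ?u = "\<lambda>e\<in>edges \<Delta>. Some (1 :: real)"
  have u: "?u \<in> cell \<Delta>" by auto
  have pt: "\<exists>t. (G, t) \<in> topspace (cells g n) \<and> t \<in> codim_one_points G \<and> curve_iso (curve_of (G, t)) (curve_at (\<Delta>, w) ?u)"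
    if G: "G \<in> three_regular_graphs g n" and c: "contracts_to (G, \<lambda>_. 0) (\<Delta>, w)" for G
  proof -
    note tr = three_regular_graphs(1)[OF G]
    note g = trivalent_leg_graph[OF tr]
    obtain S \<sigma> \<psi> where S: "contraction (G, \<lambda>_. 0) (\<Delta>, w) S \<sigma> \<psi>" using c unfolding contracts_to_def by blast
    note fp = face_map_point[OF G S u]
    have E: "\<psi> ` e \<in> edges \<Delta>" if "e \<in> edges G - S" for e
      using contraction_edges[OF S g] that by (rule bij_betw_apply)
    have "zero_edges G (face_map (edges G) S ((`) \<psi>) ?u) \<subseteq> S"
      using E by (auto simp: zero_edges_def face_map_def)
    moreover have "finite S" using contractionD(1)[OF S] finite_edges[OF g] by (rule finite_subset)
    ultimately have "card (zero_edges G (face_map (edges G) S ((`) \<psi>) ?u)) \<le> card S" by (intro card_mono)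
    moreover have "card S \<le> 1"
      using card_edges_contraction[OF S g] card_edges_trivalent[OF tr] card by linarith
    ultimately have "face_map (edges G) S ((`) \<psi>) ?u \<in> codim_one_points G"
      using fp(1) by (simp add: codim_one_points_def topspace_cells)
    then show ?thesis using fp by blast
  qed
  obtain s where s: "(\<Gamma>, s) \<in> topspace (cells g n)" "s \<in> codim_one_points \<Gamma>"
    "curve_iso (curve_of (\<Gamma>, s)) (curve_at (\<Delta>, w) ?u)" using pt[OF A] by blast
  obtain t where t: "(\<Gamma>', t) \<in> topspace (cells g n)" "t \<in> codim_one_points \<Gamma>'"
    "curve_iso (curve_of (\<Gamma>', t)) (curve_at (\<Delta>, w) ?u)" using pt[OF B] by blast
  have "curve_iso (curve_of (\<Gamma>, s)) (curve_of (\<Gamma>', t))"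
    by (rule curve_of_iso_trans[OF A(1) s(3) curve_of_iso_sym[OF B(1) t(3)]])
  then have "proj g n (\<Gamma>, s) = proj g n (\<Gamma>', t)" using proj_eq_iff[OF s(1) t(1)] by blast
  then have "proj g n (\<Gamma>, s) \<in> codim_one_cell g n \<Gamma> \<inter> codim_one_cell g n \<Gamma>'"
    using s(2) t(2) by (auto simp: codim_one_cell_def)
  then show ?thesis by blast
qed

lemma connectedin_codim_one:
  "connectedin (Mbar g n) (\<Union>\<Gamma>\<in>three_regular_graphs g n. codim_one_cell g n \<Gamma>)"
\<comment> \<open>Without 3-regular graphs the union is empty, hence connected; otherwise one cell
  serves as a base point.\<close>
proof (cases "three_regular_graphs g n = {}")
  case False
  let ?T = "three_regular_graphs g n" and ?Y = "codim_one_cell g n"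
  let ?U = "\<Union>\<Gamma>\<in>?T. ?Y \<Gamma>"
  obtain \<Gamma>0 where \<Gamma>0: "\<Gamma>0 \<in> ?T" using False by blast
  have ne: "?Y \<Gamma> \<noteq> {}" if "\<Gamma> \<in> ?T" for \<Gamma>
  proof -
    have "(\<lambda>e\<in>edges \<Gamma>. Some 1) \<in> codim_one_points \<Gamma>"
      by (auto simp: codim_one_points_def zero_edges_def cong: conj_cong)
    then show ?thesis by (auto simp: codim_one_cell_def)
  qed
  \<comment> \<open>A chain of flips leaves the chosen representatives, so the induction speaks of
    the representative isomorphic to the current graph.\<close>
  have step: "\<forall>\<Gamma>\<in>?T. graph_iso B \<Gamma> \<longrightarrow> (\<exists>Z. connectedin (Mbar g n) Z \<and> ?Y \<Gamma>0 \<subseteq> Z \<and> ?Y \<Gamma> \<subseteq> Z \<and> Z \<subseteq> ?U)"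
    if "(flip g n)\<^sup>*\<^sup>* \<Gamma>0 B" for B
    using that
  proof (induction rule: rtranclp_induct)
    case base
    show ?case
    proof (intro ballI impI)
      fix \<Gamma> assume \<Gamma>: "\<Gamma> \<in> ?T" "graph_iso \<Gamma>0 \<Gamma>"
      then have "\<Gamma>0 = \<Gamma>" using three_regular_graphs(3)[OF \<Gamma>0] by blast
      then show "\<exists>Z. connectedin (Mbar g n) Z \<and> ?Y \<Gamma>0 \<subseteq> Z \<and> ?Y \<Gamma> \<subseteq> Z \<and> Z \<subseteq> ?U"
        using connectedin_codim_one_cell[OF \<Gamma>0] \<Gamma>0 by (intro exI[of _ "?Y \<Gamma>0"]) auto
    qed
  next
    case (step B C)
    show ?case
    proof (intro ballI impI)
      fix \<Gamma> assume \<Gamma>: "\<Gamma> \<in> ?T" "graph_iso C \<Gamma>"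
      obtain \<Delta> :: "(nat, nat) graph" and w where f: "trivalent g n B" "trivalent g n C"
        "card (edges B) \<le> card (edges \<Delta>) + 1" "contracts_to (B, \<lambda>_. 0) (\<Delta>, w)" "contracts_to (C, \<lambda>_. 0) (\<Delta>, w)"
        using step.hyps(2) unfolding flip_def by blast
      obtain \<Gamma>' where \<Gamma>': "\<Gamma>' \<in> ?T" "graph_iso B \<Gamma>'" using three_regular_graphs(2)[OF f(1)] by blast
      obtain Z where Z: "connectedin (Mbar g n) Z" "?Y \<Gamma>0 \<subseteq> Z" "?Y \<Gamma>' \<subseteq> Z" "Z \<subseteq> ?U"
        using step.IH \<Gamma>' by blast
      have "?Y \<Gamma>' \<inter> ?Y \<Gamma> \<noteq> {}"
        by (rule codim_one_cells_meet[OF \<Gamma>'(1) contracts_to_representative[OF f(1) \<Gamma>'(2) f(4)]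
              \<Gamma>(1) contracts_to_representative[OF f(2) \<Gamma>(2) f(5)]])
          (use f(3) card_edges_trivalent[OF f(1)] in linarith)
      then have "Z \<inter> ?Y \<Gamma> \<noteq> {}" using Z(3) by blast
      then have "connectedin (Mbar g n) (Z \<union> ?Y \<Gamma>)"
        using Z(1) connectedin_codim_one_cell[OF \<Gamma>(1)] by (intro connectedin_Un)
      then show "\<exists>Z. connectedin (Mbar g n) Z \<and> ?Y \<Gamma>0 \<subseteq> Z \<and> ?Y \<Gamma> \<subseteq> Z \<and> Z \<subseteq> ?U"
        using Z \<Gamma>(1) by (intro exI[of _ "Z \<union> ?Y \<Gamma>"]) auto
    qed
  qed
  have "\<forall>\<Gamma>\<in>?T. \<exists>Z. connectedin (Mbar g n) Z \<and> ?Y \<Gamma>0 \<subseteq> Z \<and> ?Y \<Gamma> \<subseteq> Z \<and> Z \<subseteq> ?U"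
  proof
    fix \<Gamma> assume \<Gamma>: "\<Gamma> \<in> ?T"
    have "graph_iso \<Gamma> \<Gamma>" unfolding graph_iso_iff_wgraph_iso by (rule wgraph_iso_refl)
    then show "\<exists>Z. connectedin (Mbar g n) Z \<and> ?Y \<Gamma>0 \<subseteq> Z \<and> ?Y \<Gamma> \<subseteq> Z \<and> Z \<subseteq> ?U"
      using step[OF flips_connected[OF three_regular_graphs(1)[OF \<Gamma>0] three_regular_graphs(1)[OF \<Gamma>]]] \<Gamma> by blast
  qed
  from bchoice[OF this] obtain Z where
    Z: "\<forall>\<Gamma>\<in>?T. connectedin (Mbar g n) (Z \<Gamma>) \<and> ?Y \<Gamma>0 \<subseteq> Z \<Gamma> \<and> ?Y \<Gamma> \<subseteq> Z \<Gamma> \<and> Z \<Gamma> \<subseteq> ?U" ..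
  \<comment> \<open>All these connected sets contain the nonempty base set of
    \<open>\<Gamma>0\<close>.\<close>
  have "connectedin (Mbar g n) (\<Union>(Z ` ?T))"
  proof (rule connectedin_Union)
    obtain y where "y \<in> ?Y \<Gamma>0" using ne[OF \<Gamma>0] by blast
    then have "y \<in> \<Inter>(Z ` ?T)" using Z by blast
    then show "\<Inter>(Z ` ?T) \<noteq> {}" by blast
  qed (use Z in blast)
  moreover have "\<Union>(Z ` ?T) = ?U" using Z by blast
  ultimately show ?thesis by simp
qed simp

section \<open>Pure dimension\<close>

text \<open>An automorphism of a graph preserving pairwise distinct edge lengths fixes every edge, so it acts
  trivially on the cell: near such curves the moduli space is even a manifold, and the trivial group
  serves in the orbifold charts.\<close>

definition generic_points :: "('v, 'h) graph \<Rightarrow> ('h set \<Rightarrow> real option) set" where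
  "generic_points \<Gamma> = {t \<in> cell \<Gamma>. inj_on t (edges \<Gamma>) \<and> (\<forall>e\<in>edges \<Gamma>. \<exists>x>0. t e = Some x)}"

text \<open>All lengths in the box are finite by the use of \<open>Some\<close>; such boxes become
  the orbifold charts.\<close>

definition open_box :: "('v, 'h) graph \<Rightarrow> ('h set \<Rightarrow> real) \<Rightarrow> real \<Rightarrow> ('h set \<Rightarrow> real option) set" where
  "open_box \<Gamma> x \<delta> = (\<Pi>\<^sub>E e\<in>edges \<Gamma>. Some ` {x e - \<delta><..<x e + \<delta>})"

lemma openin_ext_halfline_interval:
  assumes "0 \<le> a"
  shows "openin ext_halfline (Some ` {a<..<b})"
proof -
  have "openin (Alexandroff_compactification euclideanreal) (Some ` {a<..<b})" by simp
  moreover have "Some ` {a<..<b} = nonneg_ext \<inter> Some ` {a<..<b}" using assms by auto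
  ultimately show ?thesis unfolding ext_halfline_def by (metis openin_subtopology_Int2)
qed

lemma finite_positive_lower_bound:
  assumes "finite S" "\<And>y. y \<in> S \<Longrightarrow> (0 :: real) < y"
  shows "\<exists>\<delta>>0. \<forall>y\<in>S. \<delta> \<le> y"
  \<comment> \<open>The 1 keeps the minimum defined when \<open>S\<close> is empty.\<close>
  using assms by (intro exI[of _ "Min (insert 1 S)"]) auto

lemma generic_box:
  assumes g: "leg_graph n \<Gamma>" and t: "t \<in> generic_points \<Gamma>"
  shows "\<exists>x \<delta>. t \<in> open_box \<Gamma> x \<delta> \<and> (\<forall>e\<in>edges \<Gamma>. 0 \<le> x e - \<delta>) \<and> open_box \<Gamma> x \<delta> \<subseteq> generic_points \<Gamma> \<and>
    (\<forall>e\<in>edges \<Gamma>. \<forall>e'\<in>edges \<Gamma>. e \<noteq> e' \<longrightarrow> {x e - \<delta><..<x e + \<delta>} \<inter> {x e' - \<delta><..<x e' + \<delta>} = {})"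
proof -
  let ?E = "edges \<Gamma>"
  have fin: "finite ?E" by (rule finite_edges[OF g])
  define x where "x e = the (t e)" for e
  have tc: "t \<in> cell \<Gamma>" and inj: "inj_on t ?E" and x: "\<And>e. e \<in> ?E \<Longrightarrow> t e = Some (x e) \<and> 0 < x e"
    using t by (auto simp: generic_points_def x_def)
  have ne: "x e \<noteq> x e'" if "e \<in> ?E" "e' \<in> ?E" "e \<noteq> e'" for e e'
    using inj_onD[OF inj] x that by metis
  \<comment> \<open>The coordinates bound the radius so that the box stays among positive lengths;
    the half-distances keep the intervals of different edges apart.\<close>
  let ?S = "x ` ?E \<union> (\<lambda>(e, e'). \<bar>x e - x e'\<bar> / 2) ` {(e, e') \<in> ?E \<times> ?E. e \<noteq> e'}"
  have "finite {(e, e') \<in> ?E \<times> ?E. e \<noteq> e'}" by (rule finite_subset[of _ "?E \<times> ?E"]) (auto simp: fin)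
  then have "finite ?S" using fin by (intro finite_UnI finite_imageI)
  moreover have "0 < y" if "y \<in> ?S" for y
    using that
  proof (elim UnE imageE)
    fix p assume "p \<in> {(e, e') \<in> ?E \<times> ?E. e \<noteq> e'}" and y: "y = (case p of (e, e') \<Rightarrow> \<bar>x e - x e'\<bar> / 2)"
    then obtain e e' where "p = (e, e')" "e \<in> ?E" "e' \<in> ?E" "e \<noteq> e'" by blast
    then show "0 < y" using ne[of e e'] y by simp
  qed (use x in simp)
  ultimately obtain \<delta> where \<delta>: "\<delta> > 0" "\<forall>y\<in>?S. \<delta> \<le> y" using finite_positive_lower_bound[of ?S] by blast
  have d1: "0 \<le> x e - \<delta>" if "e \<in> ?E" for e using \<delta>(2) that by auto
  have d2: "\<delta> \<le> \<bar>x e - x e'\<bar> / 2" if "e \<in> ?E" "e' \<in> ?E" "e \<noteq> e'" for e e'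
  proof -
    have "\<bar>x e - x e'\<bar> / 2 \<in> (\<lambda>(e, e'). \<bar>x e - x e'\<bar> / 2) ` {(e, e') \<in> ?E \<times> ?E. e \<noteq> e'}"
      by (rule image_eqI[of _ _ "(e, e')"]) (use that in auto)
    then show ?thesis using \<delta>(2) by blast
  qed
  have disj: "{x e - \<delta><..<x e + \<delta>} \<inter> {x e' - \<delta><..<x e' + \<delta>} = {}" if "e \<in> ?E" "e' \<in> ?E" "e \<noteq> e'" for e e'
    using d2[OF that] by auto
  have "open_box \<Gamma> x \<delta> \<subseteq> generic_points \<Gamma>"
  proof
    fix s assume s: "s \<in> open_box \<Gamma> x \<delta>"
    have se: "\<exists>y\<in>{x e - \<delta><..<x e + \<delta>}. s e = Some y" if "e \<in> ?E" for e
      using s that by (auto simp: open_box_def dest: PiE_mem)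
    have "s e \<noteq> s e'" if "e \<in> ?E" "e' \<in> ?E" "e \<noteq> e'" for e e'
      using se[OF that(1)] se[OF that(2)] disj[OF that] by auto
    then have "inj_on s ?E" by (auto simp: inj_on_def)
    moreover have p: "\<exists>y>0. s e = Some y" if "e \<in> ?E" for e using se[OF that] d1[OF that] by fastforce
    moreover have "s \<in> cell \<Gamma>"
      unfolding PiE_iff
    proof
      show "\<forall>e\<in>?E. s e \<in> nonneg_ext" using p by fastforce
      show "s \<in> extensional ?E" using s by (auto simp: open_box_def PiE_def)
    qed
    ultimately show "s \<in> generic_points \<Gamma>" by (simp add: generic_points_def)
  qed
  moreover have "t \<in> open_box \<Gamma> x \<delta>"
    using tc x \<delta>(1) by (auto simp: open_box_def PiE_iff)
  ultimately show ?thesis using d1 disj by blast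
qed

lemma openin_open_box:
  assumes g: "leg_graph n \<Gamma>" and x: "\<And>e. e \<in> edges \<Gamma> \<Longrightarrow> 0 \<le> x e - \<delta>"
  shows "openin (closed_cell (\<Gamma>, w)) (open_box \<Gamma> x \<delta>)"
  unfolding closed_cell_eq open_box_def openin_PiE[OF finite_edges[OF g]]
  using openin_ext_halfline_interval x by blast

lemma openin_generic_points:
  assumes g: "leg_graph n \<Gamma>"
  shows "openin (closed_cell (\<Gamma>, w)) (generic_points \<Gamma>)"
proof (subst openin_subopen, intro ballI)
  fix t assume t: "t \<in> generic_points \<Gamma>"
  obtain x \<delta> where B: "t \<in> open_box \<Gamma> x \<delta>" "\<forall>e\<in>edges \<Gamma>. 0 \<le> x e - \<delta>" "open_box \<Gamma> x \<delta> \<subseteq> generic_points \<Gamma>"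
    using generic_box[OF g t] by (elim exE conjE)
  have "openin (closed_cell (\<Gamma>, w)) (open_box \<Gamma> x \<delta>)" by (rule openin_open_box[OF g]) (rule bspec[OF B(2)])
  then show "\<exists>T. openin (closed_cell (\<Gamma>, w)) T \<and> t \<in> T \<and> T \<subseteq> generic_points \<Gamma>"
    using B(1,3) by (intro exI conjI)
qed

lemma zero_edges_generic: "t \<in> generic_points \<Gamma> \<Longrightarrow> zero_edges \<Gamma> t = {}"
  by (force simp: generic_points_def zero_edges_def)

lemma exists_injective_choice:
  assumes "finite E" "\<And>e. e \<in> E \<Longrightarrow> infinite (A e)"
  shows "\<exists>f. inj_on f E \<and> (\<forall>e\<in>E. f e \<in> A e)"
  using assms
proof (induction E rule: finite_induct)
  case (insert e E)
  then obtain f where f: "inj_on f E" "\<forall>e\<in>E. f e \<in> A e" by blast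
  have "infinite (A e - f ` E)" using insert.prems insert.hyps(1) by (simp add: Diff_infinite_finite)
  then obtain y where y: "y \<in> A e - f ` E" by (metis finite.emptyI ex_in_conv)
  have "inj_on (f(e := y)) (insert e E)" using f(1) y insert.hyps(2) by (auto simp: inj_on_def)
  moreover have "\<forall>e'\<in>insert e E. (f(e := y)) e' \<in> A e'" using f(2) y by auto
  ultimately show ?case by blast
qed simp

text \<open>Each side of a basic open box contains infinitely many positive reals, so the finitely
  many edges can be given distinct positive finite lengths inside it.\<close>

lemma generic_points_dense:
  assumes g: "leg_graph n \<Gamma>" and W: "openin (closed_cell (\<Gamma>, w)) W" and t: "t \<in> W"
  shows "W \<inter> generic_points \<Gamma> \<noteq> {}"
proof -
  let ?E = "edges \<Gamma>"
  obtain A where A: "finite {e \<in> ?E. A e \<noteq> topspace ext_halfline}" "\<forall>e\<in>?E. openin ext_halfline (A e)"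
    "t \<in> PiE ?E A" "PiE ?E A \<subseteq> W"
    using W t unfolding closed_cell_eq openin_product_topology_alt by blast
  have "infinite {y. 0 < y \<and> Some y \<in> A e}" if e: "e \<in> ?E" for e
    by (rule infinite_positive_in_open[of _ "t e"]) (use A e in \<open>auto dest: PiE_mem\<close>)
  then obtain f where f: "inj_on f ?E" "\<forall>e\<in>?E. f e \<in> {y. 0 < y \<and> Some y \<in> A e}"
    using exists_injective_choice[OF finite_edges[OF g], of "\<lambda>e. {y. 0 < y \<and> Some y \<in> A e}"] by blast
  let ?s = "\<lambda>e\<in>?E. Some (f e)"
  have "?s \<in> W" using f(2) by (intro subsetD[OF A(4)]) auto
  moreover have "?s \<in> generic_points \<Gamma>"
    using f by (auto simp: generic_points_def inj_on_def order_less_imp_le)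
  ultimately show ?thesis by blast
qed

section \<open>The projection to the moduli space near generic curves\<close>

text \<open>Only \<open>s\<close> is assumed to have no zero length. Both graphs have the same
  number of edges, so nothing is contracted at \<open>t\<close> either, and the isomorphism of
  curves is one of the graphs \<open>\<Gamma>\<close> and \<open>\<Delta>\<close>
  themselves.\<close>

lemma iso_of_positive_points:
  assumes \<Gamma>: "\<Gamma> \<in> three_regular_graphs g n" and \<Delta>: "\<Delta> \<in> three_regular_graphs g n"
    and z: "zero_edges \<Gamma> s = {}" and i: "curve_iso (curve_of (\<Gamma>, s)) (curve_of (\<Delta>, t))"
  shows "\<exists>\<sigma> \<psi>. contraction (\<Gamma>, \<lambda>_. 0) (\<Delta>, \<lambda>_. 0) {} \<sigma> \<psi> \<and> (\<forall>e\<in>edges \<Gamma>. s e = t (\<psi> ` e))"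
proof -
  note g\<Gamma> = trivalent_leg_graph[OF three_regular_graphs(1)[OF \<Gamma>]]
  note g\<Delta> = trivalent_leg_graph[OF three_regular_graphs(1)[OF \<Delta>]]
  let ?T = "zero_edges \<Delta> t"
  obtain \<sigma> \<psi> where c: "contraction (\<Gamma>, \<lambda>_. 0) (contract \<Delta> ?T, contract_weight \<Delta> (\<lambda>_. 0) ?T) {} \<sigma> \<psi>"
    and l: "\<forall>e\<in>edges \<Gamma>. (if \<psi> ` e \<in> edges \<Delta> - ?T then t (\<psi> ` e) else None) = s e"
    using i unfolding curve_of_def case_prod_conv curve_at_eq[of \<Delta>] curve_iso_curve_at_iff[OF g\<Gamma>] z Diff_empty by blast
  have "card (edges \<Gamma>) = card (edges \<Delta> - ?T)" using card_edges_contraction[OF c g\<Gamma>] by (simp add: edges_contract)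
  moreover have "card (edges \<Gamma>) = card (edges \<Delta>)"
    using card_edges_trivalent[OF three_regular_graphs(1)[OF \<Gamma>]] card_edges_trivalent[OF three_regular_graphs(1)[OF \<Delta>]] by simp
  ultimately have "edges \<Delta> - ?T = edges \<Delta>"
    using finite_edges[OF g\<Delta>] by (intro card_subset_eq) auto
  then have T: "?T = {}" using zero_edges_subset[of \<Delta> t] by blast
  have \<psi>: "\<psi> ` e \<in> edges \<Delta>" if "e \<in> edges \<Gamma>" for e
    using bij_betw_apply[OF contraction_edges[OF c g\<Gamma>], of e] that by (simp add: edges_contract)
  have "contraction (\<Delta>, \<lambda>_. 0) (contract \<Delta> {}, contract_weight \<Delta> (\<lambda>_. 0) {}) {} (component \<Delta> {}) id"
    by (rule contraction_contract[OF g\<Delta>]) simp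
  note b = contraction_iso_sym[OF this g\<Delta>]
  note cb = contraction_comp_iso[OF c[unfolded T] b g\<Gamma>]
  \<comment> \<open>Undoing the contraction of no edges composes with the inverse of the identity,
    which acts as the identity on half-edges.\<close>
  have "(inv_into (halfs \<Delta>) id \<circ> \<psi>) ` e = \<psi> ` e" if e: "e \<in> edges \<Gamma>" for e
  proof -
    have "\<psi> ` e \<subseteq> halfs \<Delta>" using edge_subset_free_halfs[OF g\<Delta>, of "\<psi> ` e" "{}"] \<psi>[OF e] by simp
    then have "inv_into (halfs \<Delta>) id (\<psi> h) = \<psi> h" if "h \<in> e" for h
      using inv_into_f_f[of id "halfs \<Delta>" "\<psi> h"] that by auto
    then show ?thesis by (intro image_cong) simp_all
  qed
  then have "\<forall>e\<in>edges \<Gamma>. s e = t ((inv_into (halfs \<Delta>) id \<circ> \<psi>) ` e)"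
    using l \<psi> by (simp add: T del: o_apply)
  then show ?thesis using cb by blast
qed

text \<open>A point of any cell that maps into the image is isomorphic to a point of
  \<open>W\<close>. As no length in \<open>W\<close> is zero, the two graphs are isomorphic, which
  induces a continuous map of their full cells; the preimage of \<open>W\<close> under it is a
  neighbourhood that still maps into the image.\<close>

lemma openin_proj_image:
  assumes \<Gamma>: "\<Gamma> \<in> three_regular_graphs g n" and W: "openin (closed_cell (\<Gamma>, \<lambda>_. 0)) W"
    and z: "\<And>s. s \<in> W \<Longrightarrow> zero_edges \<Gamma> s = {}"
  shows "openin (Mbar g n) ((\<lambda>s. proj g n (\<Gamma>, s)) ` W)"
proof -
  note g\<Gamma> = trivalent_leg_graph[OF three_regular_graphs(1)[OF \<Gamma>]]
  let ?I = "(\<lambda>s. proj g n (\<Gamma>, s)) ` W"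
  have Wc: "W \<subseteq> cell \<Gamma>" using openin_subset[OF W] by simp
  then have WX: "(\<Gamma>, s) \<in> topspace (cells g n)" if "s \<in> W" for s using that \<Gamma> by (auto simp: topspace_cells)
  have "openin (cells g n) {p \<in> topspace (cells g n). proj g n p \<in> ?I}"
    unfolding openin_cells
  proof (intro conjI ballI Collect_restrict)
    fix \<Delta> assume \<Delta>: "\<Delta> \<in> three_regular_graphs g n"
    show "openin (closed_cell (\<Delta>, \<lambda>_. 0)) {t. (\<Delta>, t) \<in> {p \<in> topspace (cells g n). proj g n p \<in> ?I}}"
    proof (subst openin_subopen, intro ballI)
      fix t assume "t \<in> {t. (\<Delta>, t) \<in> {p \<in> topspace (cells g n). proj g n p \<in> ?I}}"
      then obtain s where t: "(\<Delta>, t) \<in> topspace (cells g n)" and s: "s \<in> W" "proj g n (\<Delta>, t) = proj g n (\<Gamma>, s)" by blast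
      have "curve_iso (curve_of (\<Gamma>, s)) (curve_of (\<Delta>, t))" using proj_eq_iff[OF WX[OF s(1)] t] s(2) by simp
      then obtain \<sigma> \<psi> where c: "contraction (\<Gamma>, \<lambda>_. 0) (\<Delta>, \<lambda>_. 0) {} \<sigma> \<psi>" and l: "\<forall>e\<in>edges \<Gamma>. s e = t (\<psi> ` e)"
        using iso_of_positive_points[OF \<Gamma> \<Delta> z[OF s(1)]] by blast
      let ?f = "face_map (edges \<Gamma>) {} ((`) \<psi>)"
      have E: "\<psi> ` e \<in> edges \<Delta>" if "e \<in> edges \<Gamma> - {}" for e
        using contraction_edges[OF c g\<Gamma>] that by (rule bij_betw_apply)
      have fs: "?f t = s"
        using l subsetD[OF Wc s(1)] by (auto simp: face_map_def fun_eq_iff PiE_iff extensional_def)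
      let ?V = "{u \<in> topspace (closed_cell (\<Delta>, \<lambda>_. 0)). ?f u \<in> W}"
      have "openin (closed_cell (\<Delta>, \<lambda>_. 0)) ?V"
        by (rule openin_continuous_map_preimage[OF continuous_map_face_map[OF E] W])
      moreover have "t \<in> ?V" using t s(1) fs by (simp add: topspace_cells)
      moreover have "?V \<subseteq> {t. (\<Delta>, t) \<in> {p \<in> topspace (cells g n). proj g n p \<in> ?I}}"
      proof
        fix u assume u: "u \<in> ?V"
        then have uX: "(\<Delta>, u) \<in> topspace (cells g n)" and uW: "?f u \<in> W" using \<Delta> by (auto simp: topspace_cells)
        have "curve_iso (curve_of (\<Gamma>, ?f u)) (curve_of (\<Delta>, u))"
          using curve_iso_face_map[OF c g\<Gamma>] by (simp add: curve_of_def)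
        then have "proj g n (\<Gamma>, ?f u) = proj g n (\<Delta>, u)" using proj_eq_iff[OF WX[OF uW] uX] by blast
        then have "proj g n (\<Delta>, u) \<in> ?I" using uW by (metis imageI)
        then show "u \<in> {t. (\<Delta>, t) \<in> {p \<in> topspace (cells g n). proj g n p \<in> ?I}}" using uX by simp
      qed
      ultimately show "\<exists>T. openin (closed_cell (\<Delta>, \<lambda>_. 0)) T \<and> t \<in> T \<and>
          T \<subseteq> {t. (\<Delta>, t) \<in> {p \<in> topspace (cells g n). proj g n p \<in> ?I}}" by blast
    qed
  qed
  moreover have "?I \<subseteq> topspace (Mbar g n)" using WX by (auto simp: topspace_Mbar)
  ultimately show ?thesis using quotient_map_proj[of g n] unfolding quotient_map_def by blast
qed

definition generic_locus :: "nat \<Rightarrow> nat \<Rightarrow> moduli_point set" where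
  "generic_locus g n = (\<Union>\<Gamma>\<in>three_regular_graphs g n. (\<lambda>t. proj g n (\<Gamma>, t)) ` generic_points \<Gamma>)"

lemma openin_generic_locus: "openin (Mbar g n) (generic_locus g n)"
  unfolding generic_locus_def
proof (rule openin_Union)
  fix S assume "S \<in> (\<lambda>\<Gamma>. (\<lambda>t. proj g n (\<Gamma>, t)) ` generic_points \<Gamma>) ` three_regular_graphs g n"
  then obtain \<Gamma> where \<Gamma>: "\<Gamma> \<in> three_regular_graphs g n" "S = (\<lambda>t. proj g n (\<Gamma>, t)) ` generic_points \<Gamma>" by blast
  show "openin (Mbar g n) S"
    unfolding \<Gamma>(2) using openin_generic_points[OF trivalent_leg_graph[OF three_regular_graphs(1)[OF \<Gamma>(1)]]] zero_edges_generic
    by (rule openin_proj_image[OF \<Gamma>(1)])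
qed

text \<open>An open set is pulled back to a cell that meets it, where generic points are
  dense.\<close>

lemma dense_generic_locus: "Mbar g n closure_of generic_locus g n = topspace (Mbar g n)"
  unfolding dense_intersects_open
proof (intro allI impI, elim conjE)
  fix V assume V: "openin (Mbar g n) V" "V \<noteq> {}"
  then obtain x where x: "x \<in> V" "x \<in> topspace (Mbar g n)" using openin_subset by blast
  then obtain \<Gamma> t where p: "(\<Gamma>, t) \<in> topspace (cells g n)" "x = proj g n (\<Gamma>, t)" unfolding topspace_Mbar by auto
  have \<Gamma>: "\<Gamma> \<in> three_regular_graphs g n" "t \<in> cell \<Gamma>" using p(1) by (auto simp: topspace_cells)
  have "openin (closed_cell (\<Gamma>, \<lambda>_. 0)) {t \<in> topspace (closed_cell (\<Gamma>, \<lambda>_. 0)). proj g n (\<Gamma>, t) \<in> V}"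
    by (rule openin_continuous_map_preimage[OF continuous_map_proj_cell[OF \<Gamma>(1)] V(1)])
  moreover have "t \<in> {t \<in> topspace (closed_cell (\<Gamma>, \<lambda>_. 0)). proj g n (\<Gamma>, t) \<in> V}"
    using \<Gamma>(2) x(1) p(2) by simp
  ultimately obtain s where "s \<in> {t \<in> topspace (closed_cell (\<Gamma>, \<lambda>_. 0)). proj g n (\<Gamma>, t) \<in> V} \<inter> generic_points \<Gamma>"
    using generic_points_dense[OF trivalent_leg_graph[OF three_regular_graphs(1)[OF \<Gamma>(1)]]] by blast
  then have "proj g n (\<Gamma>, s) \<in> generic_locus g n \<inter> V" using \<Gamma>(1) by (auto simp: generic_locus_def)
  then show "generic_locus g n \<inter> V \<noteq> {}" by blast
qed

text \<open>Under an isomorphism the length of \<open>e\<close> at \<open>s\<close> is the length of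
  its image at \<open>t\<close>, and so lies in the intervals of both edges. These are disjoint
  unless the image is \<open>e\<close> itself.\<close>

lemma proj_injective_on_box:
  assumes \<Gamma>: "\<Gamma> \<in> three_regular_graphs g n" and B: "open_box \<Gamma> x \<delta> \<subseteq> generic_points \<Gamma>"
    and disj: "\<And>e e'. e \<in> edges \<Gamma> \<Longrightarrow> e' \<in> edges \<Gamma> \<Longrightarrow> e \<noteq> e' \<Longrightarrow>
      {x e - \<delta><..<x e + \<delta>} \<inter> {x e' - \<delta><..<x e' + \<delta>} = {}"
  shows "inj_on (\<lambda>s. proj g n (\<Gamma>, s)) (open_box \<Gamma> x \<delta>)"
proof (rule inj_onI)
  fix s t assume s: "s \<in> open_box \<Gamma> x \<delta>" and t: "t \<in> open_box \<Gamma> x \<delta>" and e: "proj g n (\<Gamma>, s) = proj g n (\<Gamma>, t)"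
  note g = trivalent_leg_graph[OF three_regular_graphs(1)[OF \<Gamma>]]
  have X: "(\<Gamma>, s) \<in> topspace (cells g n)" "(\<Gamma>, t) \<in> topspace (cells g n)"
    using s t B \<Gamma> by (auto simp: topspace_cells generic_points_def)
  have "curve_iso (curve_of (\<Gamma>, s)) (curve_of (\<Gamma>, t))" using proj_eq_iff[OF X] e by blast
  then obtain \<sigma> \<psi> where c: "contraction (\<Gamma>, \<lambda>_. 0) (\<Gamma>, \<lambda>_. 0) {} \<sigma> \<psi>" and l: "\<forall>e\<in>edges \<Gamma>. s e = t (\<psi> ` e)"
    using iso_of_positive_points[OF \<Gamma> \<Gamma> zero_edges_generic[OF subsetD[OF B s]]] by blast
  have st: "s e \<in> Some ` {x e - \<delta><..<x e + \<delta>}" "t e \<in> Some ` {x e - \<delta><..<x e + \<delta>}" if "e \<in> edges \<Gamma>" for e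
    using s t that by (auto simp: open_box_def dest: PiE_mem)
  have "s e = t e" if "e \<in> edges \<Gamma>" for e
  proof -
    have E: "\<psi> ` e \<in> edges \<Gamma>" using bij_betw_apply[OF contraction_edges[OF c g]] that by simp
    have "s e \<in> Some ` {x (\<psi> ` e) - \<delta><..<x (\<psi> ` e) + \<delta>}" using st(2)[OF E] l that by simp
    then have "\<psi> ` e = e" using st(1)[OF that] disj[OF that E] by fastforce
    then show ?thesis using l that by simp
  qed
  then show "s = t" using s t unfolding open_box_def by (rule PiE_ext[rotated 2])
qed

section \<open>Boxes in Euclidean space as orbifold charts\<close>

definition euclidean_box :: "nat \<Rightarrow> (nat \<Rightarrow> real) \<Rightarrow> (nat \<Rightarrow> real) \<Rightarrow> (nat \<Rightarrow> real) set" where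
  "euclidean_box d lo hi = {y. \<forall>i<d. lo i < y i \<and> y i < hi i}"

lemma openin_euclidean_box: "openin (Euclidean_space d) (topspace (Euclidean_space d) \<inter> euclidean_box d lo hi)"
proof -
  \<comment> \<open>Only the first \<open>d\<close> factors are restricted, as openness in an
    infinite product demands.\<close>
  have "openin (powertop_real UNIV) (PiE UNIV (\<lambda>i. if i < d then {lo i<..<hi i} else UNIV))"
    unfolding openin_PiE_gen
  proof (intro disjI2 conjI ballI)
    show "finite {i \<in> UNIV. (if i < d then {lo i<..<hi i} else UNIV) \<noteq> topspace euclideanreal}"
      by (rule finite_subset[of _ "{..<d}"]) auto
  qed auto
  moreover have "topspace (Euclidean_space d) \<inter> euclidean_box d lo hi =
      PiE UNIV (\<lambda>i. if i < d then {lo i<..<hi i} else UNIV) \<inter> {x. \<forall>i\<ge>d. x i = 0}"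
    by (auto simp: topspace_Euclidean_space euclidean_box_def PiE_iff split: if_splits)
  ultimately show ?thesis unfolding Euclidean_space_def openin_subtopology by blast
qed

lemma second_countable_Euclidean_space: "second_countable (Euclidean_space d)"
proof -
  obtain B :: "(nat \<Rightarrow> real) set set" where B: "countable B" "topological_basis B"
    using ex_countable_basis by blast
  have "second_countable (euclidean :: (nat \<Rightarrow> real) topology)"
    unfolding second_countable_def
  proof (intro exI[of _ B] conjI ballI allI impI)
    show "openin euclidean V" if "V \<in> B" for V using topological_basis_open[OF B(2) that] by simp
    show "\<exists>V\<in>B. x \<in> V \<and> V \<subseteq> U" if "openin euclidean U \<and> x \<in> U" for U x
      using topological_basisE[OF B(2), of U x] that by (metis open_openin)
  qed (rule B(1))
  then show ?thesis unfolding Euclidean_space_def euclidean_product_topology[symmetric] by (rule second_countable_subtopology)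
qed

lemma Hausdorff_space_Euclidean_space: "Hausdorff_space (Euclidean_space d)"
  unfolding Euclidean_space_def by (intro Hausdorff_space_subtopology) (simp add: Hausdorff_space_product_topology)

lemma topological_manifold_box:
  "topological_manifold d (subtopology (Euclidean_space d) (euclidean_box d lo hi))"
  unfolding topological_manifold_def
proof (intro conjI ballI)
  let ?M = "subtopology (Euclidean_space d) (euclidean_box d lo hi)"
  show "Hausdorff_space ?M" by (rule Hausdorff_space_subtopology[OF Hausdorff_space_Euclidean_space])
  show "second_countable ?M" by (rule second_countable_subtopology[OF second_countable_Euclidean_space])
  fix x assume x: "x \<in> topspace ?M"
  have "subtopology ?M (topspace ?M) homeomorphic_space subtopology (Euclidean_space d)
      (topspace (Euclidean_space d) \<inter> euclidean_box d lo hi)"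
    unfolding subtopology_topspace subtopology_restrict by (rule homeomorphic_space_refl)
  then show "\<exists>U V. openin ?M U \<and> x \<in> U \<and> openin (Euclidean_space d) V \<and>
      subtopology ?M U homeomorphic_space subtopology (Euclidean_space d) V"
    using x openin_topspace[of ?M] openin_euclidean_box by blast
qed

text \<open>The orbits are singletons, so the map to the orbit space is an injective quotient map
  and hence a homeomorphism.\<close>

lemma orbit_space_trivial_group:
  fixes M :: "(nat \<Rightarrow> real) topology"
  shows "\<exists>(G :: nat monoid) \<phi>. finite (carrier G) \<and> group_action G (topspace M) \<phi> \<and>
    (\<forall>g\<in>carrier G. homeomorphic_map M M (\<phi> g)) \<and> M homeomorphic_space orbit_space G \<phi> M"
proof -
  define G :: "nat monoid" where "G = \<lparr>carrier = {0}, mult = (\<lambda>_ _. 0), one = 0\<rparr>"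
  \<comment> \<open>The identity is restricted because the elements of \<open>BijGroup\<close> are
    extensional functions.\<close>
  let ?\<phi> = "\<lambda>_ :: nat. \<lambda>x\<in>topspace M. x"
  have G: "group G" by (rule groupI) (auto simp: G_def)
  have one: "\<one>\<^bsub>BijGroup (topspace M)\<^esub> = (\<lambda>x\<in>topspace M. x)" by (simp add: BijGroup_def)
  have "?\<phi> \<in> hom G (BijGroup (topspace M))"
    using group.is_monoid[OF group_BijGroup[of "topspace M"]] unfolding one[symmetric]
    by (auto simp: hom_def monoid.one_closed monoid.l_one)
  then have act: "group_action G (topspace M) ?\<phi>"
    using G group_BijGroup by (simp add: group_action_def group_hom_def group_hom_axioms_def)
  have id: "homeomorphic_map M M (?\<phi> h)" for h
    by (rule homeomorphic_map_eq[of M M id]) (simp_all add: homeomorphic_map_id)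
  let ?r = "{(x, y). x \<in> topspace M \<and> y \<in> orbit G ?\<phi> x}"
  have r: "?r `` {x} = {x}" if "x \<in> topspace M" for x using that by (auto simp: orbit_def G_def)
  have "quotient_map M (orbit_space G ?\<phi> M) (\<lambda>x. ?r `` {x})"
    unfolding orbit_space_def by (rule quotient_map_quotient_topology)
  moreover have "inj_on (\<lambda>x. ?r `` {x}) (topspace M)" 
  proof (rule inj_onI)
    fix x y assume "x \<in> topspace M" "y \<in> topspace M" "?r `` {x} = ?r `` {y}"
    then have "{x} = {y}" by (simp only: r)
    then show "x = y" by simp
  qed
  ultimately have "M homeomorphic_space orbit_space G ?\<phi> M"
    unfolding homeomorphic_space homeomorphic_map_def by blast
  moreover have "finite (carrier G)" by (simp add: G_def)
  ultimately show ?thesis using act id by blast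
qed

lemma continuous_map_ext_halfline:
  "continuous_map X ext_halfline f \<Longrightarrow> continuous_map X (Alexandroff_compactification euclideanreal) f"
  unfolding ext_halfline_def by (rule continuous_map_into_fulltopology)

text \<open>On finite values the compactification carries the topology of the reals, as
  \<open>Some\<close> maps open sets to open sets.\<close>

lemma continuous_map_the: "continuous_map (subtopology (Alexandroff_compactification euclideanreal) (range Some)) euclideanreal the"
  unfolding continuous_map_def
proof (intro conjI allI impI)
  fix V :: "real set" assume V: "openin euclideanreal V"
  have "{z \<in> topspace (subtopology (Alexandroff_compactification euclideanreal) (range Some)). the z \<in> V} = Some ` V \<inter> range Some"
    by auto
  then show "openin (subtopology (Alexandroff_compactification euclideanreal) (range Some))
      {z \<in> topspace (subtopology (Alexandroff_compactification euclideanreal) (range Some)). the z \<in> V}"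
    using V by (auto simp: openin_subtopology intro!: exI[of _ "Some ` V"])
qed simp

lemma open_box_homeomorphic:
  assumes g: "leg_graph n \<Gamma>" and b: "bij_betw b {..<d} (edges \<Gamma>)" and x: "\<And>e. e \<in> edges \<Gamma> \<Longrightarrow> 0 \<le> x e - \<delta>"
  shows "subtopology (closed_cell (\<Gamma>, w)) (open_box \<Gamma> x \<delta>) homeomorphic_space
    subtopology (Euclidean_space d) (euclidean_box d (\<lambda>i. x (b i) - \<delta>) (\<lambda>i. x (b i) + \<delta>))"
proof -
  let ?E = "edges \<Gamma>" and ?B = "open_box \<Gamma> x \<delta>" and ?Q = "euclidean_box d (\<lambda>i. x (b i) - \<delta>) (\<lambda>i. x (b i) + \<delta>)"
  let ?C = "subtopology (closed_cell (\<Gamma>, w)) ?B" and ?M = "subtopology (Euclidean_space d) ?Q"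
  \<comment> \<open>Points of \<open>Euclidean_space d\<close> vanish from coordinate
    \<open>d\<close> on.\<close>
  define f where "f s = (\<lambda>i. if i < d then the (s (b i)) else 0 :: real)" for s :: "'b set \<Rightarrow> real option"
  define h where "h y = (\<lambda>e\<in>?E. Some (y (inv_into {..<d} b e) :: real))" for y
  have bi: "b i \<in> ?E" "inv_into {..<d} b (b i) = i" if "i < d" for i
    using bij_betw_apply[OF b] bij_betw_inv_into_left[OF b] that by auto
  have ib: "inv_into {..<d} b e < d" "b (inv_into {..<d} b e) = e" if "e \<in> ?E" for e
    using bij_betw_apply[OF bij_betw_inv_into[OF b] that] bij_betw_inv_into_right[OF b that] by auto
  have BC: "?B \<subseteq> cell \<Gamma>"
    using x by (auto simp: open_box_def intro!: PiE_mono) fastforce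
  have tC: "topspace ?C = ?B" using BC by auto
  have tM: "topspace ?M = {y. (\<forall>i\<ge>d. y i = 0) \<and> (\<forall>i<d. x (b i) - \<delta> < y i \<and> y i < x (b i) + \<delta>)}"
    by (auto simp: topspace_Euclidean_space euclidean_box_def)
  have s: "\<exists>y. s e = Some y \<and> x e - \<delta> < y \<and> y < x e + \<delta>" if "s \<in> ?B" "e \<in> ?E" for s e
    using that by (auto simp: open_box_def dest: PiE_mem)
  have fM: "f t \<in> topspace ?M" if "t \<in> ?B" for t
    unfolding tM f_def using s[OF that bi(1)] by fastforce
  have hB: "h y \<in> ?B" if "y \<in> topspace ?M" for y
    using that ib unfolding tM open_box_def h_def by (auto simp: PiE_iff) (metis greaterThanLessThan_iff image_eqI)
  have "homeomorphic_maps ?C ?M f h"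
    unfolding homeomorphic_maps_def
  proof (intro conjI ballI)
    have "continuous_map ?C euclideanreal (\<lambda>t. f t i)" for i
    proof (cases "i < d")
      case True
      have "continuous_map ?C (Alexandroff_compactification euclideanreal) (\<lambda>t. t (b i))"
        unfolding closed_cell_eq
        by (intro continuous_map_from_subtopology continuous_map_ext_halfline
            continuous_map_product_projection bi(1)[OF True])
      moreover have "(\<lambda>t. t (b i)) ` topspace ?C \<subseteq> range Some" unfolding tC using s[OF _ bi(1)[OF True]] by fastforce
      ultimately have "continuous_map ?C (subtopology (Alexandroff_compactification euclideanreal) (range Some)) (\<lambda>t. t (b i))"
        unfolding continuous_map_in_subtopology by auto
      from continuous_map_compose[OF this continuous_map_the] show ?thesis using True by (simp add: f_def o_def)
    qed (simp add: f_def)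
    then have "continuous_map ?C (powertop_real UNIV) f" unfolding continuous_map_componentwise_UNIV by blast
    then show "continuous_map ?C ?M f"
      using fM unfolding Euclidean_space_def continuous_map_in_subtopology tC tM by (auto simp: euclidean_box_def)
    have "continuous_map ?M ext_halfline (\<lambda>y. h y e)" if e: "e \<in> ?E" for e
    proof -
      have "continuous_map ?M euclideanreal (\<lambda>y. y (inv_into {..<d} b e))"
        unfolding Euclidean_space_def
        by (intro continuous_map_from_subtopology continuous_map_product_projection) simp
      from continuous_map_compose[OF this continuous_map_Some]
      have "continuous_map ?M (Alexandroff_compactification euclideanreal) (\<lambda>y. h y e)" using e by (simp add: h_def o_def)
      moreover have "h y e \<in> nonneg_ext" if "y \<in> topspace ?M" for y
        using PiE_mem[OF subsetD[OF BC hB[OF that]] e] .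
      ultimately show ?thesis unfolding ext_halfline_def continuous_map_in_subtopology by auto
    qed
    then have "continuous_map ?M (closed_cell (\<Gamma>, w)) h"
      unfolding closed_cell_eq continuous_map_componentwise by (auto simp: h_def)
    then show "continuous_map ?M ?C h" using hB unfolding continuous_map_in_subtopology by auto
    show "h (f t) = t" if "t \<in> topspace ?C" for t
    proof (rule PiE_ext[of _ ?E "\<lambda>e. Some ` {x e - \<delta><..<x e + \<delta>}"])
      show "h (f t) \<in> (\<Pi>\<^sub>E e\<in>?E. Some ` {x e - \<delta><..<x e + \<delta>})" using hB[OF fM[OF that[unfolded tC]]] unfolding open_box_def .
      show "t \<in> (\<Pi>\<^sub>E e\<in>?E. Some ` {x e - \<delta><..<x e + \<delta>})" using that[unfolded tC] unfolding open_box_def .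
      fix e assume e: "e \<in> ?E"
      then show "h (f t) e = t e" using s[of t e] that ib[OF e] unfolding tC by (auto simp: h_def f_def)
    qed
    show "f (h y) = y" if "y \<in> topspace ?M" for y
    proof
      fix i show "f (h y) i = y i" using that bi[of i] unfolding tM by (simp add: f_def h_def)
    qed
  qed
  then show ?thesis by (rule homeomorphic_maps_imp_homeomorphic_space)
qed

text \<open>A box around a generic point projects injectively and openly, so its image is an open
  set homeomorphic to the box; enumerating the edges identifies it with a box in Euclidean
  space.\<close>

lemma orbifold_generic_locus:
  assumes g2: "g \<ge> 2"
  shows "orbifold (3 * g - 3 + n) (subtopology (Mbar g n) (generic_locus g n))"
  unfolding orbifold_def
proof
  let ?d = "3 * g - 3 + n" and ?X = "subtopology (Mbar g n) (generic_locus g n)"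
  fix y assume "y \<in> topspace ?X"
  then obtain \<Gamma> t where \<Gamma>: "\<Gamma> \<in> three_regular_graphs g n" and t: "t \<in> generic_points \<Gamma>" and y: "y = proj g n (\<Gamma>, t)"
    by (auto simp: generic_locus_def)
  note gr = trivalent_leg_graph[OF three_regular_graphs(1)[OF \<Gamma>]]
  obtain x \<delta> where B: "t \<in> open_box \<Gamma> x \<delta>" "\<forall>e\<in>edges \<Gamma>. 0 \<le> x e - \<delta>" "open_box \<Gamma> x \<delta> \<subseteq> generic_points \<Gamma>"
    "\<forall>e\<in>edges \<Gamma>. \<forall>e'\<in>edges \<Gamma>. e \<noteq> e' \<longrightarrow> {x e - \<delta><..<x e + \<delta>} \<inter> {x e' - \<delta><..<x e' + \<delta>} = {}"
    using generic_box[OF gr t] by blast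
  let ?B = "open_box \<Gamma> x \<delta>" and ?p = "\<lambda>s. proj g n (\<Gamma>, s)"
  let ?U = "?p ` ?B" and ?C = "subtopology (closed_cell (\<Gamma>, \<lambda>_. 0)) (open_box \<Gamma> x \<delta>)"
  have Bo: "openin (closed_cell (\<Gamma>, \<lambda>_. 0)) ?B" using openin_open_box[OF gr] B(2) by blast
  have zB: "zero_edges \<Gamma> s = {}" if "s \<in> ?B" for s using zero_edges_generic subsetD[OF B(3) that] by blast
  have Uo: "openin (Mbar g n) ?U" by (rule openin_proj_image[OF \<Gamma> Bo zB])
  have Us: "?U \<subseteq> generic_locus g n" using B(3) \<Gamma> by (auto simp: generic_locus_def)
  have tC: "topspace ?C = ?B" using openin_subset[OF Bo] by auto
  have tU: "topspace (subtopology (Mbar g n) ?U) = ?U" using openin_subset[OF Uo] by auto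
  have "homeomorphic_map ?C (subtopology (Mbar g n) ?U) ?p"
  proof (rule bijective_open_imp_homeomorphic_map)
    show "continuous_map ?C (subtopology (Mbar g n) ?U) ?p"
      unfolding continuous_map_in_subtopology tC
      using continuous_map_from_subtopology[OF continuous_map_proj_cell[OF \<Gamma>]] by auto
    show "open_map ?C (subtopology (Mbar g n) ?U) ?p"
      unfolding open_map_def
    proof (intro allI impI)
      fix W assume W: "openin ?C W"
      then have WB: "W \<subseteq> ?B" using openin_subset[OF W] tC by simp
      have "openin (closed_cell (\<Gamma>, \<lambda>_. 0)) W" using W Bo by (simp add: openin_open_subtopology)
      then have "openin (Mbar g n) (?p ` W)" using openin_proj_image[OF \<Gamma>] zB WB by blast
      then show "openin (subtopology (Mbar g n) ?U) (?p ` W)"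
        using WB by (simp add: openin_open_subtopology[OF Uo] image_mono)
    qed
    show "?p ` topspace ?C = topspace (subtopology (Mbar g n) ?U)" unfolding tC tU ..
    show "inj_on ?p (topspace ?C)" unfolding tC using proj_injective_on_box[OF \<Gamma> B(3)] B(4) by blast
  qed
  then have h1: "?C homeomorphic_space subtopology (Mbar g n) ?U" by (rule homeomorphic_map_imp_homeomorphic_space)
  have "card (edges \<Gamma>) = ?d" by (rule card_edges_representative[OF \<Gamma> g2])
  then obtain b where b: "bij_betw b {..<?d} (edges \<Gamma>)"
    using ex_bij_betw_nat_finite[OF finite_edges[OF gr]] by (auto simp: atLeast0LessThan)
  define M where "M = subtopology (Euclidean_space ?d) (euclidean_box ?d (\<lambda>i. x (b i) - \<delta>) (\<lambda>i. x (b i) + \<delta>))"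
  have h2: "?C homeomorphic_space M"
    unfolding M_def by (rule open_box_homeomorphic[OF gr b]) (use B(2) in blast)
  have M: "topological_manifold ?d M" unfolding M_def by (rule topological_manifold_box)
  obtain G :: "nat monoid" and \<phi> where G: "finite (carrier G)" "group_action G (topspace M) \<phi>"
    "\<forall>g\<in>carrier G. homeomorphic_map M M (\<phi> g)" "M homeomorphic_space orbit_space G \<phi> M"
    using orbit_space_trivial_group[of M] by blast
  have "subtopology ?X ?U = subtopology (Mbar g n) ?U"
    using Us by (simp add: subtopology_subtopology Int_absorb1)
  moreover have "subtopology (Mbar g n) ?U homeomorphic_space orbit_space G \<phi> M"
    using h1 h2 G(4) by (meson homeomorphic_space_sym homeomorphic_space_trans)
  moreover have "openin ?X ?U" using Uo Us by (auto simp: openin_subtopology)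
  moreover have "y \<in> ?U" using B(1) y by blast
  ultimately show "\<exists>U (M :: (nat \<Rightarrow> real) topology) (G :: nat monoid) \<phi>.
        openin ?X U \<and> y \<in> U \<and> topological_manifold ?d M \<and>
        finite (carrier G) \<and> group_action G (topspace M) \<phi> \<and>
        (\<forall>g\<in>carrier G. homeomorphic_map M M (\<phi> g)) \<and>
        subtopology ?X U homeomorphic_space orbit_space G \<phi> M"
    using M G(1-3) by (intro exI[of _ ?U] exI[of _ M] exI[of _ G] exI[of _ \<phi>]) simp
qed

lemma pure_dimension_Mbar:
  assumes "g \<ge> 2"
  shows "pure_dimension (Mbar g n) (3 * g - 3 + n)"
  unfolding pure_dimension_def
  using openin_generic_locus dense_generic_locus orbifold_generic_locus[OF assms] by (intro exI conjI)

theorem theorem3p30: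
  fixes g n :: nat
  assumes "g \<ge> 2"
  shows "bij_betw (curve_class g n) (topspace (Mbar g n)) (curve_classes g n)
    \<and> compact_space (Mbar g n)
    \<and> Hausdorff_space (Mbar g n)
    \<and> pure_dimension (Mbar g n) (3 * g - 3 + n)
    \<and> connected_through_codim_one (Mbar g n) (3 * g - 3 + n)
        (stable_graphs g n) (stratum g n) stratum_dim"
  unfolding connected_through_codim_one_def codim_one_strata[OF assms]
  using bij_betw_curve_class compact_space_Mbar Hausdorff_space_Mbar pure_dimension_Mbar[OF assms]
    disjoint_strata Union_strata connectedin_stratum connectedin_codim_one by blast

end
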